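(* Let $\zeta_M$ be a Poisson point process on $\mathbb X$ with finite intensity measure $M(\mathrm dx)=m(x)\,\ell(\mathrm dx)$, and let $\Phi$ be a finite point process on $\mathbb X$ with Papangelou intensity $c$ (with respect to $\ell$). Then $$\Delta_{TV}^*(\Phi,\zeta_M)\le \int_{\mathbb X}\mathbb E\big[|m(x)-c(x,\Phi)|\big]\,\ell(\mathrm dx).$$
   Context: $\mathbb X$ is a locally compact metric space with its Borel $\sigma$-algebra, and $\ell$ is a Radon measure on $\mathbb X$ (not necessarily diffuse). $N_{\mathbb X}$ is the set of configurations, i.e. nonnegative-integer-valued measures on $\mathbb X$ finite on relatively compact Borel sets, with the smallest $\sigma$-algebra making $\phi\mapsto\phi(A)$ measurable for every relatively compact Borel $A$; $\widehat N_{\mathbb X}\subset N_{\mathbb X}$ is the set of finite configurations. Configurations are treated as (multi)sets of points: $\sum_{x\in\phi}f(x)=\int f\,\mathrm d\phi$, $\phi\setminus x=\phi-\delta_x$. A point process is a random element of $N_{\mathbb X}$; it is finite if it is a.s. in $\widehat N_{\mathbb X}$. A Papangelou intensity of $\Phi$ is a measurable $c:\mathbb X\times N_{\mathbb X}\to\mathbb R_+$ such that for all measurable $u:\mathbb X\times N_{\mathbb X}\to\mathbb R_+$, $$\mathbb E\Big[\sum_{x\in\Phi}u(x,\Phi\setminus x)\Big]=\int_{\mathbb X}\mathbb E[c(x,\Phi)u(x,\Phi)]\,\ell(\mathrm dx).$$ For measures $\nu_1,\nu_2$ on $\mathbb X$, $\Delta_{TV}(\nu_1,\nu_2)=\sup|\nu_1(A)-\nu_2(A)|$,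 the supremum being over Borel $A$ with $\nu_1(A),\nu_2(A)<\infty$. For point processes $\Phi_1,\Phi_2$ with laws $\mathbb P_1,\mathbb P_2$, $\Delta_{TV}^*(\Phi_1,\Phi_2)=\inf_{\mathbf C}\int\Delta_{TV}(\omega_1,\omega_2)\,\mathbf C(\mathrm d(\omega_1,\omega_2))$, the infimum being over all couplings $\mathbf C$ of $\mathbb P_1$ and $\mathbb P_2$ (Kantorovich-Rubinstein distance). *)

theory Defs
  imports "HOL-Probability.Probability"
begin

(* The underlying space is a type of class metric_space; local compactness is a hypothesis of the
   theorem, and no separability or sigma-compactness is assumed. On a locally compact space,
   local finiteness of a Borel measure is finiteness on compact sets. *)
definition radon_measure :: "'a::topological_space measure \<Rightarrow> bool" where
  "radon_measure L \<longleftrightarrow>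
     sets L = sets borel \<and>
     (\<forall>K. compact K \<longrightarrow> emeasure L K < \<infinity>) \<and>
     (\<forall>A\<in>sets borel. emeasure L A = (SUP K\<in>{K. compact K \<and> K \<subseteq> A}. emeasure L K))"

definition relcompact_borel :: "'a::topological_space set set" where
  "relcompact_borel = {A \<in> sets borel. compact (closure A)}"

definition configurations :: "'a::topological_space measure set" where
  "configurations =
     {\<phi>. sets \<phi> = sets borel \<and>
         (\<forall>A\<in>sets borel. emeasure \<phi> A \<in> range ennreal_of_enat) \<and>
         (\<forall>A\<in>relcompact_borel. emeasure \<phi> A < \<infinity>)}"

definition finite_configurations :: "'a::topological_space measure set" where
  "finite_configurations = {\<phi> \<in> configurations. emeasure \<phi> UNIV < \<infinity>}"

definition config_space :: "'a::topological_space measure measure" where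
  "config_space =
     sigma configurations
       {{\<phi> \<in> configurations. emeasure \<phi> A \<in> B} | A B.
          A \<in> relcompact_borel \<and> B \<in> sets borel}"

definition point_process :: "'w measure \<Rightarrow> ('w \<Rightarrow> 'a::topological_space measure) \<Rightarrow> bool" where
  "point_process P \<Phi> \<longleftrightarrow> prob_space P \<and> \<Phi> \<in> measurable P config_space"

definition finite_point_process :: "'w measure \<Rightarrow> ('w \<Rightarrow> 'a::topological_space measure) \<Rightarrow> bool" where
  "finite_point_process P \<Phi> \<longleftrightarrow>
     point_process P \<Phi> \<and> (AE \<omega> in P. \<Phi> \<omega> \<in> finite_configurations)"

(* The Poisson probabilities are written out because poisson_pmf is only specified for a
   strictly positive rate, and M A may be 0. *)
definition poisson_process ::
    "'w measure \<Rightarrow> 'a::topological_space measure \<Rightarrow> ('w \<Rightarrow> 'a measure) \<Rightarrow> bool" where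
  "poisson_process P M \<zeta> \<longleftrightarrow>
     point_process P \<zeta> \<and>
     (\<forall>A\<in>relcompact_borel. \<forall>n::nat.
        measure P {\<omega> \<in> space P. emeasure (\<zeta> \<omega>) A = of_nat n} =
          measure M A ^ n / fact n * exp (- measure M A)) \<and>
     (\<forall>(k::nat) A. A ` {..<k} \<subseteq> relcompact_borel \<and> disjoint_family_on A {..<k} \<longrightarrow>
        prob_space.indep_vars P (\<lambda>_. borel) (\<lambda>i \<omega>. emeasure (\<zeta> \<omega>) (A i)) {..<k})"

definition remove_point :: "'a::topological_space measure \<Rightarrow> 'a \<Rightarrow> 'a measure" where
  "remove_point \<phi> x = diff_measure \<phi> (return borel x)"

(* The sum over the points x of a configuration, with multiplicity, is the integral against it. *)
definition papangelou_intensity ::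
    "'w measure \<Rightarrow> 'a::topological_space measure \<Rightarrow> ('w \<Rightarrow> 'a measure) \<Rightarrow>
     ('a \<Rightarrow> 'a measure \<Rightarrow> real) \<Rightarrow> bool" where
  "papangelou_intensity P L \<Phi> c \<longleftrightarrow>
     case_prod c \<in> borel_measurable (borel \<Otimes>\<^sub>M config_space) \<and>
     (\<forall>x. \<forall>\<phi>\<in>configurations. 0 \<le> c x \<phi>) \<and>
     (\<forall>u :: 'a \<Rightarrow> 'a measure \<Rightarrow> real.
        case_prod u \<in> borel_measurable (borel \<Otimes>\<^sub>M config_space) \<and>
        (\<forall>x. \<forall>\<phi>\<in>configurations. 0 \<le> u x \<phi>) \<longrightarrow>
        (\<integral>\<^sup>+\<omega>. (\<integral>\<^sup>+x. ennreal (u x (remove_point (\<Phi> \<omega>) x)) \<partial>\<Phi> \<omega>) \<partial>P) =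
        (\<integral>\<^sup>+x. (\<integral>\<^sup>+\<omega>. ennreal (c x (\<Phi> \<omega>) * u x (\<Phi> \<omega>)) \<partial>P) \<partial>L))"

definition tv_dist :: "'a::topological_space measure \<Rightarrow> 'a measure \<Rightarrow> ennreal" where
  "tv_dist \<nu>\<^sub>1 \<nu>\<^sub>2 =
     (SUP A\<in>{A \<in> sets borel. emeasure \<nu>\<^sub>1 A < \<infinity> \<and> emeasure \<nu>\<^sub>2 A < \<infinity>}.
        ennreal \<bar>measure \<nu>\<^sub>1 A - measure \<nu>\<^sub>2 A\<bar>)"

definition couplings :: "'b measure \<Rightarrow> 'b measure \<Rightarrow> ('b \<times> 'b) measure set" where
  "couplings P\<^sub>1 P\<^sub>2 =
     {C. sets C = sets (P\<^sub>1 \<Otimes>\<^sub>M P\<^sub>2) \<and> distr C P\<^sub>1 fst = P\<^sub>1 \<and> distr C P\<^sub>2 snd = P\<^sub>2}"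

definition kr_tv_dist ::
    "'a::topological_space measure measure \<Rightarrow> 'a measure measure \<Rightarrow> ennreal" where
  "kr_tv_dist P\<^sub>1 P\<^sub>2 =
     (INF C\<in>couplings P\<^sub>1 P\<^sub>2. \<integral>\<^sup>+(\<omega>\<^sub>1, \<omega>\<^sub>2). tv_dist \<omega>\<^sub>1 \<omega>\<^sub>2 \<partial>C)"

end

theory Submission
  imports Defs
begin

text \<open>The Papangelou equation determines the law of \<open>\<Phi>\<close> from its value on the empty configuration: it
  has a density \<open>f\<close> with respect to a Poisson law, with \<open>f (\<phi> + \<delta>\<^sub>x) = c(x, \<phi>) f \<phi>\<close>. The law of \<open>\<zeta>\<close> has
  such a density \<open>p\<close> too, with \<open>m\<close> in place of \<open>c\<close>, by the Mecke equation. Put the points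
  \<open>y\<^sub>0, \<dots>, y\<^bsub>N-1\<^esub>\<close> of independent copies of \<open>\<Phi>\<close> and \<open>\<zeta>\<close> in a random order; given \<open>y\<close>, the set \<open>B\<close> of
  labels belonging to \<open>\<Phi>\<close> has weight \<open>W(B) = f(y\<^sub>B) p(y\<^bsub>-B\<^esub>)\<close>. Now run through the labels and
  move label \<open>t\<close> to the other side with probability \<open>min (W B) (W (B \<triangle> {t})) / W B\<close>. Each step
  preserves \<open>W\<close>, so for the final set \<open>B'\<close> the complement of \<open>B'\<close> still selects a copy of \<open>\<zeta>\<close>, and it
  differs from the copy of \<open>\<Phi>\<close> selected by \<open>B\<close> exactly in the labels that were not moved. Their
  expected number is the sum of \<open>\<bar>W(B \<union> {t}) - W(B)\<bar> = \<bar>c(y\<^sub>t, y\<^sub>B) - m(y\<^sub>t)\<bar> f(y\<^sub>B) p(\<dots>)\<close> over \<open>t\<close> and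
  \<open>B\<close> not containing \<open>t\<close>, and this integrates to the right-hand side.

  All of this takes place on a \<open>\<sigma>\<close>-compact set carrying both intensities, on which \<open>\<ell>\<close> may be replaced
  by an equivalent probability measure.\<close>

section \<open>Coupling a weight on subsets with its complement\<close>

text \<open>Existence of the density rests on an induction over the number of points in the carrying
  set \<open>S0\<close>: the equation reduces a null event for \<open>n + 1\<close> points to null
  events for \<open>n\<close> points, so the law is absolutely continuous. An infinite right-hand
  side is trivial; a finite one makes the mean number of points of \<open>\<Phi>\<close> finite,
  which this argument needs. The obstacle is measurability without separability.
  \<open>config_space\<close> only makes counts on relatively compact sets measurable, so counts are
  taken inside \<open>S0\<close>, a countable union of such sets. Equations between laws are written
  with \<open>add_point\<close>, which is measurable, and \<open>remove_point\<close> is undone as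
  soon as it appears. No measurability of \<open>tv_dist\<close> is at hand, so its integral is only
  bounded from above. The random order of labels becomes the constant
  \<open>exp (-2) / fact N\<close>: two independent reference samples of mean size 1 have together
  \<open>N\<close> points with probability \<open>exp (-2) * 2 ^ N / fact N\<close>, shared equally
  by the \<open>2 ^ N\<close> sets \<open>B\<close>.\<close>

definition flip :: "nat \<Rightarrow> nat set \<Rightarrow> nat set" where
  "flip t B = (if t \<in> B then B - {t} else insert t B)"

text \<open>Where \<open>W B = 0\<close> the division yields 0, so for nonnegative \<open>W\<close>
  the value stays in the unit interval and \<open>W B * switch_prob W t B\<close> is the minimum
  without exception.\<close>

definition switch_prob :: "(nat set \<Rightarrow> real) \<Rightarrow> nat \<Rightarrow> nat set \<Rightarrow> real" where
  "switch_prob W t B = min (W B) (W (flip t B)) / W B"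

text \<open>Joint weight of the initial set \<open>B\<close> and the set \<open>B'\<close> reached
  after labels \<open>0, ..., t - 1\<close> have been treated. The two summands of the step are
  staying at \<open>B'\<close> and arriving from its only other predecessor
  \<open>flip t B'\<close>.\<close>

primrec switch_coupling :: "(nat set \<Rightarrow> real) \<Rightarrow> nat \<Rightarrow> nat set \<Rightarrow> nat set \<Rightarrow> real" where
  "switch_coupling W 0 B B' = (if B = B' then W B else 0)"
| "switch_coupling W (Suc t) B B' =
     switch_coupling W t B B' * (1 - switch_prob W t B') +
     switch_coupling W t B (flip t B') * switch_prob W t (flip t B')"

lemma flip_flip [simp]: "flip t (flip t B) = B"
  by (auto simp: flip_def)

lemma mem_flip: "i \<in> flip t B \<longleftrightarrow> (if i = t then t \<notin> B else i \<in> B)"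
  by (auto simp: flip_def)

lemma flip_Pow: "t < n \<Longrightarrow> flip t B \<subseteq> {..<n} \<longleftrightarrow> B \<subseteq> {..<n}"
  by (auto simp: flip_def)

lemma sum_flip:
  assumes "t < n"
  shows "(\<Sum>B\<in>Pow {..<n}. g (flip t B)) = (\<Sum>B\<in>Pow {..<n}. g B)"
  by (rule sum.reindex_bij_witness[of _ "flip t" "flip t"]) (use assms flip_Pow in auto)

lemma switch_prob_mult:
  assumes "\<And>B. 0 \<le> W B"
  shows "W B * switch_prob W t B = min (W B) (W (flip t B))"
  using assms[of "flip t B"] by (cases "W B = 0") (auto simp: switch_prob_def)

lemma switch_prob_bounds:
  assumes "\<And>B. 0 \<le> W B"
  shows "0 \<le> switch_prob W t B" "switch_prob W t B \<le> 1"
  using assms[of B] assms[of "flip t B"] by (auto simp: switch_prob_def divide_le_eq_1)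

lemma switch_coupling_nonneg:
  assumes "\<And>B. 0 \<le> W B"
  shows "0 \<le> switch_coupling W t B B'"
  using switch_prob_bounds[OF assms] by (induction t arbitrary: B') (auto simp: assms)

text \<open>A step only redistributes mass among the final sets: re-indexing by
  \<open>flip t\<close> shows that the mass arriving by moves equals the mass leaving by
  moves.\<close>

lemma switch_coupling_row:
  assumes "t \<le> n" "B \<subseteq> {..<n}"
  shows "(\<Sum>B'\<in>Pow {..<n}. switch_coupling W t B B') = W B"
  using assms(1)
proof (induction t)
  case 0
  show ?case using assms(2) by (simp add: sum.delta)
next
  case (Suc t)
  have "(\<Sum>B'\<in>Pow {..<n}. switch_coupling W (Suc t) B B') =
     (\<Sum>B'\<in>Pow {..<n}. switch_coupling W t B B' * (1 - switch_prob W t B')) +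
     (\<Sum>B'\<in>Pow {..<n}. switch_coupling W t B (flip t B') * switch_prob W t (flip t B'))"
    by (simp add: sum.distrib)
  also have "(\<Sum>B'\<in>Pow {..<n}. switch_coupling W t B (flip t B') * switch_prob W t (flip t B')) =
     (\<Sum>B'\<in>Pow {..<n}. switch_coupling W t B B' * switch_prob W t B')"
    using Suc.prems by (subst sum_flip[symmetric, of t]) auto
  also have "(\<Sum>B'\<in>Pow {..<n}. switch_coupling W t B B' * (1 - switch_prob W t B')) + \<dots> =
     (\<Sum>B'\<in>Pow {..<n}. switch_coupling W t B B')"
    by (simp add: sum.distrib[symmetric] algebra_simps)
  finally show ?case using Suc by simp
qed

text \<open>Detailed balance: the mass moved from \<open>B'\<close> to \<open>flip t B'\<close> is
  \<open>min (W B') (W (flip t B'))\<close>, which is symmetric in the two sets, so each step leaves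
  \<open>W\<close> invariant.\<close>

lemma switch_coupling_col:
  assumes "\<And>B. 0 \<le> W B" "t \<le> n" "B' \<subseteq> {..<n}"
  shows "(\<Sum>B\<in>Pow {..<n}. switch_coupling W t B B') = W B'"
  using assms(2,3)
proof (induction t arbitrary: B')
  case 0
  then show ?case by simp
next
  case (Suc t)
  have "flip t B' \<subseteq> {..<n}"
    using Suc.prems flip_Pow[of t n B'] by simp
  with Suc have "(\<Sum>B\<in>Pow {..<n}. switch_coupling W (Suc t) B B') =
     W B' * (1 - switch_prob W t B') + W (flip t B') * switch_prob W t (flip t B')"
    by (simp add: sum.distrib sum_distrib_right[symmetric])
  also have "\<dots> = W B'"
    using switch_prob_mult[of W, OF assms(1)] by (simp add: algebra_simps min.commute)
  finally show ?case .
qed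

text \<open>Labels from \<open>t\<close> on have not been treated yet, so they sit where they
  started.\<close>

lemma switch_coupling_supp:
  assumes "switch_coupling W t B B' \<noteq> 0" "t \<le> i"
  shows "i \<in> B \<longleftrightarrow> i \<in> B'"
  using assms
proof (induction t arbitrary: B')
  case (Suc t)
  then have "switch_coupling W t B B' \<noteq> 0 \<or> switch_coupling W t B (flip t B') \<noteq> 0"
    by auto
  with Suc show ?case
    by (metis Suc_leD mem_flip not_less_eq_eq order_refl)
qed (auto split: if_splits)

text \<open>The labels that were not moved. As the second sample is read off the complement of
  \<open>B'\<close>, these are the labels belonging to exactly one of the two samples.\<close>

definition agree :: "nat \<Rightarrow> nat set \<Rightarrow> nat set \<Rightarrow> nat set" where
  "agree n B B' = {i. i < n \<and> (i \<in> B \<longleftrightarrow> i \<in> B')}"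

lemma finite_agree [simp]: "finite (agree n B B')"
  by (simp add: agree_def)

text \<open>Label \<open>t\<close> agrees before its own step, so staying adds one to the count and
  moving adds nothing. The increment is therefore the probability of staying, evaluated under the
  invariant weight \<open>W\<close>.\<close>

lemma switch_coupling_cost:
  assumes W: "\<And>B. 0 \<le> W B" and "t \<le> n"
  shows "(\<Sum>B\<in>Pow {..<n}. \<Sum>B'\<in>Pow {..<n}. switch_coupling W t B B' * card (agree t B B')) =
    (\<Sum>s<t. \<Sum>B\<in>Pow {..<n}. W B - min (W B) (W (flip s B)))"
  using assms(2)
proof (induction t)
  case 0
  then show ?case by (simp add: agree_def)
next
  case (Suc t)
  let ?C = "switch_coupling W t" and ?q = "switch_prob W t"
  have stay: "?C B B' * card (agree (Suc t) B B') = ?C B B' * (card (agree t B B') + 1)" for B B'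
  proof (cases "?C B B' = 0")
    case False
    then have "t \<in> B \<longleftrightarrow> t \<in> B'" by (rule switch_coupling_supp) simp
    then have "agree (Suc t) B B' = insert t (agree t B B')" "t \<notin> agree t B B'"
      by (auto simp: agree_def less_Suc_eq)
    then show ?thesis by simp
  qed simp
  have move: "?C B B' * card (agree (Suc t) B (flip t B')) = ?C B B' * card (agree t B B')" for B B'
  proof (cases "?C B B' = 0")
    case False
    then have "t \<in> B \<longleftrightarrow> t \<in> B'" by (rule switch_coupling_supp) simp
    then have "agree (Suc t) B (flip t B') = agree t B B'"
      by (auto simp: agree_def less_Suc_eq mem_flip)
    then show ?thesis by simp
  qed simp
  have "(\<Sum>B'\<in>Pow {..<n}. switch_coupling W (Suc t) B B' * card (agree (Suc t) B B')) =
    (\<Sum>B'\<in>Pow {..<n}. ?C B B' * card (agree t B B')) +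
    (\<Sum>B'\<in>Pow {..<n}. ?C B B' * (1 - ?q B'))" for B
  proof -
    have "(\<Sum>B'\<in>Pow {..<n}. switch_coupling W (Suc t) B B' * card (agree (Suc t) B B')) =
      (\<Sum>B'\<in>Pow {..<n}. (?C B B' * card (agree (Suc t) B B')) * (1 - ?q B')) +
      (\<Sum>B'\<in>Pow {..<n}. ?C B (flip t B') * card (agree (Suc t) B B') * ?q (flip t B'))"
      by (simp add: sum.distrib[symmetric] algebra_simps)
    also have "(\<Sum>B'\<in>Pow {..<n}. ?C B (flip t B') * card (agree (Suc t) B B') * ?q (flip t B')) =
       (\<Sum>B'\<in>Pow {..<n}. (?C B B' * card (agree (Suc t) B (flip t B'))) * ?q B')"
      using Suc.prems by (subst sum_flip[symmetric, of t]) auto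
    finally show ?thesis
      unfolding stay move by (simp add: sum.distrib[symmetric] algebra_simps)
  qed
  then have "(\<Sum>B\<in>Pow {..<n}. \<Sum>B'\<in>Pow {..<n}.
      switch_coupling W (Suc t) B B' * card (agree (Suc t) B B')) =
    (\<Sum>s<t. \<Sum>B\<in>Pow {..<n}. W B - min (W B) (W (flip s B))) +
    (\<Sum>B\<in>Pow {..<n}. \<Sum>B'\<in>Pow {..<n}. ?C B B' * (1 - ?q B'))"
    using Suc by (simp add: sum.distrib)
  also have "(\<Sum>B\<in>Pow {..<n}. \<Sum>B'\<in>Pow {..<n}. ?C B B' * (1 - ?q B')) =
    (\<Sum>B'\<in>Pow {..<n}. W B' * (1 - ?q B'))"
    using switch_coupling_col[OF W, of t n] Suc.prems
    by (subst sum.swap) (simp add: sum_distrib_right[symmetric])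
  also have "\<dots> = (\<Sum>B\<in>Pow {..<n}. W B - min (W B) (W (flip t B)))"
    using switch_prob_mult[of W, OF W] by (simp add: right_diff_distrib)
  finally show ?case by simp
qed

text \<open>Sets pair up as \<open>B\<close> and \<open>insert s B\<close>. Within a pair the two
  excesses over the common minimum are 0 and the absolute difference.\<close>

lemma sum_diff_min_flip:
  fixes W :: "nat set \<Rightarrow> real"
  assumes "s < n"
  shows "(\<Sum>B\<in>Pow {..<n}. W B - min (W B) (W (flip s B))) =
    (\<Sum>B\<in>Pow ({..<n} - {s}). \<bar>W (insert s B) - W B\<bar>)"
proof -
  let ?g = "\<lambda>B. W B - min (W B) (W (flip s B))"
  have "Pow {..<n} = insert s ` Pow ({..<n} - {s}) \<union> Pow ({..<n} - {s})"
    using Pow_insert[of s "{..<n} - {s}"] assms by (simp add: insert_absorb Un_commute)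
  moreover have "insert s ` Pow ({..<n} - {s}) \<inter> Pow ({..<n} - {s}) = {}"
    by auto
  ultimately have "sum ?g (Pow {..<n}) =
      sum ?g (insert s ` Pow ({..<n} - {s})) + sum ?g (Pow ({..<n} - {s}))"
    by (simp add: sum.union_disjoint)
  also have "sum ?g (insert s ` Pow ({..<n} - {s})) = (\<Sum>B\<in>Pow ({..<n} - {s}). ?g (insert s B))"
    by (subst sum.reindex) (auto simp: inj_on_def)
  also have "\<dots> + sum ?g (Pow ({..<n} - {s})) =
      (\<Sum>B\<in>Pow ({..<n} - {s}). \<bar>W (insert s B) - W B\<bar>)"
    unfolding sum.distrib[symmetric]
  proof (rule sum.cong[OF refl])
    fix B assume "B \<in> Pow ({..<n} - {s})"
    then have "flip s (insert s B) = B" "flip s B = insert s B"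
      by (auto simp: flip_def)
    then show "?g (insert s B) + ?g B = \<bar>W (insert s B) - W B\<bar>"
      by (simp add: min_def abs_real_def)
  qed
  finally show ?thesis .
qed

section \<open>Configurations\<close>

lemma relcompact_borel_sets: "A \<in> relcompact_borel \<Longrightarrow> A \<in> sets borel"
  by (simp add: relcompact_borel_def)

lemma relcompact_borel_subset:
  assumes "A \<in> relcompact_borel" "B \<subseteq> A" "B \<in> sets borel"
  shows "B \<in> relcompact_borel"
proof -
  have "closure B = closure A \<inter> closure B"
    using closure_mono[OF assms(2)] by auto
  with assms show ?thesis
    unfolding relcompact_borel_def
    by (metis (mono_tags, lifting) closed_closure compact_Int_closed mem_Collect_eq)
qed

lemma compact_relcompact_borel:
  fixes K :: "'a::t2_space set"
  shows "compact K \<Longrightarrow> K \<in> relcompact_borel"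
  by (simp add: relcompact_borel_def compact_imp_closed borel_closed)

lemma relcompact_borel_Un:
  "A \<in> relcompact_borel \<Longrightarrow> B \<in> relcompact_borel \<Longrightarrow> A \<union> B \<in> relcompact_borel"
  by (auto simp: relcompact_borel_def compact_Un)

lemma relcompact_borel_UN:
  "finite I \<Longrightarrow> (\<And>i. i \<in> I \<Longrightarrow> A i \<in> relcompact_borel) \<Longrightarrow> (\<Union>i\<in>I. A i) \<in> relcompact_borel"
proof (induction I rule: finite_induct)
  case empty
  then show ?case by (simp add: relcompact_borel_def)
next
  case (insert i I)
  then show ?case by (simp add: relcompact_borel_Un)
qed

lemma configurations_sets: "\<phi> \<in> configurations \<Longrightarrow> sets \<phi> = sets borel"
  by (simp add: configurations_def)

lemma configurations_space: "\<phi> \<in> configurations \<Longrightarrow> space \<phi> = UNIV"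
  using sets_eq_imp_space_eq[OF configurations_sets] by simp

lemma space_config_space [simp]: "space config_space = configurations"
  unfolding config_space_def by (subst space_measure_of) auto

lemma sets_config_space:
  "sets config_space = sigma_sets configurations
     {{\<phi> \<in> configurations. emeasure \<phi> A \<in> B} | A B. A \<in> relcompact_borel \<and> B \<in> sets borel}"
  unfolding config_space_def by (subst sets_measure_of) auto

lemma measurable_count:
  assumes "f \<in> measurable M config_space" "A \<in> relcompact_borel"
  shows "(\<lambda>\<omega>. emeasure (f \<omega>) A) \<in> borel_measurable M"
proof -
  have "(\<lambda>\<phi>. emeasure \<phi> A) \<in> borel_measurable config_space"
  proof (rule measurableI)
    fix B :: "ennreal set" assume "B \<in> sets borel"
    then have "{\<phi> \<in> configurations. emeasure \<phi> A \<in> B} \<in> sets config_space"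
      unfolding sets_config_space using assms(2) by (intro sigma_sets.Basic) auto
    moreover have "(\<lambda>\<phi>. emeasure \<phi> A) -` B \<inter> space config_space =
        {\<phi> \<in> configurations. emeasure \<phi> A \<in> B}"
      by auto
    ultimately show "(\<lambda>\<phi>. emeasure \<phi> A) -` B \<inter> space config_space \<in> sets config_space"
      by simp
  qed simp
  from measurable_compose[OF assms(1) this] show ?thesis .
qed

lemma measurable_config_spaceI:
  fixes f :: "'w \<Rightarrow> 'a::topological_space measure"
  assumes "\<And>\<omega>. \<omega> \<in> space M \<Longrightarrow> f \<omega> \<in> configurations"
    and "\<And>A. A \<in> relcompact_borel \<Longrightarrow> (\<lambda>\<omega>. emeasure (f \<omega>) A) \<in> borel_measurable M"
  shows "f \<in> measurable M config_space"
  unfolding config_space_def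
proof (rule measurable_measure_of)
  fix Y :: "'a measure set"
  assume "Y \<in> {{\<phi> \<in> configurations. emeasure \<phi> A \<in> B} | A B.
      A \<in> relcompact_borel \<and> B \<in> sets (borel :: ennreal measure)}"
  then obtain A B where Y: "Y = {\<phi> \<in> configurations. emeasure \<phi> A \<in> B}"
    and A: "A \<in> relcompact_borel" and B: "B \<in> sets borel"
    by blast
  have "f -` Y \<inter> space M = (\<lambda>\<omega>. emeasure (f \<omega>) A) -` B \<inter> space M"
    using assms(1) Y by auto
  then show "f -` Y \<inter> space M \<in> sets M"
    using measurable_sets[OF assms(2)[OF A] B] by simp
qed (use assms(1) in auto)

definition add_point :: "'a::topological_space \<Rightarrow> 'a measure \<Rightarrow> 'a measure" where
  "add_point x \<phi> = measure_of UNIV (sets borel) (\<lambda>A. emeasure \<phi> A + indicator A x)"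

lemma sets_add_point [simp]: "sets (add_point x \<phi>) = sets borel"
  unfolding add_point_def using sets.sigma_sets_eq[of borel]
  by (subst sets_measure_of) auto

lemma emeasure_add_point:
  assumes "sets \<phi> = sets borel" "A \<in> sets borel"
  shows "emeasure (add_point x \<phi>) A = emeasure \<phi> A + indicator A x"
  unfolding add_point_def
proof (rule emeasure_measure_of_sigma)
  show "sigma_algebra UNIV (sets borel :: 'a set set)"
    using sets.sigma_algebra_axioms[of borel] by simp
  show "positive (sets borel) (\<lambda>A. emeasure \<phi> A + indicator A x)"
    by (simp add: positive_def)
  show "countably_additive (sets borel) (\<lambda>A. emeasure \<phi> A + indicator A x)"
  proof (rule countably_additiveI)
    fix A :: "nat \<Rightarrow> 'a set"
    assume A: "range A \<subseteq> sets borel" "disjoint_family A"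
    have "(\<Sum>i. emeasure \<phi> (A i) + indicator (A i) x) =
        (\<Sum>i. emeasure \<phi> (A i)) + (\<Sum>i. indicator (A i) x)"
      by (rule suminf_add[symmetric]) auto
    also have "(\<Sum>i. emeasure \<phi> (A i)) = emeasure \<phi> (\<Union>i. A i)"
      using A assms(1) by (intro suminf_emeasure) auto
    also have "(\<Sum>i. indicator (A i) x :: ennreal) = indicator (\<Union>i. A i) x"
      using A(2) by (rule suminf_indicator)
    finally show "(\<Sum>i. emeasure \<phi> (A i) + indicator (A i) x) =
        emeasure \<phi> (\<Union>i. A i) + indicator (\<Union>i. A i) x" .
  qed
qed (use assms in auto)

lemma add_point_configurations [simp]:
  assumes "\<phi> \<in> configurations"
  shows "add_point x \<phi> \<in> configurations"
proof -
  note s = configurations_sets[OF assms]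
  have "emeasure (add_point x \<phi>) A \<in> range ennreal_of_enat" if A: "A \<in> sets borel" for A
  proof -
    obtain k where k: "emeasure \<phi> A = ennreal_of_enat k"
      using assms A by (auto simp: configurations_def)
    have "emeasure (add_point x \<phi>) A = ennreal_of_enat (k + (if x \<in> A then 1 else 0))"
      using k by (auto simp: emeasure_add_point[OF s A])
    then show ?thesis by blast
  qed
  moreover have "emeasure (add_point x \<phi>) A < \<infinity>" if "A \<in> relcompact_borel" for A
    using that assms relcompact_borel_sets[OF that]
    by (auto simp: emeasure_add_point[OF s] configurations_def indicator_def)
  ultimately show ?thesis
    by (auto simp: configurations_def)
qed

lemma measurable_add_point [measurable (raw)]:
  fixes f :: "'w \<Rightarrow> 'a::topological_space"
  assumes f: "f \<in> measurable M borel" and g: "g \<in> measurable M config_space"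
  shows "(\<lambda>\<omega>. add_point (f \<omega>) (g \<omega>)) \<in> measurable M config_space"
proof (rule measurable_config_spaceI)
  show "add_point (f \<omega>) (g \<omega>) \<in> configurations" if "\<omega> \<in> space M" for \<omega>
    using measurable_space[OF g that] by simp
  fix A :: "'a set" assume A: "A \<in> relcompact_borel"
  then have [measurable]: "A \<in> sets borel"
    by (rule relcompact_borel_sets)
  have "(\<lambda>\<omega>. emeasure (add_point (f \<omega>) (g \<omega>)) A) \<in> borel_measurable M \<longleftrightarrow>
      (\<lambda>\<omega>. emeasure (g \<omega>) A + indicator A (f \<omega>)) \<in> borel_measurable M"
    by (rule measurable_cong)
      (use measurable_space[OF g] in \<open>auto intro!: emeasure_add_point configurations_sets\<close>)
  also have "\<dots>"
    using f measurable_count[OF g A] by measurable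
  finally show "(\<lambda>\<omega>. emeasure (add_point (f \<omega>) (g \<omega>)) A) \<in> borel_measurable M" .
qed

text \<open>The sum of point masses at \<open>y i\<close> for \<open>i\<close> in \<open>B\<close>,
  as an image of counting measure. Labels with equal values contribute separately, so multiplicities
  are kept and no diffuseness is required.\<close>

definition points :: "('i \<Rightarrow> 'a::topological_space) \<Rightarrow> 'i set \<Rightarrow> 'a measure" where
  "points y B = distr (count_space B) borel y"

lemma sets_points [simp]: "sets (points y B) = sets borel"
  by (simp add: points_def)

lemma emeasure_points:
  assumes "finite B" "A \<in> sets borel"
  shows "emeasure (points y B) A = of_nat (card {i\<in>B. y i \<in> A})"
proof -
  have "y -` A \<inter> B = {i\<in>B. y i \<in> A}" by auto
  with assms show ?thesis
    by (simp add: points_def emeasure_distr emeasure_count_space_finite)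
qed

lemma points_configurations [simp]: "finite B \<Longrightarrow> points y B \<in> configurations"
  unfolding configurations_def
  by (auto simp: emeasure_points relcompact_borel_sets of_nat_less_top
      intro: range_eqI[where x = "enat n" for n])

lemma points_insert:
  fixes y :: "'i \<Rightarrow> 'a::topological_space"
  assumes "finite B" "t \<notin> B"
  shows "points y (insert t B) = add_point (y t) (points y B)"
proof (rule measure_eqI)
  fix A :: "'a set" assume "A \<in> sets (points y (insert t B))"
  then have A: "A \<in> sets borel" by simp
  have "{i \<in> insert t B. y i \<in> A} = (if y t \<in> A then insert t {i\<in>B. y i \<in> A} else {i\<in>B. y i \<in> A})"
    by auto
  then show "emeasure (points y (insert t B)) A = emeasure (add_point (y t) (points y B)) A"
    using assms A by (simp add: emeasure_points emeasure_add_point)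
qed simp

lemma points_cong: "(\<And>i. i \<in> B \<Longrightarrow> y i = z i) \<Longrightarrow> points y B = points z B"
  unfolding points_def by (rule distr_cong) auto

lemma measurable_points [measurable (raw)]:
  fixes y :: "'w \<Rightarrow> 'i \<Rightarrow> 'a::topological_space"
  assumes "finite B" "\<And>i. i \<in> B \<Longrightarrow> (\<lambda>\<omega>. y \<omega> i) \<in> measurable M borel"
  shows "(\<lambda>\<omega>. points (y \<omega>) B) \<in> measurable M config_space"
  using assms
proof (induction B rule: finite_induct)
  case empty
  have "points (y \<omega>) {} = points (\<lambda>_. undefined) ({} :: 'i set)" for \<omega>
    by (rule points_cong) auto
  then show ?case
    by (simp add: measurable_const)
next
  case (insert t B)
  then show ?case
    by (simp add: points_insert measurable_add_point)
qed

text \<open>Labels common to \<open>B\<close> and \<open>B'\<close> contribute equally to every set,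
  so only the symmetric difference can change a count.\<close>

lemma tv_dist_points_le:
  fixes y :: "'i \<Rightarrow> 'a::topological_space"
  assumes "finite B" "finite B'"
  shows "tv_dist (points y B) (points y B') \<le> of_nat (card (B - B' \<union> (B' - B)))"
  unfolding tv_dist_def
proof (rule SUP_least)
  fix A :: "'a set" assume "A \<in> {A \<in> sets borel. emeasure (points y B) A < \<infinity> \<and> emeasure (points y B') A < \<infinity>}"
  then have A: "A \<in> sets borel" by simp
  let ?c = "\<lambda>C. {i\<in>C. y i \<in> A}"
  have m: "measure (points y C) A = card (?c C)" if "finite C" for C
    using emeasure_points[OF that A, of y] by (simp add: measure_def)
  have "card (?c C) \<le> card (?c C') + card (C - C' \<union> (C' - C))" if "finite C" "finite C'" for C C'
  proof -
    have "card (?c C) \<le> card (?c C' \<union> (C - C' \<union> (C' - C)))"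
      using that by (intro card_mono) auto
    also have "\<dots> \<le> card (?c C') + card (C - C' \<union> (C' - C))"
      by (rule card_Un_le)
    finally show ?thesis .
  qed
  from this[OF assms] this[OF assms(2,1)]
  have "\<bar>real (card (?c B)) - real (card (?c B'))\<bar> \<le> real (card (B - B' \<union> (B' - B)))"
    by (simp add: Un_commute abs_le_iff)
  then show "ennreal \<bar>measure (points y B) A - measure (points y B') A\<bar>
      \<le> of_nat (card (B - B' \<union> (B' - B)))"
    unfolding m[OF assms(1)] m[OF assms(2)] ennreal_of_nat_eq_real_of_nat
    by (rule ennreal_leI)
qed

text \<open>Written as a density so that the restricted configuration keeps its space and
  \<open>\<sigma>\<close>-algebra and is again an element of \<open>configurations\<close>.\<close>

definition restr :: "'a set \<Rightarrow> 'a::topological_space measure \<Rightarrow> 'a measure" where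
  "restr S \<phi> = density \<phi> (indicator S)"

lemma sets_restr [simp]: "sets (restr S \<phi>) = sets \<phi>"
  by (simp add: restr_def)

lemma emeasure_restr:
  assumes "sets \<phi> = sets borel" "S \<in> sets borel" "A \<in> sets borel"
  shows "emeasure (restr S \<phi>) A = emeasure \<phi> (A \<inter> S)"
proof -
  have "emeasure (restr S \<phi>) A = (\<integral>\<^sup>+x. indicator S x * indicator A x \<partial>\<phi>)"
    unfolding restr_def using assms by (intro emeasure_density) auto
  also have "\<dots> = (\<integral>\<^sup>+x. indicator (A \<inter> S) x \<partial>\<phi>)"
    by (auto intro!: nn_integral_cong simp: indicator_def)
  also have "\<dots> = emeasure \<phi> (A \<inter> S)"
    using assms by (intro nn_integral_indicator) auto
  finally show ?thesis .
qed

lemma restr_configurations [simp]: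
  assumes "\<phi> \<in> configurations" "S \<in> sets borel"
  shows "restr S \<phi> \<in> configurations"
proof -
  note s = configurations_sets[OF assms(1)]
  have "emeasure \<phi> (A \<inter> S) < \<infinity>" if "A \<in> relcompact_borel" for A
    using assms relcompact_borel_subset[OF that, of "A \<inter> S"] relcompact_borel_sets[OF that]
    by (auto simp: configurations_def)
  moreover have "emeasure \<phi> (A \<inter> S) \<in> range ennreal_of_enat" if "A \<in> sets borel" for A
    using assms that by (auto simp: configurations_def)
  ultimately show ?thesis
    using s assms(2)
    by (simp add: configurations_def emeasure_restr relcompact_borel_sets del: image_iff)
qed

lemma configurations_ge_1:
  assumes "\<phi> \<in> configurations" "A \<in> sets borel" "emeasure \<phi> A \<noteq> 0"
  shows "1 \<le> emeasure \<phi> A"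
proof -
  obtain k where k: "emeasure \<phi> A = ennreal_of_enat k"
    using assms(1,2) by (auto simp: configurations_def)
  then have "k \<noteq> 0" using assms(3) by auto
  then have "1 \<le> k" by (simp add: one_eSuc ileI1)
  then have "ennreal_of_enat 1 \<le> ennreal_of_enat k"
    unfolding ennreal_of_enat_le_iff .
  with k show ?thesis by simp
qed

text \<open>A configuration of finite mass need not be purely atomic on a nonseparable space, but it is on
  compact sets: covering by finitely many balls of radius 1/n, all but countably many balls of
  measure zero can be discarded.\<close>
lemma AE_atom_on_compact:
  fixes \<phi> :: "'a::metric_space measure"
  assumes \<phi>: "\<phi> \<in> configurations" and K: "compact K"
  shows "AE x in \<phi>. x \<in> K \<longrightarrow> 1 \<le> emeasure \<phi> {x}"
proof -
  note s = configurations_sets[OF \<phi>]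
  have Krc: "K \<in> relcompact_borel" and Kb: "K \<in> sets borel"
    using K compact_relcompact_borel relcompact_borel_sets by blast+
  have "\<forall>e>0. \<exists>F. finite F \<and> K \<subseteq> (\<Union>x\<in>F. ball x e)"
    using K compact_eq_totally_bounded by blast
  then have "\<exists>F. finite F \<and> K \<subseteq> (\<Union>x\<in>F. ball x (1 / Suc n))" for n :: nat
    by simp
  then obtain F where F: "\<And>n. finite (F n)" "\<And>n. K \<subseteq> (\<Union>x\<in>F n. ball x (1 / Suc n))"
    by metis
  let ?N = "\<Union>n. \<Union>y\<in>{y\<in>F n. emeasure \<phi> (ball y (1 / Suc n) \<inter> K) = 0}. ball y (1 / Suc n) \<inter> K"
  have null: "?N \<in> null_sets \<phi>"
  proof (rule null_sets_UN)
    fix n :: nat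
    show "(\<Union>y\<in>{y\<in>F n. emeasure \<phi> (ball y (1 / Suc n) \<inter> K) = 0}. ball y (1 / Suc n) \<inter> K)
        \<in> null_sets \<phi>"
    proof (rule null_sets_UN')
      show "countable {y\<in>F n. emeasure \<phi> (ball y (1 / Suc n) \<inter> K) = 0}"
        using F(1)[of n] by (intro countable_finite) simp
    qed (use s Kb in \<open>auto simp: null_sets_def\<close>)
  qed
  have ge_1: "1 \<le> emeasure \<phi> {x}" if x: "x \<in> K" "x \<notin> ?N" for x
  proof -
    \<comment> \<open>A ball of radius \<open>1 / Suc n\<close> from the cover that contains
      \<open>x\<close> lies in the closed ball around \<open>x\<close> of twice the radius. Off
      \<open>?N\<close> its trace on \<open>K\<close> has nonzero, hence integer mass at least 1,
      and continuity from above carries the bound down to the singleton.\<close>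
    let ?B = "\<lambda>n::nat. cball x (2 / Suc n) \<inter> K"
    have ge: "1 \<le> emeasure \<phi> (?B n)" for n
    proof -
      obtain y where y: "y \<in> F n" "x \<in> ball y (1 / Suc n)"
        using F(2)[of n] x(1) by auto
      then have "emeasure \<phi> (ball y (1 / Suc n) \<inter> K) \<noteq> 0"
        using x by blast
      then have "1 \<le> emeasure \<phi> (ball y (1 / Suc n) \<inter> K)"
        using Kb by (intro configurations_ge_1[OF \<phi>]) auto
      also have "\<dots> \<le> emeasure \<phi> (?B n)"
      proof (rule emeasure_mono)
        have "dist x z \<le> 2 / Suc n" if "dist y z < 1 / Suc n" for z
        proof -
          have "dist x z \<le> dist x y + dist y z" by (rule dist_triangle)
          also have "\<dots> \<le> 1 / Suc n + 1 / Suc n"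
            using that y(2) by (intro add_mono) (simp_all add: dist_commute)
          finally show ?thesis by simp
        qed
        then show "ball y (1 / Suc n) \<inter> K \<subseteq> ?B n"
          unfolding subset_iff Int_iff mem_ball mem_cball by blast
        show "?B n \<in> sets \<phi>"
          unfolding s using Kb by (intro sets.Int[OF borel_closed[OF closed_cball]])
      qed
      finally show ?thesis .
    qed
    have "(\<lambda>n. emeasure \<phi> (?B n)) \<longlonglongrightarrow> emeasure \<phi> (\<Inter>n. ?B n)"
    proof (rule Lim_emeasure_decseq)
      show "range ?B \<subseteq> sets \<phi>"
        unfolding s using Kb by (intro image_subsetI sets.Int[OF borel_closed[OF closed_cball]])
      show "decseq ?B"
      proof (rule decseq_SucI)
        fix n
        have "2 / real (Suc (Suc n)) \<le> 2 / real (Suc n)"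
          by (rule divide_left_mono) auto
        then have "cball x (2 / Suc (Suc n)) \<subseteq> cball x (2 / Suc n)"
          by (rule subset_cball)
        then show "?B (Suc n) \<subseteq> ?B n"
          by blast
      qed
      show "emeasure \<phi> (?B n) \<noteq> \<infinity>" for n
      proof -
        have "?B n \<in> relcompact_borel"
          using Kb by (intro relcompact_borel_subset[OF Krc] sets.Int[OF borel_closed[OF closed_cball]]) auto
        then show ?thesis
          using \<phi> unfolding configurations_def by (simp add: less_top)
      qed
    qed
    then have "1 \<le> emeasure \<phi> (\<Inter>n. ?B n)"
      using ge by (intro Lim_bounded2[where N = 0]) auto
    also have "(\<Inter>n. ?B n) = {x}"
    proof -
      have "z = x" if "\<And>n::nat. dist x z \<le> 2 / Suc n" for z
      proof (rule ccontr)
        assume "z \<noteq> x"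
        then obtain n where "inverse (real (Suc n)) < dist x z / 2"
          using reals_Archimedean[of "dist x z / 2"] by auto
        with that[of n] show False by (simp add: field_simps)
      qed
      then show ?thesis
        using x(1) unfolding set_eq_iff INT_iff Int_iff mem_cball by force
    qed
    finally show ?thesis .
  qed
  show ?thesis
  proof (rule AE_I'[OF null])
    show "{x \<in> space \<phi>. \<not> (x \<in> K \<longrightarrow> 1 \<le> emeasure \<phi> {x})} \<subseteq> ?N"
      using ge_1 by blast
  qed
qed

text \<open>Mass at least 1 at \<open>x\<close> makes the point mass lie below \<open>\<phi>\<close>
  on every Borel set. Together with finiteness of \<open>\<phi>\<close> this makes
  \<open>diff_measure\<close> a genuine difference that adding the point undoes.\<close>

lemma add_point_remove_point:
  assumes \<phi>: "\<phi> \<in> finite_configurations" and x: "1 \<le> emeasure \<phi> {x}" "{x} \<in> sets borel"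
  shows "add_point x (remove_point \<phi> x) = \<phi>"
proof (rule measure_eqI)
  have c: "\<phi> \<in> configurations" using \<phi> by (simp add: finite_configurations_def)
  note s = configurations_sets[OF c]
  show "sets (add_point x (remove_point \<phi> x)) = sets \<phi>" by (simp add: s)
  fix A assume "A \<in> sets (add_point x (remove_point \<phi> x))"
  then have A: "A \<in> sets borel" by simp
  have ge: "indicator A x \<le> emeasure \<phi> A" if "A \<in> sets borel" for A
  proof (cases "x \<in> A")
    case True
    then have "emeasure \<phi> {x} \<le> emeasure \<phi> A"
      using that s by (intro emeasure_mono) auto
    with True x(1) show ?thesis by (auto intro: order_trans)
  qed simp
  have "emeasure (remove_point \<phi> x) A = emeasure \<phi> A - emeasure (return borel x) A"
    unfolding remove_point_def
  proof (rule emeasure_diff_measure)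
    show "finite_measure \<phi>"
      using \<phi> configurations_space[OF c]
      by (intro finite_measureI) (auto simp: finite_configurations_def)
    show "finite_measure (return borel x)"
      by (rule finite_measureI) simp
  qed (use A s ge in auto)
  moreover have "sets (remove_point \<phi> x) = sets borel"
    by (simp add: remove_point_def s)
  ultimately show "emeasure (add_point x (remove_point \<phi> x)) A = emeasure \<phi> A"
    using A ge[OF A] by (simp add: emeasure_add_point diff_add_cancel_ennreal)
qed

section \<open>Labelled points and their configurations\<close>

lemma pmf_poisson_Suc:
  "ennreal (pmf (poisson_pmf 1) (Suc n)) * of_nat (Suc n) = ennreal (pmf (poisson_pmf 1) n)"
proof -
  have "pmf (poisson_pmf 1) (Suc n) * real (Suc n) = pmf (poisson_pmf 1) n"
    unfolding pmf_poisson[OF zero_less_one] fact_Suc by (simp add: divide_simps del: of_nat_Suc)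
  moreover have "ennreal (pmf (poisson_pmf 1) (Suc n) * real (Suc n)) =
      ennreal (pmf (poisson_pmf 1) (Suc n)) * of_nat (Suc n)"
    unfolding ennreal_of_nat_eq_real_of_nat by (rule ennreal_mult[OF pmf_nonneg of_nat_0_le_iff])
  ultimately show ?thesis
    by (simp only:)
qed

locale reference = prob_space lam for lam :: "'a::topological_space measure" +
  assumes sets_lam [measurable_cong, simp]: "sets lam = sets borel"
begin

lemma space_lam [simp]: "space lam = UNIV"
  using sets_eq_imp_space_eq[OF sets_lam] by simp

lemma emeasure_lam_UNIV [simp]: "emeasure lam UNIV = 1"
  using emeasure_space_1 by simp

text \<open>The law of \<open>n\<close> independent points distributed as \<open>lam\<close>, built
  one point at a time without labels; \<open>nn_integral_points\<close> identifies it with labelled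
  samples.\<close>

primrec conf_law :: "nat \<Rightarrow> 'a measure measure" where
  "conf_law 0 = return config_space (null_measure borel)"
| "conf_law (Suc n) = distr (lam \<Otimes>\<^sub>M conf_law n) config_space (\<lambda>(x, \<phi>). add_point x \<phi>)"

lemma sets_conf_law [measurable_cong, simp]: "sets (conf_law n) = sets config_space"
  by (cases n) simp_all

lemma space_conf_law [simp]: "space (conf_law n) = configurations"
  using sets_eq_imp_space_eq[OF sets_conf_law] by simp

lemma points_empty: "points y {} = null_measure borel"
  by (rule measure_eqI) (simp_all add: emeasure_points)

lemma null_measure_configurations [simp]: "null_measure borel \<in> configurations"
  using points_configurations[of "{}" "\<lambda>_. undefined"] by (simp add: points_empty)

lemma prob_space_conf_law: "prob_space (conf_law n)"
proof (induction n)
  case 0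
  then show ?case by (auto intro!: prob_space_return)
next
  case (Suc n)
  interpret C: prob_space "conf_law n" by fact
  interpret P: pair_prob_space lam "conf_law n" ..
  show ?case
    unfolding conf_law.simps by (rule P.prob_space_distr) measurable
qed

declare conf_law.simps [simp del]

sublocale conf_law: prob_space "conf_law n" for n
  by (rule prob_space_conf_law)

lemma nn_integral_conf_law_0:
  assumes [measurable]: "F \<in> borel_measurable config_space"
  shows "(\<integral>\<^sup>+\<phi>. F \<phi> \<partial>conf_law 0) = F (null_measure borel)"
  by (simp add: conf_law.simps nn_integral_return)

lemma nn_integral_conf_law_Suc:
  assumes [measurable]: "F \<in> borel_measurable config_space"
  shows "(\<integral>\<^sup>+\<phi>. F \<phi> \<partial>conf_law (Suc n)) = (\<integral>\<^sup>+x. \<integral>\<^sup>+\<phi>. F (add_point x \<phi>) \<partial>conf_law n \<partial>lam)"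
proof -
  have "(\<integral>\<^sup>+\<phi>. F \<phi> \<partial>conf_law (Suc n)) =
      (\<integral>\<^sup>+z. F (case z of (x, \<phi>) \<Rightarrow> add_point x \<phi>) \<partial>(lam \<Otimes>\<^sub>M conf_law n))"
    unfolding conf_law.simps by (rule nn_integral_distr) measurable
  also have "\<dots> = (\<integral>\<^sup>+x. \<integral>\<^sup>+\<phi>. F (add_point x \<phi>) \<partial>conf_law n \<partial>lam)"
    by (subst conf_law.nn_integral_fst[symmetric]) simp_all
  finally show ?thesis .
qed

lemma emeasure_conf_law_configurations [simp]: "emeasure (conf_law n) configurations = 1"
  using conf_law.emeasure_space_1[of n] by simp

sublocale product_sigma_finite "\<lambda>_ :: nat. lam"
  by standard

lemma measurable_points_PiM [measurable]:
  "finite B \<Longrightarrow> B \<subseteq> I \<Longrightarrow> (\<lambda>y. points y B) \<in> measurable (PiM I (\<lambda>_. lam)) config_space"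
  by (rule measurable_points) (auto simp: measurable_cong_sets[OF refl sets_lam[symmetric]]
      intro!: measurable_component_singleton)

text \<open>Only the number of labels matters: each label, integrated out by Fubini, performs one
  step of the recursion of \<open>conf_law\<close>.\<close>

lemma nn_integral_points:
  assumes "finite B" "F \<in> borel_measurable config_space"
  shows "(\<integral>\<^sup>+y. F (points y B) \<partial>PiM B (\<lambda>_ :: nat. lam)) = (\<integral>\<^sup>+\<phi>. F \<phi> \<partial>conf_law (card B))"
  using assms
proof (induction B arbitrary: F rule: finite_induct)
  case empty
  interpret E: prob_space "PiM {} (\<lambda>_ :: nat. lam)"
    by (rule prob_space_PiM) (rule prob_space_axioms)
  from empty show ?case
    by (simp add: points_empty nn_integral_conf_law_0 E.emeasure_space_1)
next
  case (insert t B)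
  note [measurable] = insert.prems
  have "(\<integral>\<^sup>+y. F (points y (insert t B)) \<partial>PiM (insert t B) (\<lambda>_ :: nat. lam)) =
      (\<integral>\<^sup>+x. \<integral>\<^sup>+y. F (points (y(t := x)) (insert t B)) \<partial>PiM B (\<lambda>_. lam) \<partial>lam)"
    using insert.hyps by (intro product_nn_integral_insert_rev) measurable
  also have "\<dots> = (\<integral>\<^sup>+x. \<integral>\<^sup>+y. F (add_point x (points y B)) \<partial>PiM B (\<lambda>_. lam) \<partial>lam)"
  proof -
    have "points (y(t := x)) (insert t B) = add_point x (points y B)" for x and y :: "nat \<Rightarrow> 'a"
    proof -
      have "points (y(t := x)) B = points y B"
        using insert.hyps by (intro points_cong) auto
      then show ?thesis
        using insert.hyps by (simp add: points_insert)
    qed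
    then show ?thesis by simp
  qed
  also have "\<dots> = (\<integral>\<^sup>+x. \<integral>\<^sup>+\<phi>. F (add_point x \<phi>) \<partial>conf_law (card B) \<partial>lam)"
    by (intro nn_integral_cong insert.IH) measurable
  also have "\<dots> = (\<integral>\<^sup>+\<phi>. F \<phi> \<partial>conf_law (card (insert t B)))"
    using insert.hyps by (simp add: nn_integral_conf_law_Suc)
  finally show ?case .
qed

text \<open>One infinite sample serves every number \<open>N\<close> of labels; only labels below
  \<open>N\<close> are then read.\<close>

abbreviation labels :: "(nat \<Rightarrow> 'a) measure" where
  "labels \<equiv> PiM UNIV (\<lambda>_. lam)"

sublocale product_prob_space "\<lambda>_ :: nat. lam" UNIV
  by standard

lemma nn_integral_labels_restrict:
  assumes "finite J" "F \<in> borel_measurable (PiM J (\<lambda>_ :: nat. lam))"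
  shows "(\<integral>\<^sup>+y. F (restrict y J) \<partial>labels) = (\<integral>\<^sup>+y. F y \<partial>PiM J (\<lambda>_. lam))"
proof -
  have "(\<integral>\<^sup>+y. F y \<partial>PiM J (\<lambda>_. lam)) =
      (\<integral>\<^sup>+y. F y \<partial>distr labels (PiM J (\<lambda>_. lam)) (\<lambda>x. restrict x J))"
    using assms(1) by (subst distr_PiM_restrict_finite) auto
  also have "\<dots> = (\<integral>\<^sup>+y. F (restrict y J) \<partial>labels)"
    using assms by (intro nn_integral_distr measurable_restrict_subset) auto
  finally show ?thesis ..
qed

text \<open>Disjoint label sets carry independent samples, so the product measure splits and each
  side becomes a \<open>conf_law\<close>.\<close>

lemma nn_integral_points2:
  assumes B: "finite B" "finite R" "B \<inter> R = {}"
    and G [measurable]: "(\<lambda>(\<phi>, \<psi>). G \<phi> \<psi>) \<in> borel_measurable (config_space \<Otimes>\<^sub>M config_space)"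
  shows "(\<integral>\<^sup>+y. G (points y B) (points y R) \<partial>PiM (B \<union> R) (\<lambda>_ :: nat. lam)) =
    (\<integral>\<^sup>+\<phi>. \<integral>\<^sup>+\<psi>. G \<phi> \<psi> \<partial>conf_law (card R) \<partial>conf_law (card B))"
proof -
  have [measurable]: "(\<lambda>y. points y B) \<in> measurable (PiM (B \<union> R) (\<lambda>_. lam)) config_space"
    "(\<lambda>y. points y R) \<in> measurable (PiM (B \<union> R) (\<lambda>_. lam)) config_space"
    "(\<lambda>y. points y B) \<in> measurable (PiM B (\<lambda>_. lam)) config_space"
    "(\<lambda>y. points y R) \<in> measurable (PiM R (\<lambda>_. lam)) config_space"
    using B by (auto intro!: measurable_points_PiM)
  have m: "(\<lambda>y. G (points y B) (points y R)) \<in> borel_measurable (PiM (B \<union> R) (\<lambda>_. lam))"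
    by measurable
  have "(\<integral>\<^sup>+y. G (points y B) (points y R) \<partial>PiM (B \<union> R) (\<lambda>_ :: nat. lam)) =
    (\<integral>\<^sup>+y. \<integral>\<^sup>+z. G (points (merge B R (y, z)) B) (points (merge B R (y, z)) R)
       \<partial>PiM R (\<lambda>_. lam) \<partial>PiM B (\<lambda>_. lam))"
    using product_nn_integral_fold[OF B(3,1,2) m] .
  also have "\<dots> = (\<integral>\<^sup>+y. \<integral>\<^sup>+z. G (points y B) (points z R) \<partial>PiM R (\<lambda>_. lam) \<partial>PiM B (\<lambda>_. lam))"
  proof -
    have "points (merge B R (y, z)) B = points y B" "points (merge B R (y, z)) R = points z R"
      for y z :: "nat \<Rightarrow> 'a"
      using B(3) by (auto intro!: points_cong simp: merge_def)
    then show ?thesis by simp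
  qed
  also have "\<dots> = (\<integral>\<^sup>+y. \<integral>\<^sup>+\<psi>. G (points y B) \<psi> \<partial>conf_law (card R) \<partial>PiM B (\<lambda>_. lam))"
  proof (rule nn_integral_cong)
    fix y assume y: "y \<in> space (PiM B (\<lambda>_ :: nat. lam))"
    have "points y B \<in> space config_space" using B by simp
    then show "(\<integral>\<^sup>+z. G (points y B) (points z R) \<partial>PiM R (\<lambda>_. lam)) =
        (\<integral>\<^sup>+\<psi>. G (points y B) \<psi> \<partial>conf_law (card R))"
      using B(2) by (intro nn_integral_points) auto
  qed
  also have "\<dots> = (\<integral>\<^sup>+\<phi>. \<integral>\<^sup>+\<psi>. G \<phi> \<psi> \<partial>conf_law (card R) \<partial>conf_law (card B))"
    by (rule nn_integral_points) (use B in measurable)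
  finally show ?thesis .
qed

text \<open>The same independence with one distinguished label \<open>t\<close> outside both sets;
  it will be the point \<open>x\<close> of the final bound.\<close>

lemma nn_integral_labels3:
  assumes B: "finite B" "finite R" "B \<inter> R = {}" "t \<notin> B \<union> R"
    and G [measurable]: "(\<lambda>(x, \<phi>, \<psi>). G x \<phi> \<psi>) \<in>
      borel_measurable (borel \<Otimes>\<^sub>M (config_space \<Otimes>\<^sub>M config_space))"
  shows "(\<integral>\<^sup>+y. G (y t) (points y B) (points y R) \<partial>labels) =
    (\<integral>\<^sup>+x. \<integral>\<^sup>+\<phi>. \<integral>\<^sup>+\<psi>. G x \<phi> \<psi> \<partial>conf_law (card R) \<partial>conf_law (card B) \<partial>lam)"
proof -
  let ?J = "insert t (B \<union> R)"
  have B_meas: "(\<lambda>y. points y B) \<in> measurable (PiM ?J (\<lambda>_. lam)) config_space"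
    and R_meas: "(\<lambda>y. points y R) \<in> measurable (PiM ?J (\<lambda>_. lam)) config_space"
    using B by (auto intro!: measurable_points_PiM)
  have t_meas: "(\<lambda>y. y t) \<in> measurable (PiM ?J (\<lambda>_. lam)) borel"
    by (auto simp: measurable_cong_sets[OF refl sets_lam[symmetric]]
      intro!: measurable_component_singleton)
  have m: "(\<lambda>y. G (y t) (points y B) (points y R)) \<in> borel_measurable (PiM ?J (\<lambda>_. lam))"
    using measurable_compose[OF measurable_Pair[OF t_meas measurable_Pair[OF B_meas R_meas]] G]
    by simp
  have "points (restrict y ?J) B = points y B" "points (restrict y ?J) R = points y R"
    for y :: "nat \<Rightarrow> 'a"
    by (auto intro!: points_cong)
  then have "(\<integral>\<^sup>+y. G (y t) (points y B) (points y R) \<partial>labels) =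
    (\<integral>\<^sup>+y. G (restrict y ?J t) (points (restrict y ?J) B) (points (restrict y ?J) R) \<partial>labels)"
    by simp
  also have "\<dots> = (\<integral>\<^sup>+y. G (y t) (points y B) (points y R) \<partial>PiM ?J (\<lambda>_. lam))"
    using B by (intro nn_integral_labels_restrict m) auto
  also have "\<dots> = (\<integral>\<^sup>+x. \<integral>\<^sup>+y. G ((y(t := x)) t) (points (y(t := x)) B) (points (y(t := x)) R)
      \<partial>PiM (B \<union> R) (\<lambda>_. lam) \<partial>lam)"
    using B by (intro product_nn_integral_insert_rev m) auto
  also have "\<dots> = (\<integral>\<^sup>+x. \<integral>\<^sup>+y. G x (points y B) (points y R) \<partial>PiM (B \<union> R) (\<lambda>_. lam) \<partial>lam)"
  proof -
    have "points (y(t := x)) B = points y B" "points (y(t := x)) R = points y R"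
      for y :: "nat \<Rightarrow> 'a" and x
      using B(4) by (auto intro!: points_cong)
    then show ?thesis by simp
  qed
  also have "\<dots> = (\<integral>\<^sup>+x. \<integral>\<^sup>+\<phi>. \<integral>\<^sup>+\<psi>. G x \<phi> \<psi> \<partial>conf_law (card R) \<partial>conf_law (card B) \<partial>lam)"
    using B by (intro nn_integral_cong nn_integral_points2) auto
  finally show ?thesis .
qed

lemma nn_integral_labels2:
  assumes B: "finite B" "finite R" "B \<inter> R = {}"
    and G [measurable]: "(\<lambda>(\<phi>, \<psi>). G \<phi> \<psi>) \<in> borel_measurable (config_space \<Otimes>\<^sub>M config_space)"
  shows "(\<integral>\<^sup>+y. G (points y B) (points y R) \<partial>labels) =
    (\<integral>\<^sup>+\<phi>. \<integral>\<^sup>+\<psi>. G \<phi> \<psi> \<partial>conf_law (card R) \<partial>conf_law (card B))"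
proof -
  \<comment> \<open>A dummy label: the integrand ignores its position, and \<open>lam\<close> has
    mass 1.\<close>
  obtain t where t: "t \<notin> B \<union> R"
    using ex_new_if_finite[OF infinite_UNIV_nat, of "B \<union> R"] B by auto
  have "(\<lambda>(x :: 'a, \<phi>, \<psi>). G \<phi> \<psi>) \<in> borel_measurable (borel \<Otimes>\<^sub>M (config_space \<Otimes>\<^sub>M config_space))"
    using measurable_compose[OF measurable_snd G] by (simp add: case_prod_beta)
  from nn_integral_labels3[OF B t this] show ?thesis
    by simp
qed

text \<open>The law of a Poisson process with intensity \<open>lam\<close>: as \<open>lam\<close>
  has mass 1, the number of points is Poisson of rate 1, and given it the points are
  independent.\<close>

definition ref :: "'a measure measure" where
  "ref = measure_pmf (poisson_pmf 1) \<bind> conf_law"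

lemma measurable_conf_law [measurable]:
  "conf_law \<in> measurable (measure_pmf p) (subprob_algebra config_space)"
  by (auto simp: space_subprob_algebra intro: conf_law.subprob_space_axioms)

lemma sets_ref [measurable_cong, simp]: "sets ref = sets config_space"
  unfolding ref_def by (rule sets_bind) auto

lemma space_ref [simp]: "space ref = configurations"
  using sets_eq_imp_space_eq[OF sets_ref] by simp

lemma nn_integral_ref:
  assumes "F \<in> borel_measurable config_space"
  shows "(\<integral>\<^sup>+\<phi>. F \<phi> \<partial>ref) = (\<integral>\<^sup>+n. \<integral>\<^sup>+\<phi>. F \<phi> \<partial>conf_law n \<partial>measure_pmf (poisson_pmf 1))"
  unfolding ref_def by (rule nn_integral_bind[OF assms measurable_conf_law])

lemma nn_integral_ref_suminf:
  assumes "F \<in> borel_measurable config_space"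
  shows "(\<integral>\<^sup>+\<phi>. F \<phi> \<partial>ref) =
    (\<Sum>n. ennreal (pmf (poisson_pmf 1) n) * (\<integral>\<^sup>+\<phi>. F \<phi> \<partial>conf_law n))"
  using assms by (simp add: nn_integral_ref nn_integral_measure_pmf nn_integral_count_space_nat
      del: pmf_poisson)

lemma prob_space_ref: "prob_space ref"
proof
  have "emeasure ref (space ref) = (\<integral>\<^sup>+\<phi>. 1 \<partial>ref)"
    by simp
  also have "\<dots> = 1"
    by (subst nn_integral_ref) simp_all
  finally show "emeasure ref (space ref) = 1" .
qed

sublocale ref: prob_space ref
  by (rule prob_space_ref)

text \<open>Every \<open>n\<close> has positive Poisson probability, so a null set of the mixture is
  null for each component.\<close>

lemma AE_ref_conf_law:
  assumes "AE \<phi> in ref. Q \<phi>"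
  shows "AE \<phi> in conf_law n. Q \<phi>"
proof -
  from assms obtain N
    where N: "{\<phi> \<in> space ref. \<not> Q \<phi>} \<subseteq> N" "emeasure ref N = 0" "N \<in> sets ref"
    by (rule AE_E)
  have "(\<integral>\<^sup>+n. emeasure (conf_law n) N \<partial>measure_pmf (poisson_pmf 1)) = 0"
    using N nn_integral_ref[of "indicator N"] by simp
  then have "emeasure (conf_law n) N = 0"
    by (simp add: nn_integral_0_iff_AE AE_measure_pmf_iff)
  then show ?thesis
    using N by (intro AE_I[of _ _ N]) auto
qed

end

section \<open>The Mecke equation of the reference law\<close>

lemma add_point_commute:
  assumes "sets \<phi> = sets borel"
  shows "add_point x (add_point y \<phi>) = add_point y (add_point x \<phi>)"
  by (rule measure_eqI) (simp_all add: emeasure_add_point assms ac_simps)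

text \<open>The sets \<open>K j\<close> exhaust \<open>S0\<close> by relatively compact pieces,
  which is what makes the number of points in a Borel subset of \<open>S0\<close> a measurable
  function of the configuration.\<close>

locale carrier = reference lam for lam :: "'a::topological_space measure" +
  fixes K :: "nat \<Rightarrow> 'a set" and S0 :: "'a set"
  assumes K_relcompact: "\<And>j. K j \<in> relcompact_borel"
    and S0_def: "S0 = (\<Union>j. K j)"
    and AE_S0: "AE x in lam. x \<in> S0"
begin

lemma S0_sets [measurable, simp]: "S0 \<in> sets borel"
  using K_relcompact relcompact_borel_sets unfolding S0_def by blast

lemma relcompact_partial_union: "(\<Union>i\<le>j. K i) \<in> relcompact_borel"
  using K_relcompact by (intro relcompact_borel_UN) auto

text \<open>The count is the supremum of the counts on the intersections with finite unions of the
  \<open>K j\<close>, which are relatively compact.\<close>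

lemma measurable_count_subset:
  assumes f: "f \<in> measurable M config_space" and A: "A \<in> sets borel" "A \<subseteq> S0"
  shows "(\<lambda>\<omega>. emeasure (f \<omega>) A) \<in> borel_measurable M"
proof -
  let ?A = "\<lambda>j. A \<inter> (\<Union>i\<le>j. K i)"
  have rc: "?A j \<in> relcompact_borel" for j
    using A(1) relcompact_borel_sets[OF relcompact_partial_union[of j]]
    by (intro relcompact_borel_subset[OF relcompact_partial_union[of j]]) auto
  have UN: "(\<Union>j. ?A j) = A"
    using A(2) unfolding S0_def by auto
  have inc: "incseq ?A"
    by (rule incseq_SucI) (auto simp: atMost_Suc)
  have "emeasure (f \<omega>) A = (SUP j. emeasure (f \<omega>) (?A j))" if "\<omega> \<in> space M" for \<omega>
  proof -
    have "f \<omega> \<in> configurations"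
      using measurable_space[OF f that] by simp
    then have "(SUP j. emeasure (f \<omega>) (?A j)) = emeasure (f \<omega>) (\<Union>j. ?A j)"
      using relcompact_borel_sets[OF rc]
      by (intro SUP_emeasure_incseq inc) (auto simp: configurations_sets)
    then show ?thesis
      by (simp only: UN)
  qed
  moreover have "(\<lambda>\<omega>. SUP j. emeasure (f \<omega>) (?A j)) \<in> borel_measurable M"
    using measurable_count[OF f rc] by measurable
  ultimately show ?thesis
    by (simp cong: measurable_cong)
qed

text \<open>By exchangeability each of the \<open>n + 1\<close> points may play the part of the last
  one. In the induction the indicator of the last point gives one copy of the right-hand integral,
  and the count of the others gives \<open>n\<close> more copies by the induction hypothesis, after
  exchanging two points by Fubini and \<open>add_point_commute\<close>.\<close>

lemma conf_law_mecke:
  assumes A [measurable]: "A \<in> sets borel" and sub: "A \<subseteq> S0"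
    and G: "G \<in> borel_measurable config_space"
  shows "(\<integral>\<^sup>+\<phi>. emeasure \<phi> A * G \<phi> \<partial>conf_law (Suc n)) =
    of_nat (Suc n) * (\<integral>\<^sup>+x. indicator A x * (\<integral>\<^sup>+\<phi>. G (add_point x \<phi>) \<partial>conf_law n) \<partial>lam)"
proof -
  interpret LL: pair_sigma_finite lam lam ..
  define cnt where "cnt = (\<lambda>\<phi>. emeasure \<phi> A)"
  have [measurable]: "cnt \<in> borel_measurable config_space"
    unfolding cnt_def by (rule measurable_count_subset[OF _ A sub]) simp
  have cnt_null: "cnt (null_measure borel) = 0"
    by (simp add: cnt_def)
  have cnt_add: "cnt (add_point x \<phi>) = cnt \<phi> + indicator A x" if "\<phi> \<in> configurations" for x \<phi>
    using that A by (simp add: cnt_def emeasure_add_point configurations_sets)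
  have "(\<integral>\<^sup>+\<phi>. cnt \<phi> * G \<phi> \<partial>conf_law (Suc n)) =
    of_nat (Suc n) * (\<integral>\<^sup>+x. indicator A x * (\<integral>\<^sup>+\<phi>. G (add_point x \<phi>) \<partial>conf_law n) \<partial>lam)"
    using G
  proof (induction n arbitrary: G)
    case (0 G)
    note [measurable] = 0
    have "(\<integral>\<^sup>+\<phi>. cnt \<phi> * G \<phi> \<partial>conf_law (Suc 0)) =
        (\<integral>\<^sup>+x. \<integral>\<^sup>+\<phi>. cnt (add_point x \<phi>) * G (add_point x \<phi>) \<partial>conf_law 0 \<partial>lam)"
      by (rule nn_integral_conf_law_Suc) measurable
    also have "\<dots> = (\<integral>\<^sup>+x. cnt (add_point x (null_measure borel)) *
        G (add_point x (null_measure borel)) \<partial>lam)"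
      by (intro nn_integral_cong nn_integral_conf_law_0) measurable
    also have "\<dots> = (\<integral>\<^sup>+x. indicator A x * (\<integral>\<^sup>+\<phi>. G (add_point x \<phi>) \<partial>conf_law 0) \<partial>lam)"
      by (intro nn_integral_cong, subst nn_integral_conf_law_0)
        (simp_all add: cnt_add cnt_null)
    finally show ?case by simp
  next
    case (Suc n G)
    note [measurable] = Suc.prems
    let ?H = "\<lambda>x z. \<integral>\<^sup>+\<phi>. G (add_point x (add_point z \<phi>)) \<partial>conf_law n"
    let ?I = "\<lambda>m. \<integral>\<^sup>+x. indicator A x * (\<integral>\<^sup>+\<phi>. G (add_point x \<phi>) \<partial>conf_law m) \<partial>lam"
    have "(\<integral>\<^sup>+\<phi>. cnt \<phi> * G \<phi> \<partial>conf_law (Suc (Suc n))) =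
        (\<integral>\<^sup>+x. \<integral>\<^sup>+\<phi>. cnt (add_point x \<phi>) * G (add_point x \<phi>) \<partial>conf_law (Suc n) \<partial>lam)"
      by (rule nn_integral_conf_law_Suc) measurable
    also have "\<dots> = (\<integral>\<^sup>+x. (\<integral>\<^sup>+\<phi>. cnt \<phi> * G (add_point x \<phi>) +
        indicator A x * G (add_point x \<phi>) \<partial>conf_law (Suc n)) \<partial>lam)"
      by (intro nn_integral_cong)
        (simp add: cnt_add distrib_right)
    also have "\<dots> = (\<integral>\<^sup>+x. (\<integral>\<^sup>+\<phi>. cnt \<phi> * G (add_point x \<phi>) \<partial>conf_law (Suc n)) +
        indicator A x * (\<integral>\<^sup>+\<phi>. G (add_point x \<phi>) \<partial>conf_law (Suc n)) \<partial>lam)"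
      by (intro nn_integral_cong) (simp add: nn_integral_add nn_integral_cmult)
    also have "\<dots> = (\<integral>\<^sup>+x. (\<integral>\<^sup>+\<phi>. cnt \<phi> * G (add_point x \<phi>) \<partial>conf_law (Suc n)) \<partial>lam) +
        ?I (Suc n)"
      by (intro nn_integral_add) measurable
    also have "(\<integral>\<^sup>+x. (\<integral>\<^sup>+\<phi>. cnt \<phi> * G (add_point x \<phi>) \<partial>conf_law (Suc n)) \<partial>lam) =
        (\<integral>\<^sup>+x. of_nat (Suc n) * (\<integral>\<^sup>+z. indicator A z *
          ?H x z \<partial>lam) \<partial>lam)"
      by (intro nn_integral_cong Suc.IH) measurable
    also have "\<dots> = of_nat (Suc n) * (\<integral>\<^sup>+x. (\<integral>\<^sup>+z. indicator A z *
          ?H x z \<partial>lam) \<partial>lam)"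
      by (rule nn_integral_cmult) measurable
    also have "(\<integral>\<^sup>+x. (\<integral>\<^sup>+z. indicator A z *
          ?H x z \<partial>lam) \<partial>lam) =
        (\<integral>\<^sup>+z. (\<integral>\<^sup>+x. indicator A z *
          ?H x z \<partial>lam) \<partial>lam)"
      by (intro LL.Fubini') measurable
    also have "\<dots> = (\<integral>\<^sup>+z. indicator A z * (\<integral>\<^sup>+x. (\<integral>\<^sup>+\<phi>. G (add_point z (add_point x \<phi>))
        \<partial>conf_law n) \<partial>lam) \<partial>lam)"
    proof (rule nn_integral_cong)
      fix z
      have "(\<integral>\<^sup>+x. indicator A z * ?H x z \<partial>lam) =
        indicator A z * (\<integral>\<^sup>+x. ?H x z \<partial>lam)"
        by (rule nn_integral_cmult) measurable
      also have "(\<integral>\<^sup>+x. ?H x z \<partial>lam) =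
        (\<integral>\<^sup>+x. (\<integral>\<^sup>+\<phi>. G (add_point z (add_point x \<phi>)) \<partial>conf_law n) \<partial>lam)"
        by (intro nn_integral_cong) (simp add: add_point_commute configurations_sets)
      finally show "(\<integral>\<^sup>+x. indicator A z * ?H x z \<partial>lam) =
        indicator A z * (\<integral>\<^sup>+x. (\<integral>\<^sup>+\<phi>. G (add_point z (add_point x \<phi>)) \<partial>conf_law n) \<partial>lam)" .
    qed
    also have "\<dots> = ?I (Suc n)"
      by (intro nn_integral_cong, subst nn_integral_conf_law_Suc) simp_all
    also have "of_nat (Suc n) * ?I (Suc n) + ?I (Suc n) = of_nat (Suc (Suc n)) * ?I (Suc n)"
      by (simp add: distrib_right add.commute)
    finally show ?case .
  qed
  then show ?thesis
    by (simp only: cnt_def)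
qed

text \<open>The factor \<open>Suc n\<close> of the fixed-size identity is absorbed by
  \<open>pmf_poisson_Suc\<close>, which shifts the Poisson weights by one.\<close>

lemma ref_mecke:
  assumes A [measurable]: "A \<in> sets borel" and sub: "A \<subseteq> S0"
    and G [measurable]: "G \<in> borel_measurable config_space"
  shows "(\<integral>\<^sup>+\<phi>. emeasure \<phi> A * G \<phi> \<partial>ref) =
    (\<integral>\<^sup>+x. indicator A x * (\<integral>\<^sup>+\<phi>. G (add_point x \<phi>) \<partial>ref) \<partial>lam)"
proof -
  define cnt where "cnt = (\<lambda>\<phi>. emeasure \<phi> A)"
  have [measurable]: "cnt \<in> borel_measurable config_space"
    unfolding cnt_def by (rule measurable_count_subset[OF _ A sub]) simp
  have cnt_null: "cnt (null_measure borel) = 0"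
    by (simp add: cnt_def)
  let ?w = "\<lambda>n. ennreal (pmf (poisson_pmf 1) n)"
  let ?J = "\<lambda>n x. \<integral>\<^sup>+\<phi>. G (add_point x \<phi>) \<partial>conf_law n"
  have mecke: "(\<integral>\<^sup>+\<phi>. cnt \<phi> * G \<phi> \<partial>conf_law (Suc n)) =
    of_nat (Suc n) * (\<integral>\<^sup>+x. indicator A x * ?J n x \<partial>lam)" for n
    using conf_law_mecke[OF A sub G] by (simp only: cnt_def)
  have 0: "(\<integral>\<^sup>+\<phi>. cnt \<phi> * G \<phi> \<partial>conf_law 0) = 0"
    by (subst nn_integral_conf_law_0) (simp_all add: cnt_null)
  have "(\<integral>\<^sup>+\<phi>. cnt \<phi> * G \<phi> \<partial>ref) =
      (\<Sum>n. ?w n * (\<integral>\<^sup>+\<phi>. cnt \<phi> * G \<phi> \<partial>conf_law n))"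
    by (rule nn_integral_ref_suminf) measurable
  also have "\<dots> = (\<Sum>n. ?w (Suc n) * (\<integral>\<^sup>+\<phi>. cnt \<phi> * G \<phi> \<partial>conf_law (Suc n)))"
    by (subst suminf_offset[of _ 1]) (simp_all add: 0 del: pmf_poisson)
  also have "\<dots> = (\<Sum>n. ?w n * (\<integral>\<^sup>+x. indicator A x * ?J n x \<partial>lam))"
    by (simp only: mecke mult.assoc[symmetric] pmf_poisson_Suc)
  also have "\<dots> = (\<Sum>n. (\<integral>\<^sup>+x. ?w n * (indicator A x * ?J n x) \<partial>lam))"
    by (intro suminf_cong nn_integral_cmult[symmetric]) measurable
  also have "\<dots> = (\<integral>\<^sup>+x. (\<Sum>n. ?w n * (indicator A x * ?J n x)) \<partial>lam)"
    by (intro nn_integral_suminf[symmetric]) measurable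
  also have "\<dots> = (\<integral>\<^sup>+x. indicator A x * (\<Sum>n. ?w n * ?J n x) \<partial>lam)"
  proof (rule nn_integral_cong)
    fix x
    have "?w n * (indicator A x * ?J n x) = indicator A x * (?w n * ?J n x)" for n
      by (rule mult.left_commute)
    then show "(\<Sum>n. ?w n * (indicator A x * ?J n x)) = indicator A x * (\<Sum>n. ?w n * ?J n x)"
      by (simp only: ennreal_suminf_cmult)
  qed
  also have "\<dots> = (\<integral>\<^sup>+x. indicator A x * (\<integral>\<^sup>+\<phi>. G (add_point x \<phi>) \<partial>ref) \<partial>lam)"
    by (subst nn_integral_ref_suminf) simp_all
  finally show ?thesis
    by (simp only: cnt_def)
qed

end

section \<open>Densities from the Papangelou equation\<close>

text \<open>The law-level form shared by both processes, with \<open>c\<close> taken relative to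
  \<open>lam\<close>. The assumption \<open>mecke\<close> is the Papangelou equation for the test
  functions that are the indicator of \<open>A\<close> at \<open>x\<close> times that of
  \<open>B\<close> at \<open>\<phi> + \<delta>_x\<close>, so no point is removed. In
  \<open>carried\<close> the exceptional null set may depend on \<open>A\<close>.\<close>

locale papangelou_law = carrier lam K S0 + mu: prob_space mu
  for lam :: "'a::topological_space measure" and K S0 and mu :: "'a measure measure" +
  fixes c :: "'a \<Rightarrow> 'a measure \<Rightarrow> real"
  assumes sets_mu [measurable_cong, simp]: "sets mu = sets config_space"
    and c_measurable [measurable]: "case_prod c \<in> borel_measurable (borel \<Otimes>\<^sub>M config_space)"
    and c_nonneg: "\<And>x \<phi>. \<phi> \<in> configurations \<Longrightarrow> 0 \<le> c x \<phi>"
    and carried: "\<And>A. A \<in> relcompact_borel \<Longrightarrow> A \<inter> S0 = {} \<Longrightarrow> AE \<phi> in mu. emeasure \<phi> A = 0"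
    and mecke: "\<And>A B. A \<in> sets borel \<Longrightarrow> A \<subseteq> S0 \<Longrightarrow> B \<in> sets config_space \<Longrightarrow>
      (\<integral>\<^sup>+\<phi>. emeasure \<phi> A * indicator B \<phi> \<partial>mu) =
      (\<integral>\<^sup>+x. indicator A x * (\<integral>\<^sup>+\<phi>. ennreal (c x \<phi>) * indicator B (add_point x \<phi>) \<partial>mu) \<partial>lam)"
    and finite_intensity: "(\<integral>\<^sup>+x. \<integral>\<^sup>+\<phi>. ennreal (c x \<phi>) \<partial>mu \<partial>lam) < \<infinity>"
begin

section \<open>Absolute continuity with respect to the reference law\<close>

lemma space_mu [simp]: "space mu = configurations"
  using sets_eq_imp_space_eq[OF sets_mu] by simp

definition count :: "'a measure \<Rightarrow> ennreal" where
  "count \<phi> = emeasure \<phi> S0"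

lemma measurable_count_S0 [measurable]: "count \<in> borel_measurable config_space"
  unfolding count_def by (rule measurable_count_subset) simp_all

lemma count_add_point:
  "\<phi> \<in> configurations \<Longrightarrow> x \<in> S0 \<Longrightarrow> count (add_point x \<phi>) = count \<phi> + 1"
  by (simp add: count_def emeasure_add_point configurations_sets)

text \<open>For the generating events this is \<open>carried\<close> applied to
  \<open>A - S0\<close>; it passes to complements and countable unions. The null set depends on
  \<open>B\<close>, so almost sure equality of \<open>\<phi>\<close> and its restriction is not
  claimed.\<close>

lemma AE_restr:
  assumes "B \<in> sets config_space"
  shows "AE \<phi> in mu. \<phi> \<in> B \<longleftrightarrow> restr S0 \<phi> \<in> B"
  using assms unfolding sets_config_space
proof (induction rule: sigma_sets.induct)
  case (Basic B)
  then obtain A C where A: "A \<in> relcompact_borel"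
    and B: "B = {\<phi> \<in> configurations. emeasure \<phi> A \<in> C}"
    by blast
  have Ab: "A \<in> sets borel" using A by (rule relcompact_borel_sets)
  have "AE \<phi> in mu. emeasure \<phi> (A - S0) = 0"
    using Ab by (intro carried relcompact_borel_subset[OF A]) auto
  with AE_space show ?case
  proof eventually_elim
    case (elim \<phi>)
    then have \<phi>: "\<phi> \<in> configurations" by simp
    note s = configurations_sets[OF \<phi>]
    have "emeasure \<phi> A = emeasure \<phi> ((A \<inter> S0) \<union> (A - S0))"
      by (rule arg_cong[of _ _ "emeasure \<phi>"]) blast
    also have "\<dots> = emeasure \<phi> (A \<inter> S0) + emeasure \<phi> (A - S0)"
      using Ab s by (intro plus_emeasure[symmetric]) auto
    finally have "emeasure \<phi> A = emeasure (restr S0 \<phi>) A"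
      using elim(2) Ab s by (simp add: emeasure_restr)
    then show ?case
      using \<phi> by (simp add: B)
  qed
next
  case Empty
  then show ?case by simp
next
  case (Compl B)
  from Compl(2) AE_space show ?case
    by eventually_elim auto
next
  case (Union B)
  then have "AE \<phi> in mu. \<forall>i. \<phi> \<in> B i \<longleftrightarrow> restr S0 \<phi> \<in> B i"
    by (simp add: AE_all_countable)
  then show ?case
    by eventually_elim auto
qed

text \<open>Induction on the number of points. If \<open>B\<close> is null for \<open>n + 1\<close>
  points, then for almost every \<open>x\<close> the configurations that enter \<open>B\<close> on
  adding \<open>x\<close> are null for \<open>n\<close> points, hence negligible under
  \<open>mu\<close> on \<open>count = n\<close>; the equation with \<open>A = S0\<close> turns this
  into a statement about \<open>B\<close>.\<close>

lemma null_conf_law: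
  assumes "B \<in> sets config_space" "emeasure (conf_law n) B = 0"
  shows "AE \<phi> in mu. \<not> (\<phi> \<in> B \<and> count \<phi> = of_nat n)"
  using assms
proof (induction n arbitrary: B)
  case 0
  \<comment> \<open>\<open>conf_law 0\<close> is the point mass at the empty configuration, and any
    configuration without points in \<open>S0\<close> restricts to that one.\<close>
  have "null_measure borel \<notin> B"
    using 0 by (auto simp: conf_law.simps)
  from AE_restr[OF 0(1)] AE_space show ?case
  proof eventually_elim
    case (elim \<phi>)
    then have s: "sets \<phi> = sets borel"
      by (simp add: configurations_sets)
    have "restr S0 \<phi> = null_measure borel" if "emeasure \<phi> S0 = 0"
    proof (rule measure_eqI)
      fix A assume "A \<in> sets (restr S0 \<phi>)"
      then have A: "A \<in> sets borel" by (simp add: s)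
      have "emeasure \<phi> (A \<inter> S0) \<le> emeasure \<phi> S0"
        using s by (intro emeasure_mono) auto
      then show "emeasure (restr S0 \<phi>) A = emeasure (null_measure borel) A"
        using that A s by (simp add: emeasure_restr)
    qed (simp add: s)
    with elim \<open>null_measure borel \<notin> B\<close> show ?case
      by (auto simp: count_def)
  qed
next
  case (Suc n)
  note [measurable] = Suc.prems(1)
  let ?B = "{\<phi> \<in> space config_space. \<phi> \<in> B \<and> count \<phi> = of_nat (Suc n)}"
  have B [measurable]: "?B \<in> sets config_space"
    by measurable
  have "0 = (\<integral>\<^sup>+\<phi>. indicator B \<phi> \<partial>conf_law (Suc n))"
    using Suc.prems by simp
  also have "\<dots> = (\<integral>\<^sup>+x. \<integral>\<^sup>+\<phi>. indicator B (add_point x \<phi>) \<partial>conf_law n \<partial>lam)"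
    by (rule nn_integral_conf_law_Suc) measurable
  finally have "AE x in lam. (\<integral>\<^sup>+\<phi>. indicator B (add_point x \<phi>) \<partial>conf_law n) = 0"
    by (subst (asm) eq_commute, subst (asm) nn_integral_0_iff_AE) auto
  then have ae: "AE x in lam. x \<in> S0 \<longrightarrow>
      (\<integral>\<^sup>+\<phi>. ennreal (c x \<phi>) * indicator ?B (add_point x \<phi>) \<partial>mu) = 0"
  proof eventually_elim
    case (elim x)
    let ?Bx = "{\<phi> \<in> space config_space. add_point x \<phi> \<in> B}"
    have Bx [measurable]: "?Bx \<in> sets config_space"
      by measurable
    have "emeasure (conf_law n) ?Bx = (\<integral>\<^sup>+\<phi>. indicator ?Bx \<phi> \<partial>conf_law n)"
      by (rule nn_integral_indicator[symmetric]) (simp only: sets_conf_law Bx)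
    also have "\<dots> = (\<integral>\<^sup>+\<phi>. indicator B (add_point x \<phi>) \<partial>conf_law n)"
      by (intro nn_integral_cong) (auto simp: indicator_def)
    finally have "AE \<phi> in mu. \<not> (\<phi> \<in> ?Bx \<and> count \<phi> = of_nat n)"
      using elim by (intro Suc.IH Bx) simp
    then have "AE \<phi> in mu. x \<in> S0 \<longrightarrow> ennreal (c x \<phi>) * indicator ?B (add_point x \<phi>) = 0"
      using AE_space
    proof eventually_elim
      case (elim \<phi>)
      show ?case
      proof
        assume x: "x \<in> S0"
        have "add_point x \<phi> \<notin> ?B"
        proof
          assume a: "add_point x \<phi> \<in> ?B"
          have "1 + count \<phi> = 1 + of_nat n"
            using a elim x by (simp add: count_add_point add.commute)
          then have "count \<phi> = of_nat n"
            unfolding ennreal_add_left_cancel by simp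
          with elim a show False by simp
        qed
        then show "ennreal (c x \<phi>) * indicator ?B (add_point x \<phi>) = 0" by simp
      qed
    qed
    then have "(\<integral>\<^sup>+\<phi>. ennreal (c x \<phi>) * indicator ?B (add_point x \<phi>) \<partial>mu) = (\<integral>\<^sup>+\<phi>. 0 \<partial>mu)"
      if "x \<in> S0"
      by (rule nn_integral_cong_AE[OF AE_mp]) (simp add: that)
    then show ?case
      by simp
  qed
  have "(\<integral>\<^sup>+\<phi>. count \<phi> * indicator ?B \<phi> \<partial>mu) =
      (\<integral>\<^sup>+x. indicator S0 x * (\<integral>\<^sup>+\<phi>. ennreal (c x \<phi>) * indicator ?B (add_point x \<phi>) \<partial>mu) \<partial>lam)"
    unfolding count_def using B by (intro mecke) (simp_all add: count_def)
  also have "\<dots> = (\<integral>\<^sup>+x. 0 \<partial>lam)"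
    using ae by (intro nn_integral_cong_AE) (auto simp: indicator_def)
  finally have "(\<integral>\<^sup>+\<phi>. count \<phi> * indicator ?B \<phi> \<partial>mu) = 0"
    by simp
  \<comment> \<open>On \<open>?B\<close> the factor \<open>count\<close> equals \<open>Suc n\<close>
    and is not zero, so the vanishing integral makes \<open>?B\<close> negligible.\<close>
  then have "AE \<phi> in mu. count \<phi> * indicator ?B \<phi> = 0"
    by (rule nn_integral_0_iff_AE[THEN iffD1, rotated]) measurable
  with AE_space show ?case
    by eventually_elim (auto simp: indicator_def split: if_splits)
qed

lemma nn_integral_count: "(\<integral>\<^sup>+\<phi>. count \<phi> \<partial>mu) = (\<integral>\<^sup>+x. \<integral>\<^sup>+\<phi>. ennreal (c x \<phi>) \<partial>mu \<partial>lam)"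
proof -
  have "(\<integral>\<^sup>+\<phi>. count \<phi> \<partial>mu) = (\<integral>\<^sup>+\<phi>. emeasure \<phi> S0 * indicator (space config_space) \<phi> \<partial>mu)"
    by (intro nn_integral_cong) (simp add: count_def)
  also have "\<dots> = (\<integral>\<^sup>+x. indicator S0 x *
      (\<integral>\<^sup>+\<phi>. ennreal (c x \<phi>) * indicator (space config_space) (add_point x \<phi>) \<partial>mu) \<partial>lam)"
    by (rule mecke[OF S0_sets order_refl sets.top])
  also have "\<dots> = (\<integral>\<^sup>+x. \<integral>\<^sup>+\<phi>. ennreal (c x \<phi>) \<partial>mu \<partial>lam)"
    using AE_S0
  proof (intro nn_integral_cong_AE, eventually_elim)
    case (elim x)
    then show ?case
      by (auto intro!: nn_integral_cong simp: indicator_def)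
  qed
  finally show ?thesis .
qed

lemma AE_count_nat: "AE \<phi> in mu. \<exists>n. count \<phi> = of_nat n"
proof -
  have "AE \<phi> in mu. count \<phi> \<noteq> \<infinity>"
    using finite_intensity by (intro nn_integral_noteq_infinite) (auto simp: nn_integral_count)
  with AE_space show ?thesis
  proof eventually_elim
    case (elim \<phi>)
    then have "emeasure \<phi> S0 \<in> range ennreal_of_enat"
      using S0_sets unfolding space_mu configurations_def by blast
    then obtain k where "count \<phi> = ennreal_of_enat k"
      unfolding count_def by blast
    with elim show ?case
      by (cases k) auto
  qed
qed

text \<open>Almost surely \<open>count\<close> is some natural number \<open>n\<close>, and a null
  set of \<open>ref\<close> is null for every \<open>conf_law n\<close>, so countably many uses of
  \<open>null_conf_law\<close> suffice.\<close>

lemma absolutely_continuous_ref: "absolutely_continuous ref mu"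
  unfolding absolutely_continuous_def
proof
  fix B assume B: "B \<in> null_sets ref"
  then have [measurable]: "B \<in> sets config_space" by auto
  have "AE \<phi> in conf_law n. \<phi> \<notin> B" for n
    using B by (intro AE_ref_conf_law AE_not_in)
  then have "emeasure (conf_law n) B = 0" for n
    using sets.sets_into_space[of B config_space]
    by (subst (asm) AE_iff_measurable[of B]) auto
  then have "AE \<phi> in mu. \<forall>n. \<not> (\<phi> \<in> B \<and> count \<phi> = of_nat n)"
    unfolding AE_all_countable by (intro allI null_conf_law) auto
  with AE_count_nat have "AE \<phi> in mu. \<phi> \<notin> B"
    by eventually_elim auto
  then show "B \<in> null_sets mu"
    using sets.sets_into_space[of B config_space]
    by (subst (asm) AE_iff_measurable[of B]) auto
qed

lemma obtain_density:
  obtains f :: "'a measure \<Rightarrow> real"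
  where "f \<in> borel_measurable config_space" "\<And>\<phi>. 0 \<le> f \<phi>" "mu = density ref (\<lambda>\<phi>. ennreal (f \<phi>))"
proof -
  obtain D where D: "D \<in> borel_measurable ref" "AE \<phi> in ref. RN_deriv ref mu \<phi> = ennreal (D \<phi>)"
    "\<And>\<phi>. 0 \<le> D \<phi>"
    using ref.real_RN_deriv[OF mu.finite_measure_axioms absolutely_continuous_ref] by auto
  have "mu = density ref (RN_deriv ref mu)"
    by (rule ref.density_RN_deriv[OF absolutely_continuous_ref, symmetric]) simp
  also have "\<dots> = density ref (\<lambda>\<phi>. ennreal (D \<phi>))"
    using D by (intro density_cong) auto
  finally show ?thesis
    using that[of D] D by (simp cong: measurable_cong_sets)
qed

text \<open>The map \<open>(x, \<phi>) \<mapsto> (x, \<phi> + \<delta>\<^sub>x)\<close> generates the product \<open>\<sigma>\<close>-algebra, so measures may be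
  compared through it although removing a point need not be measurable.\<close>
lemma sets_via_add_point:
  fixes Z :: "('b::topological_space \<times> 'b measure) set"
  defines "T \<equiv> \<lambda>(x, \<phi>). (x, add_point x \<phi>)"
  assumes Z: "Z \<in> sets (borel \<Otimes>\<^sub>M config_space)"
  obtains Z' where "Z' \<in> sets (borel \<Otimes>\<^sub>M config_space)" "Z = T -` Z' \<inter> (UNIV \<times> configurations)"
proof -
  let ?N = "borel \<Otimes>\<^sub>M config_space :: ('b \<times> 'b measure) measure"
  let ?V = "vimage_algebra (UNIV \<times> configurations) T ?N"
  have sp: "space ?N = UNIV \<times> configurations" by (simp add: space_pair_measure)
  have T: "T \<in> UNIV \<times> configurations \<rightarrow> space ?N"
    by (auto simp: T_def sp)
  have TV: "T \<in> measurable ?V ?N"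
    using T by (rule measurable_vimage_algebra1)
  have fstV: "(\<lambda>z. fst z) \<in> measurable ?V borel"
    using measurable_compose[OF TV measurable_fst] by (simp add: T_def case_prod_beta)
  have "(\<lambda>z. snd z) \<in> measurable ?V config_space"
  proof (rule measurable_config_spaceI)
    fix A :: "'b set" assume A: "A \<in> relcompact_borel"
    then have Ab: "A \<in> sets borel" by (rule relcompact_borel_sets)
    \<comment> \<open>The count before adding the point is recovered by subtracting the indicator;
      this makes the second coordinate measurable for the pulled-back
      \<open>\<sigma>\<close>-algebra.\<close>
    have m: "(\<lambda>z. emeasure (snd (T z)) A - indicator A (fst z)) \<in> borel_measurable ?V"
      using measurable_count[OF measurable_compose[OF TV measurable_snd] A] fstV Ab by measurable
    show "(\<lambda>z. emeasure (snd z) A) \<in> borel_measurable ?V"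
    proof (rule measurable_cong[THEN iffD1, OF _ m])
      fix z assume "z \<in> space ?V"
      then have "sets (snd z) = sets borel"
        by (auto simp: configurations_sets)
      then show "emeasure (snd (T z)) A - indicator A (fst z) = emeasure (snd z) A"
        using Ab by (simp add: T_def case_prod_beta emeasure_add_point indicator_def)
    qed
  qed auto
  with fstV have "(\<lambda>z. z) \<in> measurable ?V ?N"
    by (simp add: measurable_pair_iff comp_def)
  from measurable_sets[OF this Z] have "Z \<inter> (UNIV \<times> configurations) \<in> sets ?V"
    by (simp add: vimage_def)
  moreover have "Z \<inter> (UNIV \<times> configurations) = Z"
    using sets.sets_into_space[OF Z] sp by blast
  ultimately have "Z \<in> {T -` Z' \<inter> (UNIV \<times> configurations) | Z'. Z' \<in> sets ?N}"
    using sets_vimage_algebra2[OF T] by simp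
  then show ?thesis
    using that by blast
qed

text \<open>The Mecke equation of \<open>ref\<close>, applied to \<open>f\<close>, and the equation
  of \<open>mu\<close> evaluate the same integral over \<open>mu\<close>. So the measures with
  densities \<open>f (add_point x \<phi>)\<close> and \<open>c x \<phi> * f \<phi>\<close> have
  equal images under \<open>T\<close> on rectangles, hence everywhere, and their densities agree
  almost everywhere.\<close>

lemma density_add_point:
  assumes f [measurable]: "f \<in> borel_measurable config_space" and f_nonneg: "\<And>\<phi>. 0 \<le> f \<phi>"
    and mu: "mu = density ref (\<lambda>\<phi>. ennreal (f \<phi>))"
  shows "AE z in lam \<Otimes>\<^sub>M ref. f (add_point (fst z) (snd z)) = c (fst z) (snd z) * f (snd z)"
proof -
  interpret LR: pair_prob_space lam ref ..
  let ?N = "borel \<Otimes>\<^sub>M config_space :: ('a \<times> 'a measure) measure"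
  define T :: "'a \<times> 'a measure \<Rightarrow> 'a \<times> 'a measure" where "T = (\<lambda>(x, \<phi>). (x, add_point x \<phi>))"
  have T [measurable]: "T \<in> measurable ?N ?N"
    unfolding T_def by measurable
  have TL: "T \<in> measurable (lam \<Otimes>\<^sub>M ref) ?N"
    by measurable
  define u1 where "u1 = (\<lambda>(x, \<phi>). ennreal (f (add_point x \<phi>)))"
  define u2 where "u2 = (\<lambda>(x, \<phi>). ennreal (c x \<phi>) * ennreal (f \<phi>))"
  have u [measurable]: "u1 \<in> borel_measurable ?N" "u2 \<in> borel_measurable ?N"
    unfolding u1_def u2_def by measurable
  let ?D = "\<lambda>u. density (lam \<Otimes>\<^sub>M ref) u"
  let ?I = "\<lambda>u B x. \<integral>\<^sup>+\<phi>. u (x, \<phi>) * indicator B (add_point x \<phi>) \<partial>ref"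
  have rect: "emeasure (distr (?D u) ?N T) (A \<times> B) =
      (\<integral>\<^sup>+x. indicator A x * ?I u B x \<partial>lam)"
    if [measurable]: "u \<in> borel_measurable ?N" "A \<in> sets borel" "B \<in> sets config_space" for u A B
  proof -
    have "emeasure (distr (?D u) ?N T) (A \<times> B) = (\<integral>\<^sup>+y. indicator (A \<times> B) y \<partial>distr (?D u) ?N T)"
      by simp
    also have "\<dots> = (\<integral>\<^sup>+z. indicator (A \<times> B) (T z) \<partial>?D u)"
      using TL by (intro nn_integral_distr) auto
    also have "\<dots> = (\<integral>\<^sup>+z. u z * indicator (A \<times> B) (T z) \<partial>(lam \<Otimes>\<^sub>M ref))"
      by (intro nn_integral_density) measurable
    also have "\<dots> = (\<integral>\<^sup>+x. \<integral>\<^sup>+\<phi>. u (x, \<phi>) * indicator (A \<times> B) (T (x, \<phi>)) \<partial>ref \<partial>lam)"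
      by (intro ref.nn_integral_fst[symmetric]) measurable
    also have "\<dots> = (\<integral>\<^sup>+x. indicator A x * ?I u B x \<partial>lam)"
    proof (rule nn_integral_cong)
      fix x
      have "(\<integral>\<^sup>+\<phi>. u (x, \<phi>) * indicator (A \<times> B) (T (x, \<phi>)) \<partial>ref) =
          (\<integral>\<^sup>+\<phi>. indicator A x * (u (x, \<phi>) * indicator B (add_point x \<phi>)) \<partial>ref)"
        by (intro nn_integral_cong) (auto simp: T_def indicator_def)
      also have "\<dots> = indicator A x * ?I u B x"
        by (intro nn_integral_cmult) measurable
      finally show "(\<integral>\<^sup>+\<phi>. u (x, \<phi>) * indicator (A \<times> B) (T (x, \<phi>)) \<partial>ref) =
          indicator A x * ?I u B x" .
    qed
    finally show ?thesis .
  qed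
  have agree: "emeasure (distr (?D u1) ?N T) (A \<times> B) = emeasure (distr (?D u2) ?N T) (A \<times> B)"
    if A [measurable]: "A \<in> sets borel" and B [measurable]: "B \<in> sets config_space" for A B
  proof -
    have A' [measurable]: "A \<inter> S0 \<in> sets borel" by simp
    define cnt where "cnt = (\<lambda>\<phi>. emeasure \<phi> (A \<inter> S0))"
    have [measurable]: "cnt \<in> borel_measurable config_space"
      unfolding cnt_def by (rule measurable_count_subset) simp_all
    have inS: "(\<integral>\<^sup>+x. indicator A x * h x \<partial>lam) = (\<integral>\<^sup>+x. indicator (A \<inter> S0) x * h x \<partial>lam)"
      for h :: "'a \<Rightarrow> ennreal"
      using AE_S0 by (intro nn_integral_cong_AE) (auto simp: indicator_def)
    have "emeasure (distr (?D u1) ?N T) (A \<times> B) = (\<integral>\<^sup>+x. indicator (A \<inter> S0) x *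
        (\<integral>\<^sup>+\<phi>. ennreal (f (add_point x \<phi>)) * indicator B (add_point x \<phi>) \<partial>ref) \<partial>lam)"
      by (subst rect) (simp_all add: u1_def inS)
    also have "\<dots> = (\<integral>\<^sup>+\<phi>. emeasure \<phi> (A \<inter> S0) * (ennreal (f \<phi>) * indicator B \<phi>) \<partial>ref)"
      by (rule ref_mecke[symmetric]) (use A' in measurable)
    also have "\<dots> = (\<integral>\<^sup>+\<phi>. ennreal (f \<phi>) * (cnt \<phi> * indicator B \<phi>) \<partial>ref)"
      by (simp add: cnt_def ac_simps)
    also have "\<dots> = (\<integral>\<^sup>+\<phi>. cnt \<phi> * indicator B \<phi> \<partial>mu)"
      unfolding mu by (rule nn_integral_density[symmetric]) measurable
    also have "\<dots> = (\<integral>\<^sup>+x. indicator (A \<inter> S0) x *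
        (\<integral>\<^sup>+\<phi>. ennreal (c x \<phi>) * indicator B (add_point x \<phi>) \<partial>mu) \<partial>lam)"
      unfolding cnt_def by (rule mecke) (use A' B in auto)
    also have "\<dots> = (\<integral>\<^sup>+x. indicator (A \<inter> S0) x *
        (\<integral>\<^sup>+\<phi>. u2 (x, \<phi>) * indicator B (add_point x \<phi>) \<partial>ref) \<partial>lam)"
    proof (intro nn_integral_cong arg_cong[where f = "\<lambda>t. indicator (A \<inter> S0) _ * t"])
      fix x
      have "(\<integral>\<^sup>+\<phi>. ennreal (c x \<phi>) * indicator B (add_point x \<phi>) \<partial>mu) =
          (\<integral>\<^sup>+\<phi>. ennreal (f \<phi>) * (ennreal (c x \<phi>) * indicator B (add_point x \<phi>)) \<partial>ref)"
        unfolding mu by (rule nn_integral_density) measurable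
      then show "(\<integral>\<^sup>+\<phi>. ennreal (c x \<phi>) * indicator B (add_point x \<phi>) \<partial>mu) =
          (\<integral>\<^sup>+\<phi>. u2 (x, \<phi>) * indicator B (add_point x \<phi>) \<partial>ref)"
        by (simp add: u2_def ac_simps)
    qed
    also have "\<dots> = emeasure (distr (?D u2) ?N T) (A \<times> B)"
      by (subst rect) (simp_all add: inS)
    finally show ?thesis .
  qed
  \<comment> \<open>The total mass is the integrated intensity; its finiteness is needed for
    uniqueness from rectangles.\<close>
  have "emeasure (distr (?D u2) ?N T) (UNIV \<times> configurations) =
      (\<integral>\<^sup>+x. \<integral>\<^sup>+\<phi>. ennreal (f \<phi>) * ennreal (c x \<phi>) \<partial>ref \<partial>lam)"
    using sets.top[of config_space]
    by (subst rect) (auto simp: u2_def ac_simps intro!: nn_integral_cong)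
  also have "\<dots> = (\<integral>\<^sup>+x. \<integral>\<^sup>+\<phi>. ennreal (c x \<phi>) \<partial>mu \<partial>lam)"
    unfolding mu by (intro nn_integral_cong nn_integral_density[symmetric]) measurable
  finally have fin: "emeasure (distr (?D u2) ?N T) (UNIV \<times> configurations) \<noteq> \<infinity>"
    using finite_intensity by simp
  have "distr (?D u1) ?N T = distr (?D u2) ?N T"
  proof (rule measure_eqI_generator_eq[OF Int_stable_pair_measure_generator[of borel config_space],
      where \<Omega> = "UNIV \<times> configurations" and A = "\<lambda>_. UNIV \<times> configurations"])
    show "{a \<times> b | a b. a \<in> sets borel \<and> b \<in> sets config_space} \<subseteq> Pow (UNIV \<times> configurations)"
      using sets.sets_into_space[of _ config_space] by auto
    show "emeasure (distr (?D u1) ?N T) X = emeasure (distr (?D u2) ?N T) X"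
      if "X \<in> {a \<times> b | a b. a \<in> sets borel \<and> b \<in> sets config_space}" for X
      using that agree by auto
    show "range (\<lambda>_. UNIV \<times> configurations) \<subseteq>
        {a \<times> b | a b. a \<in> sets borel \<and> b \<in> sets config_space}"
      using sets.top[of config_space]
      by (intro image_subsetI CollectI exI[of _ UNIV] exI[of _ configurations]) auto
    show "emeasure (distr (?D u1) ?N T) (UNIV \<times> configurations) \<noteq> \<infinity>"
      using fin sets.top[of config_space] by (subst agree) auto
  qed (simp_all add: sets_pair_measure)
  then have push: "emeasure (?D u1) (T -` Z' \<inter> (UNIV \<times> configurations)) =
      emeasure (?D u2) (T -` Z' \<inter> (UNIV \<times> configurations))" if "Z' \<in> sets ?N" for Z'
    using that TL emeasure_distr[of T "?D u1" ?N Z'] emeasure_distr[of T "?D u2" ?N Z']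
    by (simp add: space_pair_measure)
  \<comment> \<open>Every measurable set is a preimage under \<open>T\<close>, so equality of the
    image measures already gives equality of the measures.\<close>
  have "?D u1 = ?D u2"
  proof (rule measure_eqI)
    fix Z assume "Z \<in> sets (?D u1)"
    then have "Z \<in> sets ?N"
      by (simp cong: sets_pair_measure_cong)
    then obtain Z' where "Z' \<in> sets ?N" "Z = T -` Z' \<inter> (UNIV \<times> configurations)"
      unfolding T_def by (rule sets_via_add_point)
    then show "emeasure (?D u1) Z = emeasure (?D u2) Z"
      using push by simp
  qed simp
  then have "AE z in lam \<Otimes>\<^sub>M ref. u1 z = u2 z"
    by (rule LR.P.density_unique[rotated 2]) measurable
  with AE_space show ?thesis
  proof eventually_elim
    case (elim z)
    then show ?case
      using f_nonneg c_nonneg[of "snd z" "fst z"]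
      by (auto simp: u1_def u2_def case_prod_beta space_pair_measure ennreal_mult[symmetric])
  qed
qed

end

section \<open>The coupling\<close>

lemma suminf_ennreal_swap:
  fixes a :: "nat \<Rightarrow> nat \<Rightarrow> ennreal"
  shows "(\<Sum>i. \<Sum>j. a i j) = (\<Sum>j. \<Sum>i. a i j)"
  using nn_integral_suminf[of a "count_space UNIV"] by (simp add: nn_integral_count_space_nat)

lemma suminf_ennreal_antidiagonal:
  fixes a :: "nat \<Rightarrow> nat \<Rightarrow> ennreal"
  shows "(\<Sum>N. \<Sum>n\<le>N. a n (N - n)) = (\<Sum>n. \<Sum>k. a n k)"
proof -
  let ?b = "\<lambda>N n. if n \<le> N then a n (N - n) else 0"
  have "(\<Sum>n\<le>N. a n (N - n)) = (\<Sum>n. ?b N n)" for N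
    by (subst suminf_finite[of "{..N}"]) auto
  then have "(\<Sum>N. \<Sum>n\<le>N. a n (N - n)) = (\<Sum>n. \<Sum>N. ?b N n)"
    by (simp add: suminf_ennreal_swap[of ?b])
  moreover have "(\<Sum>N. ?b N n) = (\<Sum>k. a n k)" for n
    by (subst suminf_offset[of _ n]) simp_all
  ultimately show ?thesis
    by simp
qed

lemma sum_Pow_card:
  fixes H :: "nat \<Rightarrow> nat \<Rightarrow> ennreal"
  assumes "finite A"
  shows "(\<Sum>B\<in>Pow A. H (card B) (card (A - B))) =
    (\<Sum>n\<le>card A. of_nat (card A choose n) * H n (card A - n))"
proof -
  have "(\<Sum>B\<in>Pow A. H (card B) (card (A - B))) =
      (\<Sum>n\<le>card A. \<Sum>B\<in>{B \<in> Pow A. card B = n}. H (card B) (card (A - B)))"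
    using assms by (intro sum.group[symmetric]) (auto intro: card_mono)
  also have "\<dots> = (\<Sum>n\<le>card A. of_nat (card A choose n) * H n (card A - n))"
  proof (rule sum.cong[OF refl])
    fix n
    have "(\<Sum>B\<in>{B \<in> Pow A. card B = n}. H (card B) (card (A - B))) =
        (\<Sum>B\<in>{B \<in> Pow A. card B = n}. H n (card A - n))"
      using assms by (intro sum.cong) (auto simp: card_Diff_subset finite_subset)
    then show "(\<Sum>B\<in>{B \<in> Pow A. card B = n}. H (card B) (card (A - B))) =
        of_nat (card A choose n) * H n (card A - n)"
      using n_subsets[OF assms] by simp
  qed
  finally show ?thesis .
qed

text \<open>The probability that two independent Poisson variables of rate 1 add up to
  \<open>N\<close>, divided by the number \<open>2 ^ N\<close> of ways to assign \<open>N\<close>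
  labels to them. It is the weight of one pair \<open>(N, B)\<close>.\<close>

definition poisson_weight :: "nat \<Rightarrow> ennreal" where
  "poisson_weight N = ennreal (exp (-2) / fact N)"

lemma poisson_weight_Suc: "poisson_weight (Suc N) * of_nat (Suc N) = poisson_weight N"
proof -
  have "exp (-2) / fact (Suc N) * real (Suc N) = (exp (-2) / fact N :: real)"
    unfolding fact_Suc by (simp add: divide_simps del: of_nat_Suc)
  then show ?thesis
    unfolding poisson_weight_def ennreal_of_nat_eq_real_of_nat
    by (subst ennreal_mult[symmetric]) (simp_all del: of_nat_Suc)
qed

text \<open>The splitting property: summing over the sets \<open>B\<close> of size \<open>n\<close>
  makes the two sample sizes independent Poisson variables.\<close>

lemma poisson_weight_binomial:
  assumes "n \<le> N"
  shows "poisson_weight N * of_nat (N choose n) =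
    ennreal (pmf (poisson_pmf 1) n) * ennreal (pmf (poisson_pmf 1) (N - n))"
proof -
  have "exp (-2) = exp (-1) * exp (-1 :: real)"
    by (simp add: exp_add[symmetric])
  then have "exp (-2) / fact N * real (N choose n) =
      pmf (poisson_pmf 1) n * pmf (poisson_pmf 1) (N - n)"
    unfolding pmf_poisson[OF zero_less_one] binomial_fact[OF assms]
    by (simp add: divide_simps)
  then show ?thesis
    unfolding poisson_weight_def ennreal_of_nat_eq_real_of_nat
    by (subst (1 2) ennreal_mult[symmetric]) (simp_all del: pmf_poisson)
qed

lemma sum_poisson_weight:
  fixes H :: "nat \<Rightarrow> nat \<Rightarrow> ennreal"
  shows "(\<Sum>N. poisson_weight N * (\<Sum>n\<le>N. of_nat (N choose n) * H n (N - n))) =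
    (\<Sum>n. \<Sum>k. ennreal (pmf (poisson_pmf 1) n) * ennreal (pmf (poisson_pmf 1) k) * H n k)"
proof -
  have "poisson_weight N * (\<Sum>n\<le>N. of_nat (N choose n) * H n (N - n)) =
      (\<Sum>n\<le>N. ennreal (pmf (poisson_pmf 1) n) * ennreal (pmf (poisson_pmf 1) (N - n)) * H n (N - n))"
    for N
    unfolding sum_distrib_left
    by (intro sum.cong refl) (simp add: poisson_weight_binomial mult.assoc[symmetric] del: pmf_poisson)
  then show ?thesis
    by (simp add: suminf_ennreal_antidiagonal
      [of "\<lambda>n k. ennreal (pmf (poisson_pmf 1) n) * ennreal (pmf (poisson_pmf 1) k) * H n k"]
      del: pmf_poisson)
qed

text \<open>Without measurability of the integrand, where the integral is a lower integral.\<close>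
lemma nn_integral_distr_le:
  assumes "T \<in> measurable M N"
  shows "(\<integral>\<^sup>+x. f x \<partial>distr M N T) \<le> (\<integral>\<^sup>+x. f (T x) \<partial>M)"
  unfolding nn_integral_def[of "distr M N T"]
proof (rule SUP_least)
  fix g assume "g \<in> {g. simple_function (distr M N T) g \<and> g \<le> f}"
  then have g: "simple_function (distr M N T) g" "g \<le> f" by auto
  have "integral\<^sup>S (distr M N T) g = (\<integral>\<^sup>+x. g x \<partial>distr M N T)"
    using g(1) by (rule nn_integral_eq_simple_integral[symmetric])
  also have "\<dots> = (\<integral>\<^sup>+x. g (T x) \<partial>M)"
    using assms borel_measurable_simple_function[OF g(1)] by (intro nn_integral_distr) auto
  also have "\<dots> \<le> (\<integral>\<^sup>+x. f (T x) \<partial>M)"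
    using g(2) by (intro nn_integral_mono) (auto simp: le_fun_def)
  finally show "integral\<^sup>S (distr M N T) g \<le> (\<integral>\<^sup>+x. f (T x) \<partial>M)" .
qed

section \<open>Labelled samples and pairs of independent reference configurations\<close>

context reference
begin

lemma sum_conf_law_ref:
  assumes [measurable]: "(\<lambda>(\<phi>, \<psi>). G \<phi> \<psi>) \<in> borel_measurable (config_space \<Otimes>\<^sub>M config_space)"
  shows "(\<Sum>n. \<Sum>k. ennreal (pmf (poisson_pmf 1) n) * ennreal (pmf (poisson_pmf 1) k) *
      (\<integral>\<^sup>+\<phi>. \<integral>\<^sup>+\<psi>. G \<phi> \<psi> \<partial>conf_law k \<partial>conf_law n)) = (\<integral>\<^sup>+\<phi>. \<integral>\<^sup>+\<psi>. G \<phi> \<psi> \<partial>ref \<partial>ref)"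
proof -
  let ?w = "\<lambda>n. ennreal (pmf (poisson_pmf 1) n)"
  have outer: "(\<integral>\<^sup>+\<phi>. \<integral>\<^sup>+\<psi>. G \<phi> \<psi> \<partial>ref \<partial>ref) = (\<Sum>n. ?w n * (\<integral>\<^sup>+\<phi>. \<integral>\<^sup>+\<psi>. G \<phi> \<psi> \<partial>ref \<partial>conf_law n))"
    by (rule nn_integral_ref_suminf) measurable
  have inner: "(\<integral>\<^sup>+\<phi>. \<integral>\<^sup>+\<psi>. G \<phi> \<psi> \<partial>ref \<partial>conf_law n) =
      (\<Sum>k. ?w k * (\<integral>\<^sup>+\<phi>. \<integral>\<^sup>+\<psi>. G \<phi> \<psi> \<partial>conf_law k \<partial>conf_law n))" for n
  proof -
    have "(\<integral>\<^sup>+\<phi>. \<integral>\<^sup>+\<psi>. G \<phi> \<psi> \<partial>ref \<partial>conf_law n) =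
        (\<integral>\<^sup>+\<phi>. (\<Sum>k. ?w k * (\<integral>\<^sup>+\<psi>. G \<phi> \<psi> \<partial>conf_law k)) \<partial>conf_law n)"
      by (intro nn_integral_cong nn_integral_ref_suminf) (simp, measurable)
    also have "\<dots> = (\<Sum>k. \<integral>\<^sup>+\<phi>. ?w k * (\<integral>\<^sup>+\<psi>. G \<phi> \<psi> \<partial>conf_law k) \<partial>conf_law n)"
      by (rule nn_integral_suminf) measurable
    also have "\<dots> = (\<Sum>k. ?w k * (\<integral>\<^sup>+\<phi>. \<integral>\<^sup>+\<psi>. G \<phi> \<psi> \<partial>conf_law k \<partial>conf_law n))"
      by (intro suminf_cong nn_integral_cmult) measurable
    finally show ?thesis .
  qed
  show ?thesis
    unfolding outer inner by (simp only: ennreal_suminf_cmult[symmetric] mult.assoc)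
qed

text \<open>Each subset of the labels yields a pair of independent samples depending only on the two
  sizes; grouping subsets by size and splitting the Poisson weight recovers two independent
  reference configurations.\<close>

lemma sum_labels_ref:
  assumes G: "(\<lambda>(\<phi>, \<psi>). G \<phi> \<psi>) \<in> borel_measurable (config_space \<Otimes>\<^sub>M config_space)"
  shows "(\<Sum>N. poisson_weight N * (\<Sum>B\<in>Pow {..<N}.
      \<integral>\<^sup>+y. G (points y B) (points y ({..<N} - B)) \<partial>labels)) = (\<integral>\<^sup>+\<phi>. \<integral>\<^sup>+\<psi>. G \<phi> \<psi> \<partial>ref \<partial>ref)"
proof -
  let ?H = "\<lambda>n k. \<integral>\<^sup>+\<phi>. \<integral>\<^sup>+\<psi>. G \<phi> \<psi> \<partial>conf_law k \<partial>conf_law n"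
  have "(\<Sum>B\<in>Pow {..<N}. \<integral>\<^sup>+y. G (points y B) (points y ({..<N} - B)) \<partial>labels) =
      (\<Sum>n\<le>N. of_nat (N choose n) * ?H n (N - n))" for N
  proof -
    have "(\<Sum>B\<in>Pow {..<N}. \<integral>\<^sup>+y. G (points y B) (points y ({..<N} - B)) \<partial>labels) =
        (\<Sum>B\<in>Pow {..<N}. ?H (card B) (card ({..<N} - B)))"
      using finite_subset by (intro sum.cong refl nn_integral_labels2[OF _ _ _ G]) auto
    also have "\<dots> = (\<Sum>n\<le>card {..<N}. of_nat (card {..<N} choose n) * ?H n (card {..<N} - n))"
      by (rule sum_Pow_card) simp
    finally show ?thesis
      by simp
  qed
  then show ?thesis
    by (simp only: sum_poisson_weight[of ?H] sum_conf_law_ref[OF G])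
qed

text \<open>The distinguished label can be chosen in \<open>N\<close> ways with equal contributions,
  and \<open>N * poisson_weight N\<close> is the weight for \<open>N - 1\<close> labels. What
  remains besides the point \<open>x\<close> is again a pair of independent reference
  configurations.\<close>

lemma sum_labels_ref_edge:
  assumes G [measurable]: "(\<lambda>(x, \<phi>, \<psi>). G x \<phi> \<psi>) \<in>
    borel_measurable (borel \<Otimes>\<^sub>M (config_space \<Otimes>\<^sub>M config_space))"
  shows "(\<Sum>N. poisson_weight N * (\<Sum>t<N. \<Sum>B\<in>Pow ({..<N} - {t}).
      \<integral>\<^sup>+y. G (y t) (points y B) (points y ({..<N} - {t} - B)) \<partial>labels)) =
    (\<integral>\<^sup>+x. \<integral>\<^sup>+\<phi>. \<integral>\<^sup>+\<psi>. G x \<phi> \<psi> \<partial>ref \<partial>ref \<partial>lam)"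
proof -
  let ?E = "\<lambda>N t B. \<integral>\<^sup>+y. G (y t) (points y B) (points y ({..<N} - {t} - B)) \<partial>labels"
  let ?w = "\<lambda>n. ennreal (pmf (poisson_pmf 1) n)"
  have [measurable]: "(\<lambda>z. G (fst (fst z)) (snd (fst z)) (snd z)) \<in>
      borel_measurable ((borel \<Otimes>\<^sub>M config_space) \<Otimes>\<^sub>M config_space)"
    using measurable_compose[OF _ G, of "\<lambda>z. (fst (fst z), snd (fst z), snd z)"] by simp
  define H where "H x n k = (\<integral>\<^sup>+\<phi>. \<integral>\<^sup>+\<psi>. G x \<phi> \<psi> \<partial>conf_law k \<partial>conf_law n)" for x n k
  have H [measurable]: "(\<lambda>x. H x n k) \<in> borel_measurable borel" for n k
    unfolding H_def by measurable
  define H' where "H' n k = (\<integral>\<^sup>+x. H x n k \<partial>lam)" for n k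
  let ?S = "\<lambda>N. \<Sum>n\<le>N. of_nat (N choose n) * H' n (N - n)"
  have "(\<Sum>B\<in>Pow ({..<N} - {t}). ?E N t B) =
      ?S (N - 1)" if "t < N" for N t
  proof -
    have "(\<Sum>B\<in>Pow ({..<N} - {t}). ?E N t B) =
        (\<Sum>B\<in>Pow ({..<N} - {t}). H' (card B) (card ({..<N} - {t} - B)))"
      unfolding H'_def H_def
      using finite_subset by (intro sum.cong refl nn_integral_labels3[OF _ _ _ _ G]) auto
    also have "\<dots> = ?S (card ({..<N} - {t}))"
      by (rule sum_Pow_card) simp
    finally show ?thesis
      using that by simp
  qed
  then have "(\<Sum>N. poisson_weight N * (\<Sum>t<N. \<Sum>B\<in>Pow ({..<N} - {t}). ?E N t B)) =
    (\<Sum>N. poisson_weight N * (of_nat N * ?S (N - 1)))"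
    by simp
  \<comment> \<open>The term \<open>N = 0\<close> vanishes through its factor
    \<open>of_nat N\<close>, so the truncated \<open>N - 1\<close> does no harm there.\<close>
  also have "\<dots> = (\<Sum>N. poisson_weight (Suc N) * (of_nat (Suc N) * ?S N))"
    by (subst suminf_offset[of _ 1]) simp_all
  also have "\<dots> = (\<Sum>N. poisson_weight N * ?S N)"
    by (simp only: mult.assoc[symmetric] poisson_weight_Suc)
  also have "\<dots> = (\<Sum>n. \<Sum>k. ?w n * ?w k * H' n k)"
    by (rule sum_poisson_weight)
  also have "\<dots> = (\<Sum>n. \<Sum>k. \<integral>\<^sup>+x. ?w n * ?w k * H x n k \<partial>lam)"
    unfolding H'_def by (intro suminf_cong nn_integral_cmult[symmetric]) measurable
  also have "\<dots> = (\<Sum>n. \<integral>\<^sup>+x. (\<Sum>k. ?w n * ?w k * H x n k) \<partial>lam)"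
    by (intro suminf_cong nn_integral_suminf[symmetric]) measurable
  also have "\<dots> = (\<integral>\<^sup>+x. (\<Sum>n. \<Sum>k. ?w n * ?w k * H x n k) \<partial>lam)"
    by (intro nn_integral_suminf[symmetric]) measurable
  also have "\<dots> = (\<integral>\<^sup>+x. \<integral>\<^sup>+\<phi>. \<integral>\<^sup>+\<psi>. G x \<phi> \<psi> \<partial>ref \<partial>ref \<partial>lam)"
    unfolding H_def by (intro nn_integral_cong sum_conf_law_ref) measurable
  finally show ?thesis .
qed

end

section \<open>The space on which the coupling is built\<close>

context reference
begin

definition index_space :: "(nat \<times> nat set \<times> nat set \<times> (nat \<Rightarrow> 'a)) measure" where
  "index_space = count_space UNIV \<Otimes>\<^sub>M
     (count_space (Collect finite) \<Otimes>\<^sub>M (count_space (Collect finite) \<Otimes>\<^sub>M labels))"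

lemma measurable_index_space:
  assumes "\<And>N B B'. finite B \<Longrightarrow> finite B' \<Longrightarrow> (\<lambda>y. g (N, B, B', y)) \<in> measurable labels M"
  shows "g \<in> measurable index_space M"
  unfolding index_space_def
  using assms by (intro measurable_pair_measure_countable1) (auto simp: countable_Collect_finite)

lemma nn_integral_index_space:
  assumes g: "\<And>N B B'. finite B \<Longrightarrow> finite B' \<Longrightarrow> (\<lambda>y. g (N, B, B', y)) \<in> borel_measurable labels"
    and supp: "\<And>N B B' y. \<not> (B \<subseteq> {..<N} \<and> B' \<subseteq> {..<N}) \<Longrightarrow> g (N, B, B', y) = 0"
  shows "(\<integral>\<^sup>+w. g w \<partial>index_space) =
    (\<Sum>N. \<Sum>B\<in>Pow {..<N}. \<Sum>B'\<in>Pow {..<N}. \<integral>\<^sup>+y. g (N, B, B', y) \<partial>labels)"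
proof -
  let ?F = "count_space (Collect finite :: nat set set)"
  have cF: "countable (Collect finite :: nat set set)"
    by (rule countable_Collect_finite)
  interpret F: sigma_finite_measure ?F
    using cF by (rule sigma_finite_measure_count_space_countable)
  interpret FL: pair_sigma_finite ?F labels ..
  interpret FFL: pair_sigma_finite ?F "?F \<Otimes>\<^sub>M labels" ..
  have m: "g \<in> borel_measurable index_space"
    using g by (rule measurable_index_space)
  have fin: "finite (Pow {..<N})" "Pow {..<N} \<subseteq> Collect finite" for N :: nat
    by (auto intro: finite_subset)
  have "(\<integral>\<^sup>+w. g w \<partial>index_space) =
      (\<integral>\<^sup>+N. \<integral>\<^sup>+z. g (N, z) \<partial>(?F \<Otimes>\<^sub>M (?F \<Otimes>\<^sub>M labels)) \<partial>count_space UNIV)"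
    using m unfolding index_space_def by (intro FFL.nn_integral_fst[symmetric])
  also have "\<dots> = (\<Sum>N. \<integral>\<^sup>+z. g (N, z) \<partial>(?F \<Otimes>\<^sub>M (?F \<Otimes>\<^sub>M labels)))"
    by (rule nn_integral_count_space_nat)
  also have "\<dots> = (\<Sum>N. \<Sum>B\<in>Pow {..<N}. \<Sum>B'\<in>Pow {..<N}. \<integral>\<^sup>+y. g (N, B, B', y) \<partial>labels)"
  proof (rule suminf_cong)
    fix N
    have "(\<integral>\<^sup>+z. g (N, z) \<partial>(?F \<Otimes>\<^sub>M (?F \<Otimes>\<^sub>M labels))) =
        (\<integral>\<^sup>+B. \<integral>\<^sup>+z. g (N, B, z) \<partial>(?F \<Otimes>\<^sub>M labels) \<partial>?F)"
      using g cF by (intro FL.nn_integral_fst[symmetric] measurable_pair_measure_countable1) auto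
    also have "\<dots> = (\<integral>\<^sup>+B. \<integral>\<^sup>+B'. \<integral>\<^sup>+y. g (N, B, B', y) \<partial>labels \<partial>?F \<partial>?F)"
      using g cF by (intro nn_integral_cong nn_integral_fst[symmetric]
          measurable_pair_measure_countable1) auto
    also have "\<dots> = (\<integral>\<^sup>+B. (\<Sum>B'\<in>Pow {..<N}. \<integral>\<^sup>+y. g (N, B, B', y) \<partial>labels) \<partial>?F)"
      using fin by (intro nn_integral_cong nn_integral_count_space') (auto simp: supp)
    also have "\<dots> = (\<Sum>B\<in>Pow {..<N}. \<Sum>B'\<in>Pow {..<N}. \<integral>\<^sup>+y. g (N, B, B', y) \<partial>labels)"
      using fin by (intro nn_integral_count_space') (auto simp: supp)
    finally show "(\<integral>\<^sup>+z. g (N, z) \<partial>(?F \<Otimes>\<^sub>M (?F \<Otimes>\<^sub>M labels))) =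
        (\<Sum>B\<in>Pow {..<N}. \<Sum>B'\<in>Pow {..<N}. \<integral>\<^sup>+y. g (N, B, B', y) \<partial>labels)" .
  qed
  finally show ?thesis .
qed

end

text \<open>The points of both processes together are a sample of labels; \<open>B\<close> selects those of the
  first process, and its complement those of the second.\<close>
locale two_densities = reference lam for lam :: "'a::topological_space measure" +
  fixes f p :: "'a measure \<Rightarrow> real"
  assumes f_measurable [measurable]: "f \<in> borel_measurable config_space"
    and p_measurable [measurable]: "p \<in> borel_measurable config_space"
    and f_nonneg: "\<And>\<phi>. 0 \<le> f \<phi>" and p_nonneg: "\<And>\<phi>. 0 \<le> p \<phi>"
    and f_prob: "(\<integral>\<^sup>+\<phi>. ennreal (f \<phi>) \<partial>ref) = 1" and p_prob: "(\<integral>\<^sup>+\<phi>. ennreal (p \<phi>) \<partial>ref) = 1"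
begin

text \<open>The intersection with \<open>{..<N}\<close> keeps the weight meaningful and measurable
  for every set \<open>B\<close>; it changes nothing for the sets that are summed over.\<close>

definition weight :: "nat \<Rightarrow> (nat \<Rightarrow> 'a) \<Rightarrow> nat set \<Rightarrow> real" where
  "weight N y B = f (points y (B \<inter> {..<N})) * p (points y ({..<N} - B))"

lemma weight_nonneg: "0 \<le> weight N y B"
  by (simp add: weight_def f_nonneg p_nonneg)

lemma weight_measurable [measurable]: "(\<lambda>y. weight N y B) \<in> borel_measurable labels"
proof -
  have [measurable]: "(\<lambda>y. points y (B \<inter> {..<N})) \<in> measurable labels config_space"
    "(\<lambda>y. points y ({..<N} - B)) \<in> measurable labels config_space"
    by (auto intro!: measurable_points_PiM)
  show ?thesis
    unfolding weight_def by measurable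
qed

lemma switch_coupling_measurable [measurable]:
  "(\<lambda>y. switch_coupling (weight N y) t B B') \<in> borel_measurable labels"
  by (induction t arbitrary: B') (auto simp: switch_prob_def)

text \<open>All \<open>N\<close> labels have been treated, hence the second \<open>N\<close> in
  \<open>switch_coupling\<close>. That the total mass is 1 comes out of \<open>f_prob\<close> and
  \<open>p_prob\<close>.\<close>

definition coupling_density :: "nat \<times> nat set \<times> nat set \<times> (nat \<Rightarrow> 'a) \<Rightarrow> ennreal" where
  "coupling_density = (\<lambda>(N, B, B', y). if B \<subseteq> {..<N} \<and> B' \<subseteq> {..<N}
     then poisson_weight N * ennreal (switch_coupling (weight N y) N B B') else 0)"

definition config_pair :: "nat \<times> nat set \<times> nat set \<times> (nat \<Rightarrow> 'a) \<Rightarrow> 'a measure \<times> 'a measure" where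
  "config_pair = (\<lambda>(N, B, B', y). (points y B, points y ({..<N} - B')))"

definition coupling :: "('a measure \<times> 'a measure) measure" where
  "coupling = distr (density index_space coupling_density) (config_space \<Otimes>\<^sub>M config_space) config_pair"

lemma coupling_density_measurable [measurable]: "coupling_density \<in> borel_measurable index_space"
  by (rule measurable_index_space) (simp add: coupling_density_def)

lemma config_pair_measurable [measurable]:
  "config_pair \<in> measurable index_space (config_space \<Otimes>\<^sub>M config_space)"
proof (rule measurable_index_space)
  fix N :: nat and B B' :: "nat set" assume "finite B" "finite B'"
  then have [measurable]: "(\<lambda>y. points y B) \<in> measurable labels config_space"
    "(\<lambda>y. points y ({..<N} - B')) \<in> measurable labels config_space"
    by (auto intro!: measurable_points_PiM)
  show "(\<lambda>y. config_pair (N, B, B', y)) \<in> measurable labels (config_space \<Otimes>\<^sub>M config_space)"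
    unfolding config_pair_def by simp
qed

lemma nn_integral_coupling_density:
  assumes h: "\<And>N B B'. finite B \<Longrightarrow> finite B' \<Longrightarrow> (\<lambda>y. h (N, B, B', y)) \<in> borel_measurable labels"
  shows "(\<integral>\<^sup>+w. h w \<partial>density index_space coupling_density) =
    (\<Sum>N. poisson_weight N * (\<integral>\<^sup>+y. (\<Sum>B\<in>Pow {..<N}. \<Sum>B'\<in>Pow {..<N}.
      ennreal (switch_coupling (weight N y) N B B') * h (N, B, B', y)) \<partial>labels))"
proof -
  let ?e = "\<lambda>N B B' y. ennreal (switch_coupling (weight N y) N B B') * h (N, B, B', y)"
  have fin: "finite B" if "B \<subseteq> {..<N}" for B and N :: nat
    using that finite_subset by blast
  have hm: "?e N B B'
      \<in> borel_measurable labels" if "B \<subseteq> {..<N}" "B' \<subseteq> {..<N}" for N B B'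
    using h[OF fin[OF that(1)] fin[OF that(2)], of N] by measurable
  have d: "(\<lambda>y. coupling_density (N, B, B', y)) \<in> borel_measurable labels" for N B B'
    by (simp add: coupling_density_def)
  have "(\<integral>\<^sup>+w. h w \<partial>density index_space coupling_density) =
      (\<integral>\<^sup>+w. coupling_density w * h w \<partial>index_space)"
    by (intro nn_integral_density coupling_density_measurable measurable_index_space h)
  also have "\<dots> = (\<Sum>N. \<Sum>B\<in>Pow {..<N}. \<Sum>B'\<in>Pow {..<N}.
      \<integral>\<^sup>+y. coupling_density (N, B, B', y) * h (N, B, B', y) \<partial>labels)"
  proof (rule nn_integral_index_space)
    show "(\<lambda>y. coupling_density (N, B, B', y) * h (N, B, B', y)) \<in> borel_measurable labels"
      if "finite B" "finite B'" for N B B'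
      using d[of N B B'] h[OF that, of N] by measurable
  qed (auto simp: coupling_density_def)
  also have "\<dots> = (\<Sum>N. \<Sum>B\<in>Pow {..<N}. \<Sum>B'\<in>Pow {..<N}. \<integral>\<^sup>+y. poisson_weight N *
      ?e N B B' y \<partial>labels)"
    by (intro suminf_cong sum.cong refl nn_integral_cong)
      (simp add: coupling_density_def mult.assoc)
  also have "\<dots> = (\<Sum>N. \<integral>\<^sup>+y. (\<Sum>B\<in>Pow {..<N}. \<Sum>B'\<in>Pow {..<N}. poisson_weight N *
      ?e N B B' y) \<partial>labels)"
  proof (rule suminf_cong)
    fix N
    have m: "(\<lambda>y. poisson_weight N * ?e N B B' y)
        \<in> borel_measurable labels" if "B \<in> Pow {..<N}" "B' \<in> Pow {..<N}" for B B'
      using hm[of B N B'] that by simp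
    show "(\<Sum>B\<in>Pow {..<N}. \<Sum>B'\<in>Pow {..<N}. \<integral>\<^sup>+y. poisson_weight N *
        ?e N B B' y \<partial>labels) =
      (\<integral>\<^sup>+y. (\<Sum>B\<in>Pow {..<N}. \<Sum>B'\<in>Pow {..<N}. poisson_weight N *
        ?e N B B' y) \<partial>labels)"
      by (simp only: nn_integral_sum borel_measurable_sum m cong: sum.cong)
  qed
  also have "\<dots> = (\<Sum>N. poisson_weight N * (\<integral>\<^sup>+y. (\<Sum>B\<in>Pow {..<N}. \<Sum>B'\<in>Pow {..<N}.
      ?e N B B' y) \<partial>labels))"
    unfolding sum_distrib_left[symmetric]
    by (intro suminf_cong nn_integral_cmult borel_measurable_sum hm) auto
  finally show ?thesis .
qed

lemma row_sum:
  "(\<Sum>B\<in>Pow {..<N}. \<Sum>B'\<in>Pow {..<N}. ennreal (switch_coupling (weight N y) N B B') * h B) =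
    (\<Sum>B\<in>Pow {..<N}. ennreal (weight N y B) * h B)"
proof (rule sum.cong[OF refl])
  fix B assume "B \<in> Pow {..<N}"
  then have "(\<Sum>B'\<in>Pow {..<N}. ennreal (switch_coupling (weight N y) N B B')) = ennreal (weight N y B)"
    using switch_coupling_row[of N N B "weight N y"]
    by (subst sum_ennreal) (auto simp: switch_coupling_nonneg weight_nonneg)
  then show "(\<Sum>B'\<in>Pow {..<N}. ennreal (switch_coupling (weight N y) N B B') * h B) =
      ennreal (weight N y B) * h B"
    by (simp add: sum_distrib_right[symmetric])
qed

lemma col_sum:
  "(\<Sum>B\<in>Pow {..<N}. \<Sum>B'\<in>Pow {..<N}. ennreal (switch_coupling (weight N y) N B B') * h B') =
    (\<Sum>B\<in>Pow {..<N}. ennreal (weight N y B) * h B)"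
proof (subst sum.swap, rule sum.cong[OF refl])
  fix B' assume "B' \<in> Pow {..<N}"
  then have "(\<Sum>B\<in>Pow {..<N}. ennreal (switch_coupling (weight N y) N B B')) = ennreal (weight N y B')"
    using switch_coupling_col[of "weight N y" N N B']
    by (subst sum_ennreal) (auto simp: switch_coupling_nonneg weight_nonneg)
  then show "(\<Sum>B\<in>Pow {..<N}. ennreal (switch_coupling (weight N y) N B B') * h B') =
      ennreal (weight N y B') * h B'"
    by (simp add: sum_distrib_right[symmetric])
qed

text \<open>The weight is a function of the points in \<open>B\<close> times a function of the
  remaining ones, so under \<open>sum_labels_ref\<close> the integral factorises.\<close>

lemma sum_weight:
  assumes [measurable]: "F \<in> borel_measurable config_space" "F' \<in> borel_measurable config_space"
  shows "(\<Sum>N. poisson_weight N * (\<integral>\<^sup>+y. (\<Sum>B\<in>Pow {..<N}. ennreal (weight N y B) *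
      (F (points y B) * F' (points y ({..<N} - B)))) \<partial>labels)) =
    (\<integral>\<^sup>+\<phi>. ennreal (f \<phi>) * F \<phi> \<partial>ref) * (\<integral>\<^sup>+\<psi>. ennreal (p \<psi>) * F' \<psi> \<partial>ref)"
proof -
  let ?G = "\<lambda>\<phi> \<psi>. (ennreal (f \<phi>) * F \<phi>) * (ennreal (p \<psi>) * F' \<psi>)"
  let ?I = "\<lambda>N. \<integral>\<^sup>+y. (\<Sum>B\<in>Pow {..<N}. ennreal (weight N y B) *
      (F (points y B) * F' (points y ({..<N} - B)))) \<partial>labels"
  let ?g = "\<lambda>N B y. ?G (points y B) (points y ({..<N} - B))"
  have "?I N =
    (\<Sum>B\<in>Pow {..<N}. integral\<^sup>N labels (?g N B))" for N
  proof -
    have [measurable]: "(\<lambda>y. points y B) \<in> measurable labels config_space"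
      "(\<lambda>y. points y ({..<N} - B)) \<in> measurable labels config_space" if "B \<in> Pow {..<N}" for B
      using that finite_subset[of B "{..<N}"] by (auto intro!: measurable_points_PiM)
    have "?I N =
      (\<integral>\<^sup>+y. (\<Sum>B\<in>Pow {..<N}. ?g N B y) \<partial>labels)"
      by (intro nn_integral_cong sum.cong refl)
        (auto simp: weight_def ennreal_mult f_nonneg p_nonneg Int_absorb2 ac_simps)
    also have "\<dots> = (\<Sum>B\<in>Pow {..<N}. integral\<^sup>N labels (?g N B))"
      by (rule nn_integral_sum) measurable
    finally show ?thesis .
  qed
  then have "(\<Sum>N. poisson_weight N * ?I N) = (\<integral>\<^sup>+\<phi>. \<integral>\<^sup>+\<psi>. ?G \<phi> \<psi> \<partial>ref \<partial>ref)"
    by (simp only:) (rule sum_labels_ref, measurable)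
  also have "\<dots> = (\<integral>\<^sup>+\<phi>. ennreal (f \<phi>) * F \<phi> \<partial>ref) * (\<integral>\<^sup>+\<psi>. ennreal (p \<psi>) * F' \<psi> \<partial>ref)"
    by (simp add: nn_integral_cmult nn_integral_multc)
  finally show ?thesis .
qed

text \<open>The target \<open>M\<close> is left open because \<open>couplings\<close> pushes forward
  into the marginal measures themselves rather than into \<open>config_space\<close>.\<close>

lemma emeasure_distr_coupling:
  assumes q: "q \<in> measurable (config_space \<Otimes>\<^sub>M config_space) config_space"
    and M: "sets M = sets config_space" and A: "A \<in> sets config_space"
  shows "emeasure (distr coupling M q) A =
    (\<integral>\<^sup>+w. indicator A (q (config_pair w)) \<partial>density index_space coupling_density)"
proof -
  have qM: "q \<in> measurable (config_space \<Otimes>\<^sub>M config_space) M"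
    using q measurable_cong_sets[OF refl M] by blast
  have "distr coupling M q = distr (density index_space coupling_density) M (q \<circ> config_pair)"
    unfolding coupling_def using qM by (intro distr_distr) auto
  then have "emeasure (distr coupling M q) A =
      (\<integral>\<^sup>+z. indicator A z \<partial>distr (density index_space coupling_density) M (q \<circ> config_pair))"
    using A M by simp
  also have "\<dots> = (\<integral>\<^sup>+w. indicator A ((q \<circ> config_pair) w) \<partial>density index_space coupling_density)"
    using A M qM by (intro nn_integral_distr) (auto intro: measurable_comp)
  finally show ?thesis by simp
qed

text \<open>The first marginal reads only \<open>B\<close>, whose weight \<open>row_sum\<close>
  provides, and \<open>p\<close> integrates to 1. The second reads only \<open>B'\<close>, which by
  \<open>col_sum\<close> has the same weight as \<open>B\<close>, so its complement is distributed
  with density \<open>p\<close> and \<open>f\<close> integrates to 1.\<close>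

lemma coupling_in_couplings:
  assumes mu: "mu = density ref (\<lambda>\<phi>. ennreal (f \<phi>))" and nu: "nu = density ref (\<lambda>\<phi>. ennreal (p \<phi>))"
  shows "coupling \<in> couplings mu nu"
proof -
  have s: "sets mu = sets config_space" "sets nu = sets config_space"
    by (simp_all add: mu nu)
  have "distr coupling mu fst = mu"
  proof (rule measure_eqI)
    fix A assume "A \<in> sets (distr coupling mu fst)"
    then have A [measurable]: "A \<in> sets config_space" by (simp add: s)
    have "emeasure (distr coupling mu fst) A =
        (\<integral>\<^sup>+w. indicator A (fst (config_pair w)) \<partial>density index_space coupling_density)"
      by (rule emeasure_distr_coupling) (simp_all add: s)
    also have "\<dots> = (\<Sum>N. poisson_weight N * (\<integral>\<^sup>+y. (\<Sum>B\<in>Pow {..<N}. \<Sum>B'\<in>Pow {..<N}.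
      ennreal (switch_coupling (weight N y) N B B') * indicator A (points y B)) \<partial>labels))"
      by (subst nn_integral_coupling_density)
        (auto simp: config_pair_def intro!: measurable_compose[OF measurable_points_PiM])
    also have "\<dots> = (\<Sum>N. poisson_weight N * (\<integral>\<^sup>+y. (\<Sum>B\<in>Pow {..<N}.
        ennreal (weight N y B) * (indicator A (points y B) * 1)) \<partial>labels))"
      by (simp only: row_sum mult_1_right)
    also have "\<dots> = (\<integral>\<^sup>+\<phi>. ennreal (f \<phi>) * indicator A \<phi> \<partial>ref) * (\<integral>\<^sup>+\<psi>. ennreal (p \<psi>) * 1 \<partial>ref)"
      by (rule sum_weight) measurable
    also have "\<dots> = (\<integral>\<^sup>+\<phi>. ennreal (f \<phi>) * indicator A \<phi> \<partial>ref)"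
      by (simp only: p_prob mult_1_right)
    also have "\<dots> = emeasure mu A"
      unfolding mu by (rule emeasure_density[symmetric]) (use A in simp_all)
    finally show "emeasure (distr coupling mu fst) A = emeasure mu A" .
  qed simp
  moreover have "distr coupling nu snd = nu"
  proof (rule measure_eqI)
    fix A assume "A \<in> sets (distr coupling nu snd)"
    then have A [measurable]: "A \<in> sets config_space" by (simp add: s)
    have "emeasure (distr coupling nu snd) A =
        (\<integral>\<^sup>+w. indicator A (snd (config_pair w)) \<partial>density index_space coupling_density)"
      by (rule emeasure_distr_coupling) (simp_all add: s)
    also have "\<dots> = (\<Sum>N. poisson_weight N * (\<integral>\<^sup>+y. (\<Sum>B\<in>Pow {..<N}. \<Sum>B'\<in>Pow {..<N}.
      ennreal (switch_coupling (weight N y) N B B') * indicator A (points y ({..<N} - B'))) \<partial>labels))"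
      by (subst nn_integral_coupling_density)
        (auto simp: config_pair_def intro!: measurable_compose[OF measurable_points_PiM])
    also have "\<dots> = (\<Sum>N. poisson_weight N * (\<integral>\<^sup>+y. (\<Sum>B\<in>Pow {..<N}.
        ennreal (weight N y B) * (1 * indicator A (points y ({..<N} - B)))) \<partial>labels))"
      by (simp only: col_sum mult_1_left)
    also have "\<dots> = (\<integral>\<^sup>+\<phi>. ennreal (f \<phi>) * 1 \<partial>ref) * (\<integral>\<^sup>+\<psi>. ennreal (p \<psi>) * indicator A \<psi> \<partial>ref)"
      by (rule sum_weight) measurable
    also have "\<dots> = (\<integral>\<^sup>+\<phi>. ennreal (p \<phi>) * indicator A \<phi> \<partial>ref)"
      by (simp only: f_prob mult_1_left mult_1_right)
    also have "\<dots> = emeasure nu A"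
      unfolding nu by (rule emeasure_density[symmetric]) (use A in simp_all)
    finally show "emeasure (distr coupling nu snd) A = emeasure nu A" .
  qed simp
  moreover have "sets coupling = sets (mu \<Otimes>\<^sub>M nu)"
    by (simp add: coupling_def s cong: sets_pair_measure_cong)
  ultimately show ?thesis
    by (simp add: couplings_def)
qed

lemma coupling_cost:
  "(\<integral>\<^sup>+(\<phi>, \<psi>). tv_dist \<phi> \<psi> \<partial>coupling) \<le> (\<integral>\<^sup>+x. \<integral>\<^sup>+\<phi>. \<integral>\<^sup>+\<psi>.
    ennreal \<bar>f (add_point x \<phi>) * p \<psi> - f \<phi> * p (add_point x \<psi>)\<bar> \<partial>ref \<partial>ref \<partial>lam)"
proof -
  let ?G = "\<lambda>x \<phi> \<psi>. ennreal \<bar>f (add_point x \<phi>) * p \<psi> - f \<phi> * p (add_point x \<psi>)\<bar>"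
  \<comment> \<open>Off the relevant label sets the value \<open>\<infinity>\<close> makes the
    pointwise bound hold trivially, and \<open>coupling_density\<close> vanishes there.\<close>
  define h :: "nat \<times> nat set \<times> nat set \<times> (nat \<Rightarrow> 'a) \<Rightarrow> ennreal" where
    "h = (\<lambda>(N, B, B', y). if B \<subseteq> {..<N} \<and> B' \<subseteq> {..<N} then of_nat (card (agree N B B')) else \<infinity>)"
  let ?e = "\<lambda>N B B' y. ennreal (switch_coupling (weight N y) N B B') * h (N, B, B', y)"
  let ?g = "\<lambda>N t B y. ?G (y t) (points y B) (points y ({..<N} - {t} - B))"
  have tv: "(case config_pair w of (\<phi>, \<psi>) \<Rightarrow> tv_dist \<phi> \<psi>) \<le> h w" for w
  proof -
    obtain N B B' y where w: "w = (N, B, B', y)" by (metis prod_cases4)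
    show ?thesis
    proof (cases "B \<subseteq> {..<N} \<and> B' \<subseteq> {..<N}")
      case True
      then have "finite B" using finite_subset by blast
      \<comment> \<open>The symmetric difference of \<open>B\<close> with the complement of
        \<open>B'\<close> consists of the labels on which \<open>B\<close> and \<open>B'\<close>
        agree.\<close>
      moreover have "B - ({..<N} - B') \<union> ({..<N} - B' - B) = agree N B B'"
        using True by (auto simp: agree_def)
      ultimately show ?thesis
        using tv_dist_points_le[of B "{..<N} - B'" y] True
        by (simp add: w h_def config_pair_def)
    qed (auto simp: w h_def)
  qed
  \<comment> \<open>An inequality, since the integrand \<open>tv_dist\<close> is not known to be
    measurable.\<close>
  have "(\<integral>\<^sup>+(\<phi>, \<psi>). tv_dist \<phi> \<psi> \<partial>coupling) \<le>
      (\<integral>\<^sup>+w. (case config_pair w of (\<phi>, \<psi>) \<Rightarrow> tv_dist \<phi> \<psi>) \<partial>density index_space coupling_density)"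
    unfolding coupling_def by (rule nn_integral_distr_le) simp
  also have "\<dots> \<le> (\<integral>\<^sup>+w. h w \<partial>density index_space coupling_density)"
    by (intro nn_integral_mono tv)
  also have "\<dots> = (\<Sum>N. poisson_weight N * (\<integral>\<^sup>+y. (\<Sum>B\<in>Pow {..<N}. \<Sum>B'\<in>Pow {..<N}.
      ?e N B B' y) \<partial>labels))"
    by (rule nn_integral_coupling_density) (simp add: h_def)
  also have "\<dots> = (\<Sum>N. poisson_weight N * (\<Sum>t<N. \<Sum>B\<in>Pow ({..<N} - {t}).
      integral\<^sup>N labels (?g N t B)))"
  proof (intro suminf_cong arg_cong[where f = "\<lambda>t. poisson_weight _ * t"])
    fix N
    have cost: "(\<Sum>B\<in>Pow {..<N}. \<Sum>B'\<in>Pow {..<N}.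
        ?e N B B' y) =
      (\<Sum>t<N. \<Sum>B\<in>Pow ({..<N} - {t}). ?g N t B y)" for y
    proof -
      have "(\<Sum>B\<in>Pow {..<N}. \<Sum>B'\<in>Pow {..<N}.
          ?e N B B' y) =
        (\<Sum>B\<in>Pow {..<N}. \<Sum>B'\<in>Pow {..<N}.
          ennreal (switch_coupling (weight N y) N B B' * card (agree N B B')))"
        by (intro sum.cong refl) (auto simp: h_def ennreal_of_nat_eq_real_of_nat ennreal_mult
            switch_coupling_nonneg weight_nonneg)
      also have "\<dots> = ennreal (\<Sum>B\<in>Pow {..<N}. \<Sum>B'\<in>Pow {..<N}.
          switch_coupling (weight N y) N B B' * card (agree N B B'))"
        by (simp add: sum_ennreal sum_nonneg switch_coupling_nonneg weight_nonneg)
      also have "\<dots> = ennreal (\<Sum>t<N. \<Sum>B\<in>Pow ({..<N} - {t}). \<bar>weight N y (insert t B) - weight N y B\<bar>)"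
        by (simp add: switch_coupling_cost[of "weight N y", OF weight_nonneg] sum_diff_min_flip)
      also have "\<dots> = (\<Sum>t<N. \<Sum>B\<in>Pow ({..<N} - {t}). ennreal \<bar>weight N y (insert t B) - weight N y B\<bar>)"
        by (simp add: sum_ennreal sum_nonneg)
      also have "\<dots> = (\<Sum>t<N. \<Sum>B\<in>Pow ({..<N} - {t}).
          ?g N t B y)"
      proof (intro sum.cong refl)
        fix t B assume t: "t \<in> {..<N}" and B: "B \<in> Pow ({..<N} - {t})"
        then have "finite B" using finite_subset by blast
        \<comment> \<open>Moving \<open>t\<close> into \<open>B\<close> takes it out of the other
          sample, so both weights share the points of \<open>B\<close> and of \<open>?R\<close> and
          differ only in which side receives \<open>y t\<close>.\<close>
        let ?R = "{..<N} - {t} - B"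
        have e: "insert t B \<inter> {..<N} = insert t B" "B \<inter> {..<N} = B"
          "{..<N} - insert t B = ?R" "{..<N} - B = insert t ?R"
          using t B by auto
        have "t \<notin> B" "finite ?R" "t \<notin> ?R"
          using B by auto
        then have "weight N y (insert t B) = f (add_point (y t) (points y B)) * p (points y ?R)"
          "weight N y B = f (points y B) * p (add_point (y t) (points y ?R))"
          unfolding weight_def e using points_insert[of B t y] points_insert[of ?R t y] \<open>finite B\<close>
          by simp_all
        then show "ennreal \<bar>weight N y (insert t B) - weight N y B\<bar> =
            ?g N t B y"
          by simp
      qed
      finally show ?thesis .
    qed
    have meas: "?g N t B \<in> borel_measurable labels"
      if "B \<in> Pow ({..<N} - {t})" for t B
    proof -
      have [measurable]: "(\<lambda>y. points y B) \<in> measurable labels config_space"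
        "(\<lambda>y. points y ({..<N} - {t} - B)) \<in> measurable labels config_space"
        "(\<lambda>y. y t) \<in> measurable labels borel"
        using that finite_subset[of B "{..<N} - {t}"]
        by (auto intro!: measurable_points_PiM measurable_component_singleton
            simp: measurable_cong_sets[OF refl sets_lam[symmetric]])
      show ?thesis by measurable
    qed
    show "(\<integral>\<^sup>+y. (\<Sum>B\<in>Pow {..<N}. \<Sum>B'\<in>Pow {..<N}.
        ?e N B B' y) \<partial>labels) =
      (\<Sum>t<N. \<Sum>B\<in>Pow ({..<N} - {t}).
        integral\<^sup>N labels (?g N t B))"
      by (simp only: cost nn_integral_sum borel_measurable_sum meas)
  qed
  also have "\<dots> = (\<integral>\<^sup>+x. \<integral>\<^sup>+\<phi>. \<integral>\<^sup>+\<psi>. ?G x \<phi> \<psi> \<partial>ref \<partial>ref \<partial>lam)"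
    by (rule sum_labels_ref_edge) measurable
  finally show ?thesis .
qed

end

text \<open>By \<open>density_add_point\<close> the integrand of \<open>coupling_cost\<close> is
  almost everywhere \<open>f \<phi> * p \<psi> * \<bar>c x \<phi> - d x \<psi>\<bar>\<close>, and
  the factors \<open>f\<close> and \<open>p\<close> turn the two copies of \<open>ref\<close> into
  \<open>mu\<close> and \<open>nu\<close>.\<close>

lemma (in carrier) coupling_of_papangelou_laws:
  assumes mu: "papangelou_law lam K S0 mu c" and nu: "papangelou_law lam K S0 nu d"
  shows "\<exists>C\<in>couplings mu nu. (\<integral>\<^sup>+(\<phi>, \<psi>). tv_dist \<phi> \<psi> \<partial>C) \<le>
    (\<integral>\<^sup>+x. \<integral>\<^sup>+\<phi>. \<integral>\<^sup>+\<psi>. ennreal \<bar>c x \<phi> - d x \<psi>\<bar> \<partial>nu \<partial>mu \<partial>lam)"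
proof -
  interpret A: papangelou_law lam K S0 mu c by fact
  interpret B: papangelou_law lam K S0 nu d by fact
  obtain f where f: "f \<in> borel_measurable config_space" "\<And>\<phi>. 0 \<le> f \<phi>"
    "mu = density ref (\<lambda>\<phi>. ennreal (f \<phi>))"
    using A.obtain_density by blast
  obtain p where p: "p \<in> borel_measurable config_space" "\<And>\<phi>. 0 \<le> p \<phi>"
    "nu = density ref (\<lambda>\<phi>. ennreal (p \<phi>))"
    using B.obtain_density by blast
  have prob: "(\<integral>\<^sup>+\<phi>. ennreal (h \<phi>) \<partial>ref) = 1"
    if "prob_space (density ref (\<lambda>\<phi>. ennreal (h \<phi>)))" "h \<in> borel_measurable config_space" for h
  proof -
    have "(\<integral>\<^sup>+\<phi>. ennreal (h \<phi>) \<partial>ref) = (\<integral>\<^sup>+\<phi>. ennreal (h \<phi>) * indicator (space ref) \<phi> \<partial>ref)"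
      by (intro nn_integral_cong) simp
    also have "\<dots> = emeasure (density ref (\<lambda>\<phi>. ennreal (h \<phi>))) (space ref)"
      using that(2) by (intro emeasure_density[symmetric] sets.top) auto
    also have "\<dots> = 1"
      using prob_space.emeasure_space_1[OF that(1)] by simp
    finally show ?thesis .
  qed
  interpret two_densities lam f p
    using f p prob A.mu.prob_space_axioms B.mu.prob_space_axioms
    by unfold_locales auto
  interpret LR: pair_sigma_finite lam ref ..
  note [measurable] = A.c_measurable B.c_measurable
  let ?G = "\<lambda>x \<phi> \<psi>. ennreal \<bar>f (add_point x \<phi>) * p \<psi> - f \<phi> * p (add_point x \<psi>)\<bar>"
  let ?D = "\<lambda>x \<phi>. \<integral>\<^sup>+\<psi>. ennreal \<bar>c x \<phi> - d x \<psi>\<bar> \<partial>nu"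
  have "AE x in lam. AE \<phi> in ref. f (add_point x \<phi>) = c x \<phi> * f \<phi>"
    using LR.AE_pair[OF A.density_add_point[OF f]] by simp
  moreover have "AE x in lam. AE \<psi> in ref. p (add_point x \<psi>) = d x \<psi> * p \<psi>"
    using LR.AE_pair[OF B.density_add_point[OF p]] by simp
  ultimately have "AE x in lam. (\<integral>\<^sup>+\<phi>. \<integral>\<^sup>+\<psi>. ?G x \<phi> \<psi> \<partial>ref \<partial>ref) =
    (\<integral>\<^sup>+\<phi>. ?D x \<phi> \<partial>mu)"
  proof eventually_elim
    case (elim x)
    have "AE \<phi> in ref.
        (\<integral>\<^sup>+\<psi>. ?G x \<phi> \<psi> \<partial>ref) =
        ennreal (f \<phi>) * ?D x \<phi>"
      using elim(1) AE_space
    proof eventually_elim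
      case f_eq: (elim \<phi>)
      then have [measurable]: "\<phi> \<in> space config_space" by simp
      have "AE \<psi> in ref. ?G x \<phi> \<psi> =
          ennreal (p \<psi>) * (ennreal (f \<phi>) * ennreal \<bar>c x \<phi> - d x \<psi>\<bar>)"
        using elim(2)
      proof eventually_elim
        case p_eq: (elim \<psi>)
        have "f (add_point x \<phi>) * p \<psi> - f \<phi> * p (add_point x \<psi>) =
            p \<psi> * (f \<phi> * (c x \<phi> - d x \<psi>))"
          unfolding f_eq(1) p_eq by (simp add: algebra_simps)
        then show ?case
          using f(2) p(2) by (simp add: abs_mult ennreal_mult)
      qed
      then have "(\<integral>\<^sup>+\<psi>. ?G x \<phi> \<psi> \<partial>ref) =
          (\<integral>\<^sup>+\<psi>. ennreal (p \<psi>) * (ennreal (f \<phi>) * ennreal \<bar>c x \<phi> - d x \<psi>\<bar>) \<partial>ref)"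
        by (rule nn_integral_cong_AE)
      also have "\<dots> = (\<integral>\<^sup>+\<psi>. ennreal (f \<phi>) * ennreal \<bar>c x \<phi> - d x \<psi>\<bar> \<partial>nu)"
        unfolding p(3) by (intro nn_integral_density[symmetric]) measurable
      also have "\<dots> = ennreal (f \<phi>) * ?D x \<phi>"
        by (intro nn_integral_cmult) measurable
      finally show ?case .
    qed
    then have "(\<integral>\<^sup>+\<phi>. \<integral>\<^sup>+\<psi>. ?G x \<phi> \<psi> \<partial>ref \<partial>ref) =
        (\<integral>\<^sup>+\<phi>. ennreal (f \<phi>) * ?D x \<phi> \<partial>ref)"
      by (rule nn_integral_cong_AE)
    also have "\<dots> = (\<integral>\<^sup>+\<phi>. ?D x \<phi> \<partial>mu)"
      unfolding f(3) by (intro nn_integral_density[symmetric]) measurable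
    finally show ?case .
  qed
  then have "(\<integral>\<^sup>+x. \<integral>\<^sup>+\<phi>. \<integral>\<^sup>+\<psi>. ?G x \<phi> \<psi> \<partial>ref \<partial>ref \<partial>lam) =
    (\<integral>\<^sup>+x. \<integral>\<^sup>+\<phi>. ?D x \<phi> \<partial>mu \<partial>lam)"
    by (rule nn_integral_cong_AE)
  with coupling_cost coupling_in_couplings[OF f(3) p(3)] show ?thesis
    by auto
qed

section \<open>The Mecke equation of a Poisson process\<close>

text \<open>The cells are the atoms generated by \<open>D\<close>: for each nonempty
  \<open>J\<close>, the points lying in exactly the members of \<open>J\<close>. Nonemptiness puts
  the cell inside a relatively compact set.\<close>

lemma relcompact_refinement:
  fixes D :: "'a::topological_space set set"
  assumes fin: "finite D" and D: "D \<subseteq> relcompact_borel"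
  shows "\<exists>(k::nat) A I. A ` {..<k} \<subseteq> relcompact_borel \<and> disjoint_family_on A {..<k} \<and>
    (\<forall>C\<in>D. I C \<subseteq> {..<k} \<and> C = (\<Union>i\<in>I C. A i))"
proof -
  let ?J = "Pow D - {{}}"
  define T where "T J = \<Inter>J - \<Union>(D - J)" for J :: "'a set set"
  have "finite ?J" using fin by simp
  then obtain e where e: "bij_betw e {0..<card ?J} ?J"
    using ex_bij_betw_nat_finite by blast
  let ?k = "card ?J"
  have e_in: "e i \<in> ?J" if "i < ?k" for i
    using bij_betwE[OF e] that by auto
  have rc: "T J \<in> relcompact_borel" if J: "J \<in> ?J" for J
  proof -
    obtain C where C: "C \<in> J" "C \<in> relcompact_borel"
      using J D by blast
    have JD: "J \<subseteq> D" "finite J" "J \<noteq> {}" "finite (D - J)"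
      using J fin finite_subset by auto
    have "(\<Inter>C\<in>J. C) \<in> sets borel"
      using JD D relcompact_borel_sets by (intro sets.finite_INT) auto
    then have "\<Inter>J \<in> sets borel"
      by simp
    moreover have "\<Union>(D - J) \<in> sets borel"
      using JD D relcompact_borel_sets by (intro sets.finite_Union) auto
    ultimately have "T J \<in> sets borel"
      unfolding T_def by (rule sets.Diff)
    moreover have "T J \<subseteq> C"
      unfolding T_def using C by blast
    ultimately show ?thesis
      by (intro relcompact_borel_subset[OF C(2)])
  qed
  have disj: "T J \<inter> T J' = {}" if "J \<in> ?J" "J' \<in> ?J" "J \<noteq> J'" for J J'
    using that unfolding T_def by blast
  show ?thesis
  proof (intro exI[of _ ?k] exI[of _ "\<lambda>i. T (e i)"] exI[of _ "\<lambda>C. {i. i < ?k \<and> C \<in> e i}"]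
      conjI ballI)
    show "(\<lambda>i. T (e i)) ` {..<?k} \<subseteq> relcompact_borel"
      by (intro image_subsetI rc e_in) simp
    show "disjoint_family_on (\<lambda>i. T (e i)) {..<?k}"
      unfolding disjoint_family_on_def
    proof (intro ballI impI)
      fix i j assume ij: "i \<in> {..<?k}" "j \<in> {..<?k}" "i \<noteq> j"
      then have "e i \<noteq> e j"
        using bij_betw_imp_inj_on[OF e] by (auto simp: inj_on_def)
      with ij show "T (e i) \<inter> T (e j) = {}"
        using e_in by (intro disj) auto
    qed
    fix C assume C: "C \<in> D"
    show "C = (\<Union>i\<in>{i. i < ?k \<and> C \<in> e i}. T (e i))"
    proof
      show "C \<subseteq> (\<Union>i\<in>{i. i < ?k \<and> C \<in> e i}. T (e i))"
      proof
        fix x assume x: "x \<in> C"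
        let ?S = "{E \<in> D. x \<in> E}"
        have "?S \<in> ?J" using C x by blast
        then have "?S \<in> e ` {0..<?k}"
          using bij_betw_imp_surj_on[OF e] by simp
        then obtain i where i: "i < ?k" "e i = ?S" by force
        moreover have "x \<in> T ?S" unfolding T_def by blast
        ultimately show "x \<in> (\<Union>i\<in>{i. i < ?k \<and> C \<in> e i}. T (e i))"
          using C x by auto
      qed
      show "(\<Union>i\<in>{i. i < ?k \<and> C \<in> e i}. T (e i)) \<subseteq> C"
        unfolding T_def by blast
    qed
  qed auto
qed

text \<open>Events about a single count are not closed under intersection; conditions on finitely
  many counts are, and they generate the same \<open>\<sigma>\<close>-algebra.\<close>

definition cylinders :: "'a::topological_space measure set set" where
  "cylinders = {{\<phi> \<in> configurations. \<forall>C\<in>D. emeasure \<phi> C \<in> B C} | D B.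
     finite D \<and> D \<subseteq> relcompact_borel \<and> (\<forall>C. B C \<in> sets (borel :: ennreal measure))}"

lemma cylinders_config_space: "cylinders \<subseteq> sets config_space"
proof
  fix E :: "'a measure set" assume "E \<in> cylinders"
  then obtain D and B :: "'a set \<Rightarrow> ennreal set" where D: "finite D" "D \<subseteq> relcompact_borel"
    and B: "\<And>C. B C \<in> sets borel" and E: "E = {\<phi> \<in> configurations. \<forall>C\<in>D. emeasure \<phi> C \<in> B C}"
    unfolding cylinders_def by blast
  have "{\<phi> \<in> space config_space. emeasure \<phi> C \<in> B C} \<in> sets config_space" if "C \<in> D" for C
  proof -
    have [measurable]: "(\<lambda>\<phi>. emeasure \<phi> C) \<in> borel_measurable config_space"
      using that D by (intro measurable_count) auto
    show ?thesis using B by measurable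
  qed
  then have "{\<phi> \<in> space config_space. \<forall>C\<in>D. emeasure \<phi> C \<in> B C} \<in> sets config_space"
    using D(1) by (intro sets.sets_Collect_finite_All) auto
  then show "E \<in> sets config_space" by (simp add: E)
qed

lemma Int_stable_cylinders: "Int_stable cylinders"
  unfolding Int_stable_def
proof (intro ballI)
  fix E E' :: "'a measure set" assume "E \<in> cylinders" "E' \<in> cylinders"
  then obtain D D' and B B' :: "'a set \<Rightarrow> ennreal set" where D: "finite D" "D \<subseteq> relcompact_borel"
    "\<And>C. B C \<in> sets borel" "E = {\<phi> \<in> configurations. \<forall>C\<in>D. emeasure \<phi> C \<in> B C}"
    "finite D'" "D' \<subseteq> relcompact_borel"
    "\<And>C. B' C \<in> sets borel" "E' = {\<phi> \<in> configurations. \<forall>C\<in>D'. emeasure \<phi> C \<in> B' C}"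
    unfolding cylinders_def by blast
  let ?B = "\<lambda>C. (if C \<in> D then B C else UNIV) \<inter> (if C \<in> D' then B' C else UNIV)"
  have "E \<inter> E' = {\<phi> \<in> configurations. \<forall>C\<in>D \<union> D'. emeasure \<phi> C \<in> ?B C}"
    unfolding D by auto
  moreover have "finite (D \<union> D')" "D \<union> D' \<subseteq> relcompact_borel" "\<forall>C. ?B C \<in> sets borel"
    using D by auto
  ultimately show "E \<inter> E' \<in> cylinders"
    unfolding cylinders_def by (intro CollectI exI[of _ "D \<union> D'"] exI[of _ ?B] conjI)
qed

lemma sets_config_space_cylinders:
  "sets (config_space :: 'a::topological_space measure measure) = sigma_sets configurations cylinders"
proof
  show "sigma_sets configurations cylinders \<subseteq> sets (config_space :: 'a measure measure)"
    using sets.sigma_sets_subset[OF cylinders_config_space] by simp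
  have "{\<phi> \<in> configurations. emeasure \<phi> A \<in> B} \<in> cylinders"
    if "A \<in> relcompact_borel" "B \<in> sets borel" for A :: "'a set" and B
    unfolding cylinders_def using that by (intro CollectI exI[of _ "{A}"] exI[of _ "\<lambda>_. B"]) auto
  then have "{{\<phi> \<in> configurations. emeasure \<phi> A \<in> B} | A B.
      A \<in> relcompact_borel \<and> B \<in> sets (borel :: ennreal measure)} \<subseteq> (cylinders :: 'a measure set set)"
    by auto
  then show "sets (config_space :: 'a measure measure) \<subseteq> sigma_sets configurations cylinders"
    unfolding sets_config_space using sigma_sets_mono[OF subset_trans[OF _ sigma_sets_superset_generator]]
    by blast
qed

section \<open>The law of a Poisson process\<close>

locale poisson = finite_measure M + Q: prob_space Q
  for M :: "'a::topological_space measure" and Q :: "'v measure" +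
  fixes \<zeta> :: "'v \<Rightarrow> 'a measure"
  assumes sets_M [measurable_cong, simp]: "sets M = sets borel"
    and poisson: "poisson_process Q M \<zeta>"
begin

lemma space_M [simp]: "space M = UNIV"
  using sets_eq_imp_space_eq[OF sets_M] by simp

lemma zeta_measurable [measurable]: "\<zeta> \<in> measurable Q config_space"
  using poisson by (simp add: poisson_process_def point_process_def)

lemma zeta_configurations [simp]: "\<omega> \<in> space Q \<Longrightarrow> \<zeta> \<omega> \<in> configurations"
  using measurable_space[OF zeta_measurable] by simp

definition law :: "'a measure measure" where
  "law = distr Q config_space \<zeta>"

sublocale law: prob_space law
  unfolding law_def by (rule Q.prob_space_distr) simp

lemma sets_law [measurable_cong, simp]: "sets law = sets config_space"
  by (simp add: law_def)

lemma space_law [simp]: "space law = configurations"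
  using sets_eq_imp_space_eq[OF sets_law] by simp

text \<open>Poisson probabilities with rate 0 included, where \<open>0 ^ 0 = 1\<close> gives the
  point mass at 0.\<close>

definition pois :: "real \<Rightarrow> nat \<Rightarrow> real" where
  "pois r n = r ^ n / fact n * exp (- r)"

lemma pois_nonneg: "0 \<le> r \<Longrightarrow> 0 \<le> pois r n"
  by (simp add: pois_def)

lemma pois_Suc: "real (Suc n) * pois r (Suc n) = r * pois r n"
  unfolding pois_def fact_Suc by (simp add: divide_simps del: of_nat_Suc)

text \<open>The Poisson formula for \<open>n = 0\<close> has value \<open>exp 0 = 1\<close>.\<close>

lemma void_probability:
  assumes "A \<in> relcompact_borel" "emeasure M A = 0"
  shows "AE \<phi> in law. emeasure \<phi> A = 0"
proof -
  have "measure Q {\<omega> \<in> space Q. emeasure (\<zeta> \<omega>) A = of_nat 0} = measure M A ^ 0 / fact 0 * exp (- measure M A)"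
    using poisson assms(1) unfolding poisson_process_def by blast
  then have p: "Q.prob {\<omega> \<in> space Q. emeasure (\<zeta> \<omega>) A = 0} = 1"
    using assms(2) by (simp add: measure_def)
  have c: "(\<lambda>\<phi>. emeasure \<phi> A) \<in> borel_measurable config_space"
    using assms(1) by (intro measurable_count) simp_all
  define cnt where "cnt \<omega> = emeasure (\<zeta> \<omega>) A" for \<omega>
  have [measurable]: "cnt \<in> borel_measurable Q"
    unfolding cnt_def using measurable_compose[OF zeta_measurable c] .
  have "Q.prob {\<omega> \<in> space Q. cnt \<omega> = 0} = 1"
    using p by (simp add: cnt_def)
  then have "AE \<omega> in Q. cnt \<omega> = 0"
    by (subst (asm) Q.prob_Collect_eq_1) measurable
  then have "AE \<omega> in Q. emeasure (\<zeta> \<omega>) A = 0"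
    by (simp only: cnt_def)
  moreover have "{\<phi> \<in> space config_space. emeasure \<phi> A = 0} =
      (\<lambda>\<phi>. emeasure \<phi> A) -` {0} \<inter> space config_space"
    by auto
  moreover have "\<dots> \<in> sets config_space"
    using c by (rule measurable_sets) simp
  ultimately show ?thesis
    unfolding law_def by (subst AE_distr_iff[OF zeta_measurable]) simp_all
qed

text \<open>On the event that disjoint sets \<open>A i\<close> contain \<open>n i\<close> points, the Mecke equation is the
  recursion \<open>n p(n) = r p(n - 1)\<close> of the Poisson probabilities.\<close>
context
  fixes k :: nat and A :: "nat \<Rightarrow> 'a set"
  assumes rc: "A ` {..<k} \<subseteq> relcompact_borel" and disj: "disjoint_family_on A {..<k}"
begin

definition count_event :: "(nat \<Rightarrow> nat) \<Rightarrow> 'a measure set" where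
  "count_event n = {\<phi> \<in> configurations. \<forall>i<k. emeasure \<phi> (A i) = of_nat (n i)}"

lemma A_borel: "i < k \<Longrightarrow> A i \<in> sets borel"
  using rc by (intro relcompact_borel_sets) (simp add: image_subset_iff)

lemma measurable_count_A: "i < k \<Longrightarrow> (\<lambda>\<phi>. emeasure \<phi> (A i)) \<in> borel_measurable config_space"
  using rc by (intro measurable_count measurable_ident_sets) (simp_all add: image_subset_iff)

lemma count_event_sets [measurable]: "count_event n \<in> sets config_space"
proof -
  have "{\<phi> \<in> space config_space. \<forall>i\<in>{..<k}. emeasure \<phi> (A i) = of_nat (n i)} \<in> sets config_space"
  proof (rule sets.sets_Collect_finite_All)
    fix i assume "i \<in> {..<k}"
    then have [measurable]: "(\<lambda>\<phi>. emeasure \<phi> (A i)) \<in> borel_measurable config_space"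
      using measurable_count_A by simp
    show "{\<phi> \<in> space config_space. emeasure \<phi> (A i) = of_nat (n i)} \<in> sets config_space"
      by measurable
  qed simp
  also have "{\<phi> \<in> space config_space. \<forall>i\<in>{..<k}. emeasure \<phi> (A i) = of_nat (n i)} = count_event n"
    by (simp only: space_config_space count_event_def Ball_def lessThan_iff)
  finally show ?thesis .
qed

text \<open>Independence of the counts on disjoint sets. With \<open>k = 0\<close> the intersection
  over the indices would be the universe instead of \<open>space Q\<close>, hence the
  assumption.\<close>

lemma emeasure_count_event:
  assumes "0 < k"
  shows "emeasure law (count_event n) = ennreal (\<Prod>i<k. pois (measure M (A i)) (n i))"
proof -
  let ?S = "\<lambda>i. (\<lambda>\<omega>. emeasure (\<zeta> \<omega>) (A i)) -` {of_nat (n i)} \<inter> space Q"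
  have ind: "Q.indep_vars (\<lambda>_. borel) (\<lambda>i \<omega>. emeasure (\<zeta> \<omega>) (A i)) {..<k}"
  proof -
    have "\<forall>(k::nat) A. A ` {..<k} \<subseteq> relcompact_borel \<and> disjoint_family_on A {..<k} \<longrightarrow>
        Q.indep_vars (\<lambda>_. borel) (\<lambda>i \<omega>. emeasure (\<zeta> \<omega>) (A i)) {..<k}"
      using poisson unfolding poisson_process_def by (elim conjE)
    from this[rule_format, OF conjI[OF rc disj]] show ?thesis .
  qed
  have "emeasure law (count_event n) = emeasure Q (\<zeta> -` count_event n \<inter> space Q)"
    unfolding law_def by (rule emeasure_distr) simp_all
  also have "\<zeta> -` count_event n \<inter> space Q =
      (\<Inter>i\<in>{..<k}. ?S i)"
    using assms zeta_configurations by (auto simp: count_event_def)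
  also have "emeasure Q \<dots> = ennreal (Q.prob \<dots>)"
    by (rule Q.emeasure_eq_measure)
  also have "Q.prob (\<Inter>i\<in>{..<k}. ?S i) =
      (\<Prod>i<k. Q.prob (?S i))"
    using assms by (intro Q.indep_varsD_finite[OF ind]) auto
  also have "\<dots> = (\<Prod>i<k. pois (measure M (A i)) (n i))"
  proof (rule prod.cong[OF refl])
    fix i assume "i \<in> {..<k}"
    then have "A i \<in> relcompact_borel" using rc by (simp add: image_subset_iff)
    then have "measure Q {\<omega> \<in> space Q. emeasure (\<zeta> \<omega>) (A i) = of_nat (n i)} = pois (measure M (A i)) (n i)"
      using poisson unfolding poisson_process_def pois_def by blast
    moreover have "?S i =
        {\<omega> \<in> space Q. emeasure (\<zeta> \<omega>) (A i) = of_nat (n i)}"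
      by auto
    ultimately show "Q.prob (?S i) =
        pois (measure M (A i)) (n i)"
      by simp
  qed
  finally show ?thesis .
qed

text \<open>The sets are disjoint, so a point in \<open>A i\<close> raises the count of
  \<open>A i\<close> alone.\<close>

lemma count_event_add_point:
  assumes "i < k" "x \<in> A i" "\<phi> \<in> configurations"
  shows "add_point x \<phi> \<in> count_event n \<longleftrightarrow> 0 < n i \<and> \<phi> \<in> count_event (n(i := n i - 1))"
proof -
  have e: "emeasure (add_point x \<phi>) (A j) = emeasure \<phi> (A j) + (if j = i then 1 else 0)" if "j < k" for j
  proof -
    have "x \<in> A j \<longleftrightarrow> j = i"
    proof (cases "j = i")
      case False
      then have "A j \<inter> A i = {}"
        using disjoint_family_onD[OF disj, of j i] assms(1) that by simp
      then show ?thesis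
        using False assms(2) by blast
    qed (use assms(2) in simp)
    then show ?thesis
      using A_borel[OF that] configurations_sets[OF assms(3)]
      by (simp add: emeasure_add_point indicator_def)
  qed
  \<comment> \<open>For \<open>m = 0\<close> the truncated \<open>m - 1\<close> would mislead; that
    case is excluded on the left because \<open>a + 1\<close> is not 0.\<close>
  have step: "a + 1 = of_nat m \<longleftrightarrow> 0 < m \<and> a = of_nat (m - 1)" for a :: ennreal and m :: nat
  proof (cases m)
    case (Suc l)
    have "a + 1 = of_nat m \<longleftrightarrow> 1 + a = 1 + of_nat l"
      by (simp add: Suc add.commute)
    also have "\<dots> \<longleftrightarrow> a = of_nat l"
      unfolding ennreal_add_left_cancel by simp
    finally show ?thesis by (simp add: Suc)
  qed simp
  show ?thesis
  proof
    assume "add_point x \<phi> \<in> count_event n"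
    then have "\<And>j. j < k \<Longrightarrow> emeasure \<phi> (A j) + (if j = i then 1 else 0) = of_nat (n j)"
      using e by (simp add: count_event_def)
    note a = this
    have "0 < n i \<and> emeasure \<phi> (A i) = of_nat (n i - 1)"
      using a[OF assms(1)] step[of "emeasure \<phi> (A i)" "n i"] by simp
    moreover have "emeasure \<phi> (A j) = of_nat (n j)" if "j < k" "j \<noteq> i" for j
      using a[OF that(1)] that(2) by simp
    ultimately show "0 < n i \<and> \<phi> \<in> count_event (n(i := n i - 1))"
      using assms(3) by (auto simp: count_event_def)
  next
    assume b: "0 < n i \<and> \<phi> \<in> count_event (n(i := n i - 1))"
    have "emeasure (add_point x \<phi>) (A j) = of_nat (n j)" if "j < k" for j
    proof (cases "j = i")
      case True
      then have "emeasure \<phi> (A i) = of_nat (n i - 1)"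
        using b assms(1) by (simp add: count_event_def)
      then show ?thesis
        using e[OF that] True b step[of "emeasure \<phi> (A i)" "n i"] by simp
    next
      case False
      then show ?thesis
        using b e[OF that] that by (simp add: count_event_def)
    qed
    then show "add_point x \<phi> \<in> count_event n"
      using assms(3) by (simp add: count_event_def)
  qed
qed

text \<open>Only the factor of index \<open>i\<close> in the product changes, and there
  \<open>pois_Suc\<close> applies; for \<open>n i = 0\<close> both sides vanish.\<close>

lemma count_event_recursion:
  assumes i: "i < k"
  shows "of_nat (n i) * emeasure law (count_event n) =
    emeasure M (A i) * (if 0 < n i then emeasure law (count_event (n(i := n i - 1))) else 0)"
proof (cases "n i")
  case (Suc l)
  let ?m = "\<lambda>j. measure M (A j)" and ?n' = "n(i := n i - 1)"
  let ?R = "\<Prod>j\<in>{..<k} - {i}. pois (?m j) (n j)"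
  let ?P = "\<lambda>n. \<Prod>j<k. pois (?m j) (n j)"
  have k: "0 < k" using i by simp
  have "?P ?n' = pois (?m i) l * (\<Prod>j\<in>{..<k} - {i}. pois (?m j) (?n' j))"
    using i by (subst prod.remove[of _ i]) (auto simp: Suc)
  also have "(\<Prod>j\<in>{..<k} - {i}. pois (?m j) (?n' j)) = ?R"
    by (rule prod.cong) auto
  finally have 1: "?P ?n' = pois (?m i) l * ?R" .
  have 2: "?P n = pois (?m i) (Suc l) * ?R"
    using i by (subst prod.remove[of _ i]) (auto simp: Suc)
  have "real (n i) * ?P n =
      (real (Suc l) * pois (?m i) (Suc l)) * ?R"
    unfolding 2 Suc by (simp only: mult.assoc)
  also have "\<dots> = ?m i * ?P ?n'"
    unfolding 1 pois_Suc by (simp only: mult.assoc)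
  finally have "real (n i) * ?P n = ?m i * ?P ?n'" .
  then show ?thesis
    unfolding emeasure_count_event[OF k] emeasure_eq_measure ennreal_of_nat_eq_real_of_nat
    by (simp add: Suc ennreal_mult[symmetric] prod_nonneg pois_nonneg del: of_nat_Suc fun_upd_apply)
qed simp

text \<open>On the event the number of points in the union is the constant sum of the
  \<open>n i\<close>. Each term obeys the recursion, and since a point of the union lies in exactly
  one cell, the terms reassemble to an integral over \<open>x\<close>.\<close>

lemma mecke_count_event:
  assumes I: "I \<subseteq> {..<k}"
  shows "(\<integral>\<^sup>+\<phi>. emeasure \<phi> (\<Union>i\<in>I. A i) * indicator (count_event n) \<phi> \<partial>law) =
    (\<integral>\<^sup>+x. indicator (\<Union>i\<in>I. A i) x *
      (\<integral>\<^sup>+\<phi>. indicator (count_event n) (add_point x \<phi>) \<partial>law) \<partial>M)"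
proof -
  let ?J = "\<lambda>x. \<integral>\<^sup>+\<phi>. indicator (count_event n) (add_point x \<phi>) \<partial>law"
  have fin: "finite I" using I finite_subset by blast
  have dI: "disjoint_family_on A I"
    using disj I by (rule disjoint_family_on_mono[rotated])
  \<comment> \<open>The value of \<open>?J\<close> at every point of the cell
    \<open>A i\<close>.\<close>
  define w where "w i = (if 0 < n i then emeasure law (count_event (n(i := n i - 1))) else 0)" for i
  have "(\<integral>\<^sup>+\<phi>. emeasure \<phi> (\<Union>i\<in>I. A i) * indicator (count_event n) \<phi> \<partial>law) =
      (\<integral>\<^sup>+\<phi>. (\<Sum>i\<in>I. of_nat (n i)) * indicator (count_event n) \<phi> \<partial>law)"
  proof (rule nn_integral_cong)
    fix \<phi> assume "\<phi> \<in> space law"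
    then have s: "sets \<phi> = sets borel" by (simp add: configurations_sets)
    have "emeasure \<phi> (\<Union>i\<in>I. A i) = (\<Sum>i\<in>I. emeasure \<phi> (A i))"
      using dI fin A_borel I s by (intro sum_emeasure[symmetric]) auto
    moreover have "(\<Sum>i\<in>I. emeasure \<phi> (A i)) = (\<Sum>i\<in>I. of_nat (n i))" if "\<phi> \<in> count_event n"
      using that I by (intro sum.cong) (auto simp: count_event_def)
    ultimately show "emeasure \<phi> (\<Union>i\<in>I. A i) * indicator (count_event n) \<phi> =
        (\<Sum>i\<in>I. of_nat (n i)) * indicator (count_event n) \<phi>"
      by (cases "\<phi> \<in> count_event n") simp_all
  qed
  also have "\<dots> = (\<Sum>i\<in>I. of_nat (n i)) * emeasure law (count_event n)"
    by (rule nn_integral_cmult_indicator) simp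
  also have "\<dots> = (\<Sum>i\<in>I. emeasure M (A i) * w i)"
    unfolding sum_distrib_right w_def using I by (intro sum.cong refl count_event_recursion) auto
  also have "\<dots> = (\<Sum>i\<in>I. \<integral>\<^sup>+x. w i * indicator (A i) x \<partial>M)"
    using I A_borel
    by (intro sum.cong refl, subst nn_integral_cmult_indicator) (auto simp: mult.commute)
  also have "\<dots> = (\<integral>\<^sup>+x. (\<Sum>i\<in>I. w i * indicator (A i) x) \<partial>M)"
  proof (rule nn_integral_sum[symmetric])
    fix i assume "i \<in> I"
    then have [measurable]: "A i \<in> sets borel" using I by (intro A_borel) auto
    show "(\<lambda>x. w i * indicator (A i) x) \<in> borel_measurable M"
      by measurable
  qed
  also have "\<dots> = (\<integral>\<^sup>+x. indicator (\<Union>i\<in>I. A i) x *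
      ?J x \<partial>M)"
  proof (rule nn_integral_cong)
    fix x
    show "(\<Sum>i\<in>I. w i * indicator (A i) x) = indicator (\<Union>i\<in>I. A i) x *
      ?J x"
    proof (cases "x \<in> (\<Union>i\<in>I. A i)")
      case True
      then obtain i where i: "i \<in> I" "x \<in> A i" by blast
      have "(\<Sum>j\<in>I. w j * indicator (A j) x) = (\<Sum>j\<in>I. if j = i then w i else 0)"
      proof (rule sum.cong[OF refl])
        fix j assume j: "j \<in> I"
        show "w j * indicator (A j) x = (if j = i then w i else 0)"
        proof (cases "j = i")
          case False
          then have "x \<notin> A j"
            using disjoint_family_onD[OF dI j i(1)] i(2) by blast
          with False show ?thesis by simp
        qed (use i in simp)
      qed
      also have "\<dots> = w i"
        using i fin by simp
      also have "\<dots> = (\<integral>\<^sup>+\<phi>. (if 0 < n i then 1 else 0) * indicator (count_event (n(i := n i - 1))) \<phi> \<partial>law)"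
        by (simp add: w_def)
      also have "\<dots> = ?J x"
      proof (rule nn_integral_cong)
        fix \<phi> assume "\<phi> \<in> space law"
        then have "add_point x \<phi> \<in> count_event n \<longleftrightarrow> 0 < n i \<and> \<phi> \<in> count_event (n(i := n i - 1))"
          using i I by (intro count_event_add_point) auto
        then show "(if 0 < n i then 1 else 0) * indicator (count_event (n(i := n i - 1))) \<phi> =
            (indicator (count_event n) (add_point x \<phi>) :: ennreal)"
          unfolding indicator_def by simp
      qed
      finally show ?thesis
        using True by simp
    next
      case False
      then have "(\<Sum>i\<in>I. w i * indicator (A i) x) = 0"
        by (intro sum.neutral) simp
      with False show ?thesis by simp
    qed
  qed
  finally show ?thesis .
qed

end

text \<open>Both sides are measures in \<open>B\<close>, of finite mass because \<open>M\<close> is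
  finite, so cylinders suffice. A cylinder splits into countably many count events of a common
  refinement, where \<open>mecke_count_event\<close> applies.\<close>

lemma law_mecke:
  assumes A: "A \<in> relcompact_borel" and B: "B \<in> sets config_space"
  shows "(\<integral>\<^sup>+\<phi>. emeasure \<phi> A * indicator B \<phi> \<partial>law) =
    (\<integral>\<^sup>+x. indicator A x * (\<integral>\<^sup>+\<phi>. indicator B (add_point x \<phi>) \<partial>law) \<partial>M)"
proof -
  let ?J = "\<lambda>E x. \<integral>\<^sup>+\<phi>. indicator E (add_point x \<phi>) \<partial>law"
  define cnt where "cnt \<phi> = emeasure \<phi> A" for \<phi> :: "'a measure"
  have [measurable]: "cnt \<in> borel_measurable config_space"
    unfolding cnt_def using A by (intro measurable_count measurable_ident_sets) simp_all
  have [measurable]: "A \<in> sets borel"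
    using A by (rule relcompact_borel_sets)
  define N1 where "N1 = density law cnt"
  define N2 where "N2 = distr (density (M \<Otimes>\<^sub>M law) (\<lambda>z. indicator A (fst z))) config_space
      (\<lambda>z. add_point (fst z) (snd z))"
  have N1: "emeasure N1 E = (\<integral>\<^sup>+\<phi>. emeasure \<phi> A * indicator E \<phi> \<partial>law)" if "E \<in> sets config_space" for E
    using that unfolding N1_def cnt_def[symmetric] by (intro emeasure_density) auto
  have N2: "emeasure N2 E = (\<integral>\<^sup>+x. indicator A x * ?J E x \<partial>M)"
    if E [measurable]: "E \<in> sets config_space" for E
  proof -
    have "emeasure N2 E = (\<integral>\<^sup>+y. indicator E y \<partial>N2)"
      by (simp add: N2_def)
    also have "\<dots> = (\<integral>\<^sup>+z. indicator E (add_point (fst z) (snd z))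
        \<partial>density (M \<Otimes>\<^sub>M law) (\<lambda>z. indicator A (fst z)))"
      unfolding N2_def by (intro nn_integral_distr) measurable
    also have "\<dots> = (\<integral>\<^sup>+z. indicator A (fst z) * indicator E (add_point (fst z) (snd z)) \<partial>(M \<Otimes>\<^sub>M law))"
      by (intro nn_integral_density) measurable
    also have "\<dots> = (\<integral>\<^sup>+x. \<integral>\<^sup>+\<phi>. indicator A x * indicator E (add_point x \<phi>) \<partial>law \<partial>M)"
      by (subst law.nn_integral_fst[symmetric]) simp_all
    also have "\<dots> = (\<integral>\<^sup>+x. indicator A x * ?J E x \<partial>M)"
      by (intro nn_integral_cong nn_integral_cmult) measurable
    finally show ?thesis .
  qed
  have agree: "emeasure N1 E = emeasure N2 E" if cyl: "E \<in> cylinders" for E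
  proof -
    obtain D and F :: "'a set \<Rightarrow> ennreal set" where D: "finite D" "D \<subseteq> relcompact_borel"
      and E: "E = {\<phi> \<in> configurations. \<forall>C\<in>D. emeasure \<phi> C \<in> F C}"
      using cyl unfolding cylinders_def by blast
    \<comment> \<open>\<open>A\<close> joins the sets of the cylinder so that it, too, is a union of
      cells.\<close>
    have D': "finite (insert A D)" "insert A D \<subseteq> relcompact_borel"
      using D A by auto
    obtain k :: nat and T :: "nat \<Rightarrow> 'a set" and I where T: "T ` {..<k} \<subseteq> relcompact_borel"
      "disjoint_family_on T {..<k}"
      and TI: "\<forall>C\<in>insert A D. I C \<subseteq> {..<k} \<and> C = (\<Union>i\<in>I C. T i)"
      using relcompact_refinement[OF D'] by (elim exE conjE)
    have I1: "I C \<subseteq> {..<k}" if "C \<in> insert A D" for C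
      using bspec[OF TI that] by (rule conjunct1)
    have I2: "C = (\<Union>i\<in>I C. T i)" if "C \<in> insert A D" for C
      using bspec[OF TI that] by (rule conjunct2)
    let ?V = "count_event k T"
    \<comment> \<open>The count vectors of the cells that satisfy the conditions of the cylinder.
      Taking them extensional keeps \<open>Z\<close> countable and makes distinct vectors differ at
      some \<open>i < k\<close>.\<close>
    define Z where "Z = {n \<in> {..<k} \<rightarrow>\<^sub>E (UNIV :: nat set). \<forall>C\<in>D. (\<Sum>i\<in>I C. of_nat (n i)) \<in> F C}"
    have "countable Z"
      by (rule countable_subset[of _ "{..<k} \<rightarrow>\<^sub>E UNIV"]) (auto simp: Z_def intro!: countable_PiE)
    have count: "emeasure \<phi> C = (\<Sum>i\<in>I C. emeasure \<phi> (T i))" if "C \<in> D" "\<phi> \<in> configurations" for C \<phi>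
    proof -
      have "C \<in> insert A D" using that by simp
      note C = I1[OF this] I2[OF this]
      have "emeasure \<phi> C = emeasure \<phi> (\<Union>i\<in>I C. T i)"
        using C(2) by (rule arg_cong)
      also have "\<dots> = (\<Sum>i\<in>I C. emeasure \<phi> (T i))"
      proof (rule sum_emeasure[symmetric])
        show "T ` I C \<subseteq> sets \<phi>"
        proof (rule image_subsetI)
          fix i assume "i \<in> I C"
          then have "T i \<in> relcompact_borel" using C(1) T(1) by blast
          then show "T i \<in> sets \<phi>"
            unfolding configurations_sets[OF that(2)] by (rule relcompact_borel_sets)
        qed
        show "disjoint_family_on T (I C)"
          using C(1) T(2) by (rule disjoint_family_on_mono)
        show "finite (I C)"
          using C(1) finite_subset by blast
      qed
      finally show ?thesis .
    qed
    have sum_count: "(\<Sum>i\<in>I C. emeasure \<phi> (T i)) = (\<Sum>i\<in>I C. of_nat (n i))"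
      if "C \<in> D" "\<phi> \<in> ?V n" for C \<phi> n
      using that I1[of C] unfolding count_event_def[OF T(1,2)] by (intro sum.cong) auto
    have union: "E = (\<Union>n\<in>Z. ?V n)"
    proof (intro equalityI subsetI)
      fix \<phi> assume "\<phi> \<in> E"
      then have \<phi>: "\<phi> \<in> configurations" "\<And>C. C \<in> D \<Longrightarrow> emeasure \<phi> C \<in> F C"
        by (auto simp: E)
      have "\<exists>l. emeasure \<phi> (T i) = of_nat l" if "i < k" for i
      proof -
        have rc: "T i \<in> relcompact_borel"
          using T(1) that by (simp add: image_subset_iff)
        then have "emeasure \<phi> (T i) < \<infinity>"
          using \<phi>(1) unfolding configurations_def by blast
        moreover have "emeasure \<phi> (T i) \<in> range ennreal_of_enat"
          using \<phi>(1) relcompact_borel_sets[OF rc] unfolding configurations_def by blast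
        ultimately obtain e where e: "emeasure \<phi> (T i) = ennreal_of_enat e" "ennreal_of_enat e < \<infinity>"
          by auto
        then show ?thesis by (cases e) auto
      qed
      then obtain l where l: "\<And>i. i < k \<Longrightarrow> emeasure \<phi> (T i) = of_nat (l i)"
        by metis
      define n where "n = restrict l {..<k}"
      have V: "\<phi> \<in> ?V n"
        using l \<phi>(1) by (simp add: n_def count_event_def[OF T(1,2)])
      then have "n \<in> Z"
      proof -
        have "(\<Sum>i\<in>I C. of_nat (n i)) \<in> F C" if "C \<in> D" for C
          using \<phi>(2)[OF that] count[OF that \<phi>(1)] sum_count[OF that V] by simp
        then show ?thesis
          unfolding Z_def by (simp add: n_def restrict_PiE_iff)
      qed
      with V show "\<phi> \<in> (\<Union>n\<in>Z. ?V n)" by blast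
    next
      fix \<phi> assume "\<phi> \<in> (\<Union>n\<in>Z. ?V n)"
      then obtain n where n: "n \<in> Z" "\<phi> \<in> ?V n" by blast
      then have "\<phi> \<in> configurations" by (simp add: count_event_def[OF T(1,2)])
      then show "\<phi> \<in> E"
      proof -
        have "emeasure \<phi> C \<in> F C" if "C \<in> D" for C
          using n(1) that count[OF that \<open>\<phi> \<in> configurations\<close>] sum_count[OF that n(2)]
          by (simp add: Z_def)
        then show ?thesis
          using \<open>\<phi> \<in> configurations\<close> by (simp add: E)
      qed
    qed
    have disj: "disjoint_family_on ?V Z"
      unfolding disjoint_family_on_def
    proof (intro ballI impI)
      fix n n' assume nn: "n \<in> Z" "n' \<in> Z" "n \<noteq> n'"
      then obtain i where "i < k" "n i \<noteq> n' i"
        using PiE_ext[of n "{..<k}" "\<lambda>_. UNIV" n'] by (auto simp: Z_def)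
      then show "?V n \<inter> ?V n' = {}"
        by (auto simp: count_event_def[OF T(1,2)])
    qed
    note V = count_event_sets[OF T(1,2)]
    have "emeasure N1 E = (\<integral>\<^sup>+n. emeasure N1 (?V n) \<partial>count_space Z)"
      unfolding union using \<open>countable Z\<close> disj V by (intro emeasure_UN_countable) (auto simp: N1_def)
    also have "\<dots> = (\<integral>\<^sup>+n. emeasure N2 (?V n) \<partial>count_space Z)"
    proof (rule nn_integral_cong)
      fix n
      have IA: "I A \<subseteq> {..<k}" "A = (\<Union>i\<in>I A. T i)"
        using I1[of A] I2[of A] by (simp, blast)
      show "emeasure N1 (?V n) = emeasure N2 (?V n)"
        unfolding N1[OF V] N2[OF V] using mecke_count_event[OF T(1,2) IA(1)] unfolding IA(2)[symmetric] .
    qed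
    also have "\<dots> = emeasure N2 E"
      unfolding union using \<open>countable Z\<close> disj V
      by (intro emeasure_UN_countable[symmetric]) (auto simp: N2_def)
    finally show ?thesis .
  qed
  have top: "configurations \<in> cylinders"
    unfolding cylinders_def by (intro CollectI exI[of _ "{}"] exI[of _ "\<lambda>_. UNIV"]) auto
  have top_sets: "(configurations :: 'a measure set) \<in> sets config_space"
    using sets.top[of config_space] by simp
  have "emeasure N2 configurations = (\<integral>\<^sup>+x. indicator A x \<partial>M)"
    unfolding N2[OF top_sets]
  proof (rule nn_integral_cong)
    fix x
    have "(\<integral>\<^sup>+\<phi>. indicator configurations (add_point x \<phi>) \<partial>law) = (\<integral>\<^sup>+\<phi>. 1 \<partial>law)"
      by (intro nn_integral_cong) simp
    then show "indicator A x * (\<integral>\<^sup>+\<phi>. indicator configurations (add_point x \<phi>) \<partial>law) = indicator A x"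
      using law.emeasure_space_1 by simp
  qed
  then have fin: "emeasure N1 configurations \<noteq> \<infinity>"
    using agree[OF top] emeasure_finite by simp
  have "N1 = N2"
  proof (rule measure_eqI_generator_eq[OF Int_stable_cylinders _ agree])
    show "cylinders \<subseteq> Pow (configurations :: 'a measure set)"
      by (auto simp: cylinders_def)
    show "range (\<lambda>_ :: nat. configurations) \<subseteq> (cylinders :: 'a measure set set)"
      using top by auto
  qed (use fin in \<open>simp_all add: N1_def N2_def sets_config_space_cylinders[symmetric]\<close>)
  then show ?thesis
    using N1[OF B] N2[OF B] by simp
qed

end

section \<open>The reference measure\<close>

text \<open>The set where \<open>g\<close> is positive is a countable union of level sets of finite
  measure, and inner regularity exhausts each by countably many compact sets up to a null set. The
  point \<open>undefined\<close> is included to keep the union nonempty.\<close>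

lemma exists_sigma_compact_carrier:
  fixes L :: "'a::metric_space measure" and g :: "'a \<Rightarrow> ennreal"
  assumes L: "radon_measure L" and g: "g \<in> borel_measurable borel" and fin: "(\<integral>\<^sup>+x. g x \<partial>L) < \<infinity>"
  shows "\<exists>K :: nat \<Rightarrow> 'a set. (\<forall>j. compact (K j)) \<and> undefined \<in> K 0 \<and>
    (AE x in L. x \<notin> (\<Union>j. K j) \<longrightarrow> g x = 0)"
proof -
  have s [measurable_cong, simp]: "sets L = sets borel"
    using L by (simp add: radon_measure_def)
  then have sp [simp]: "space L = UNIV"
    using sets_eq_imp_space_eq[OF s] by simp
  note [measurable] = g
  \<comment> \<open>The level set where \<open>g\<close> is at least \<open>1 / Suc n\<close>;
    Markov's inequality bounds its measure.\<close>
  define A where "A n = {x. 1 \<le> of_nat (Suc n) * g x}" for n :: nat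
  have A [measurable]: "A n \<in> sets borel" for n
  proof -
    have "{x \<in> space borel. 1 \<le> of_nat (Suc n) * g x} \<in> sets borel"
      by measurable
    then show ?thesis by (simp add: A_def)
  qed
  have A_fin: "emeasure L (A n) < \<infinity>" for n
  proof -
    have "emeasure L ({x \<in> UNIV. 1 \<le> of_nat (Suc n) * g x}) \<le>
        of_nat (Suc n) * (\<integral>\<^sup>+x. g x * indicator UNIV x \<partial>L)"
      by (rule nn_integral_Markov_inequality) (use g in \<open>simp_all del: of_nat_Suc\<close>)
    also have "\<dots> < \<infinity>"
      using fin by (simp add: ennreal_mult_less_top of_nat_less_top del: of_nat_Suc)
    finally show ?thesis by (simp add: A_def)
  qed
  have "\<exists>C :: nat \<Rightarrow> 'a set. (\<forall>k. compact (C k) \<and> C k \<subseteq> A n) \<and> emeasure L (A n - (\<Union>k. C k)) = 0" for n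
  proof -
    let ?\<K> = "{K. compact K \<and> K \<subseteq> A n}"
    have "?\<K> \<noteq> {}" by (auto intro: exI[of _ "{}"])
    from ennreal_SUP_countable_SUP[OF this, of "emeasure L"]
    obtain f :: "nat \<Rightarrow> ennreal"
      where f: "range f \<subseteq> emeasure L ` ?\<K>" "Sup (emeasure L ` ?\<K>) = Sup (range f)"
      by blast
    have "\<forall>k. \<exists>C. C \<in> ?\<K> \<and> f k = emeasure L C"
      using f(1) by blast
    then obtain C where C: "\<And>k. C k \<in> ?\<K>" "\<And>k. f k = emeasure L (C k)"
      by metis
    have Cb [measurable]: "C k \<in> sets borel" for k
      using C(1)[of k] by (auto intro: borel_closed compact_imp_closed)
    have sub: "(\<Union>k. C k) \<subseteq> A n"
      using C(1) by blast
    have "emeasure L (A n) = Sup (range f)"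
      using L A[of n] f(2) by (simp add: radon_measure_def)
    also have "\<dots> \<le> emeasure L (\<Union>k. C k)"
      by (rule SUP_least) (auto simp: C(2) intro!: emeasure_mono)
    finally have "emeasure L (A n) = emeasure L (\<Union>k. C k)"
      using sub emeasure_mono[OF sub, of L] by (intro antisym) auto
    moreover have "emeasure L (A n - (\<Union>k. C k)) = emeasure L (A n) - emeasure L (\<Union>k. C k)"
      using sub A_fin[of n] emeasure_mono[OF sub, of L] by (intro emeasure_Diff) (auto simp: less_top[symmetric] top_unique)
    ultimately have "emeasure L (A n - (\<Union>k. C k)) = 0"
      using A_fin[of n] by simp
    with C(1) show ?thesis by blast
  qed
  then obtain C :: "nat \<Rightarrow> nat \<Rightarrow> 'a set" where C: "\<And>n k. compact (C n k)"
    "\<And>n. emeasure L (A n - (\<Union>k. C n k)) = 0"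
    by metis
  have Cb [measurable]: "C n k \<in> sets borel" for n k
    using C(1) by (intro borel_closed compact_imp_closed)
  define K where "K j = (case j of 0 \<Rightarrow> {undefined} | Suc i \<Rightarrow> case prod_decode i of (n, k) \<Rightarrow> C n k)"
    for j :: nat
  have null: "(\<Union>n. A n - (\<Union>k. C n k)) \<in> null_sets L"
    using C(2) by (intro null_sets_UN null_setsI) auto
  have CK: "C n k \<subseteq> (\<Union>j. K j)" for n k
  proof -
    have "C n k = K (Suc (prod_encode (n, k)))" by (simp add: K_def)
    then show ?thesis by blast
  qed
  have "AE x in L. x \<notin> (\<Union>j. K j) \<longrightarrow> g x = 0"
  proof (rule AE_I'[OF null], rule subsetI)
    fix x assume "x \<in> {x \<in> space L. \<not> (x \<notin> (\<Union>j. K j) \<longrightarrow> g x = 0)}"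
    then have x: "x \<notin> (\<Union>j. K j)" "g x \<noteq> 0" by auto
    obtain n where "1 \<le> of_nat (Suc n) * g x"
    proof (cases "g x")
      case (real r)
      then have "0 < r" using x(2) by auto
      then obtain n where "inverse (real (Suc n)) < r"
        using reals_Archimedean by blast
      then have "1 \<le> real (Suc n) * r"
        by (simp add: field_simps)
      then have "ennreal 1 \<le> ennreal (real (Suc n) * r)"
        by (rule ennreal_leI)
      also have "\<dots> = of_nat (Suc n) * g x"
        using real by (simp add: ennreal_mult ennreal_of_nat_eq_real_of_nat del: of_nat_Suc)
      finally show ?thesis
        using that by simp
    next
      case top
      then show ?thesis
        using that[of 0] by simp
    qed
    then have "x \<in> A n" by (simp add: A_def)
    then show "x \<in> (\<Union>n. A n - (\<Union>k. C n k))"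
      using x(1) CK by blast
  qed
  moreover have "compact (K j)" for j
    using C(1) by (auto simp: K_def split: nat.split prod.split)
  ultimately show ?thesis
    by (intro exI[of _ K] conjI allI) (simp_all add: K_def)
qed

text \<open>The compact sets \<open>K j\<close> have finite measure, so \<open>L\<close> on
  \<open>S0\<close> is \<open>\<sigma>\<close>-finite and has a strictly positive integrable
  function; normalised, it is the density of \<open>lam\<close>, and its reciprocal is
  \<open>h\<close>.\<close>

lemma exists_probability_reference:
  fixes L :: "'a::metric_space measure"
  assumes L: "radon_measure L" and K: "\<And>j. compact (K j)" and u: "undefined \<in> K (0::nat)"
  defines "S0 \<equiv> (\<Union>j. K j)"
  shows "\<exists>(lam :: 'a measure) (h :: 'a \<Rightarrow> real). prob_space lam \<and> sets lam = sets borel \<and>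
    (AE x in lam. x \<in> S0) \<and> h \<in> borel_measurable borel \<and> (\<forall>x. 0 \<le> h x) \<and>
    density L (indicator S0) = density lam (\<lambda>x. ennreal (h x))"
proof -
  have s [measurable_cong, simp]: "sets L = sets borel"
    using L by (simp add: radon_measure_def)
  then have sp [simp]: "space L = UNIV"
    using sets_eq_imp_space_eq[OF s] by simp
  have Kb [measurable]: "K j \<in> sets borel" for j
    using K by (intro borel_closed compact_imp_closed)
  have S0 [measurable]: "S0 \<in> sets borel"
    unfolding S0_def by measurable
  define L0 where "L0 = density L (indicator S0)"
  have s0 [measurable_cong, simp]: "sets L0 = sets borel" and sp0 [simp]: "space L0 = UNIV"
    by (simp_all add: L0_def)
  have L0: "emeasure L0 A = emeasure L (A \<inter> S0)" if "A \<in> sets borel" for A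
    using that emeasure_restr[of L S0 A] by (simp add: L0_def restr_def)
  interpret L0: sigma_finite_measure L0
  proof
    show "\<exists>A. countable A \<and> A \<subseteq> sets L0 \<and> \<Union>A = space L0 \<and> (\<forall>a\<in>A. emeasure L0 a \<noteq> \<infinity>)"
    proof (intro exI[of _ "insert (UNIV - S0) (range K)"] conjI ballI)
      show "\<Union>(insert (UNIV - S0) (range K)) = space L0"
        by (auto simp: S0_def)
      fix a assume "a \<in> insert (UNIV - S0) (range K)"
      then consider "a = UNIV - S0" | j where "a = K j" by blast
      then show "emeasure L0 a \<noteq> \<infinity>"
      proof cases
        case 1
        then have "a \<inter> S0 = {}" by blast
        with 1 show ?thesis by (simp add: L0)
      next
        case 2
        have "emeasure L0 a \<le> emeasure L (K j)"
          unfolding 2 L0[OF Kb] by (rule emeasure_mono) auto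
        also have "\<dots> < \<infinity>"
          using L K unfolding radon_measure_def by blast
        finally show ?thesis by simp
      qed
    qed (use Kb S0 in auto)
  qed
  obtain k where k [measurable]: "k \<in> borel_measurable L0" and k_fin: "(\<integral>\<^sup>+x. k x \<partial>L0) \<noteq> \<infinity>"
    and k_pos: "\<And>x. 0 < k x" "\<And>x. k x < \<infinity>"
    using L0.Ex_finite_integrable_function by auto
  define b where "b = (\<integral>\<^sup>+x. k x \<partial>L0)"
  show ?thesis
  proof (cases "b = 0")
    \<comment> \<open>Here \<open>L\<close> vanishes on \<open>S0\<close>, nothing can be
      normalised, and a point mass at \<open>undefined\<close>, which lies in \<open>S0\<close>,
      serves with \<open>h = 0\<close>.\<close>
    case True
    then have "AE x in L0. k x = 0"
      unfolding b_def by (subst (asm) nn_integral_0_iff_AE) auto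
    then have "AE x in L0. False"
      by (rule eventually_mono) (metis k_pos(1) less_irrefl)
    then have "emeasure L0 UNIV = 0"
      by (subst (asm) AE_iff_measurable[of UNIV]) auto
    then have "emeasure L0 A = 0" for A
      using emeasure_mono[of A UNIV L0] by simp
    then have "L0 = density (return borel undefined) (\<lambda>x. ennreal 0)"
      by (intro measure_eqI) (simp_all add: emeasure_density)
    moreover have "AE x in return borel undefined. x \<in> S0"
      using u by (subst AE_return) (auto simp: S0_def)
    ultimately show ?thesis
      by (intro exI[of _ "return borel undefined"] exI[of _ "\<lambda>_. 0"])
        (simp add: prob_space_return L0_def)
  next
    case False
    have b: "b \<noteq> \<infinity>" using k_fin by (simp add: b_def)
    define lam where "lam = density L0 (\<lambda>x. k x / b)"
    define h where "h x = enn2real (b / k x)" for x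
    have h: "ennreal (h x) = b / k x" for x
    proof -
      have "inverse (k x) < top"
        using k_pos(1)[of x] by (simp add: less_top[symmetric])
      then have "b / k x < \<infinity>"
        using b unfolding divide_ennreal_def by (simp add: ennreal_mult_less_top less_top)
      then show ?thesis by (simp add: h_def)
    qed
    have k' [measurable]: "k \<in> borel_measurable borel"
      using k by (simp cong: measurable_cong_sets)
    have "density lam (\<lambda>x. ennreal (h x)) = density L0 (\<lambda>x. k x / b * (b / k x))"
      unfolding lam_def h by (intro density_density_eq) measurable
    also have "\<dots> = density L0 (\<lambda>_. 1)"
    proof (rule arg_cong[where f = "density L0"], rule ext)
      fix x
      have "k x / b * (b / k x) = (k x * inverse (k x)) * (b * inverse b)"
        by (simp add: divide_ennreal_def ac_simps)
      also have "k x * inverse (k x) = 1"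
        using k_pos[of x] by (simp add: divide_ennreal_def[symmetric] ennreal_divide_self less_top)
      also have "b * inverse b = 1"
        using b False by (simp add: divide_ennreal_def[symmetric] ennreal_divide_self less_top)
      finally show "k x / b * (b / k x) = 1" by simp
    qed
    also have "\<dots> = L0"
      by (rule density_1)
    finally have eq: "L0 = density lam (\<lambda>x. ennreal (h x))" ..
    have "prob_space lam"
    proof
      have "emeasure lam (space lam) = (\<integral>\<^sup>+x. k x / b \<partial>L0)"
        by (simp add: lam_def emeasure_density)
      also have "\<dots> = b / b"
        unfolding b_def by (rule nn_integral_divide) simp
      also have "\<dots> = 1"
        using b False by (simp add: ennreal_divide_self less_top)
      finally show "emeasure lam (space lam) = 1" .
    qed
    moreover have "AE x in lam. x \<in> S0"
      unfolding lam_def L0_def by (simp add: AE_density indicator_def)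
    moreover have "h \<in> borel_measurable borel"
      unfolding h_def by measurable
    ultimately show ?thesis
      using eq by (intro exI[of _ lam] exI[of _ h]) (simp add: lam_def h_def L0_def)
  qed
qed

section \<open>Assembling the bound for the two processes\<close>

theorem theorem3p7:
  fixes L :: "'a::metric_space measure"
    and m :: "'a \<Rightarrow> real"
    and P :: "'w measure" and \<Phi> :: "'w \<Rightarrow> 'a measure"
    and Q :: "'v measure" and \<zeta> :: "'v \<Rightarrow> 'a measure"
    and c :: "'a \<Rightarrow> 'a measure \<Rightarrow> real"
  assumes "locally_compact_space (euclidean :: 'a topology)"
    and "radon_measure L"
    and "m \<in> borel_measurable borel" and "\<And>x. 0 \<le> m x"
    and "finite_measure (density L (\<lambda>x. ennreal (m x)))"
    and "poisson_process Q (density L (\<lambda>x. ennreal (m x))) \<zeta>"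
    and "finite_point_process P \<Phi>"
    and "papangelou_intensity P L \<Phi> c"
  shows "kr_tv_dist (distr P config_space \<Phi>) (distr Q config_space \<zeta>)
    \<le> (\<integral>\<^sup>+x. (\<integral>\<^sup>+\<omega>. ennreal \<bar>m x - c x (\<Phi> \<omega>)\<bar> \<partial>P) \<partial>L)"
proof (cases "(\<integral>\<^sup>+x. (\<integral>\<^sup>+\<omega>. ennreal \<bar>m x - c x (\<Phi> \<omega>)\<bar> \<partial>P) \<partial>L) = \<infinity>")
  case False
  let ?R = "\<integral>\<^sup>+x. (\<integral>\<^sup>+\<omega>. ennreal \<bar>m x - c x (\<Phi> \<omega>)\<bar> \<partial>P) \<partial>L"
  let ?M = "density L (\<lambda>x. ennreal (m x))"
  have sL [measurable_cong, simp]: "sets L = sets borel"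
    using assms(2) by (simp add: radon_measure_def)
  then have spL [simp]: "space L = UNIV"
    using sets_eq_imp_space_eq[OF sL] by simp
  note m_meas [measurable] = assms(3) and m_nonneg = assms(4)
  have P: "prob_space P" and \<Phi> [measurable]: "\<Phi> \<in> measurable P config_space"
    and \<Phi>_fin: "AE \<omega> in P. \<Phi> \<omega> \<in> finite_configurations"
    using assms(7) by (simp_all add: finite_point_process_def point_process_def)
  have Q: "prob_space Q"
    using assms(6) by (simp add: poisson_process_def point_process_def)
  have c_meas [measurable]: "case_prod c \<in> borel_measurable (borel \<Otimes>\<^sub>M config_space)"
    and c_nonneg: "\<And>x \<phi>. \<phi> \<in> configurations \<Longrightarrow> 0 \<le> c x \<phi>"
    using assms(8) by (simp_all add: papangelou_intensity_def)
  interpret PS: prob_space P by fact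
  interpret poisson ?M Q \<zeta>
    using assms(5,6) Q by (auto simp: poisson_def poisson_axioms_def)
  define mu where "mu = distr P config_space \<Phi>"
  interpret mu: prob_space mu
    unfolding mu_def by (rule PS.prob_space_distr) simp
  have s_mu [measurable_cong, simp]: "sets mu = sets config_space"
    by (simp add: mu_def)
  have sp_mu [simp]: "space mu = configurations"
    by (simp add: mu_def)
  have to_mu: "(\<integral>\<^sup>+\<omega>. F (\<Phi> \<omega>) \<partial>P) = (\<integral>\<^sup>+\<phi>. F \<phi> \<partial>mu)" if "F \<in> borel_measurable config_space" for F
    unfolding mu_def using that by (intro nn_integral_distr[symmetric]) auto
  have papangelou: "(\<integral>\<^sup>+\<omega>. (\<integral>\<^sup>+x. ennreal (u x (remove_point (\<Phi> \<omega>) x)) \<partial>\<Phi> \<omega>) \<partial>P) =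
      (\<integral>\<^sup>+x. (\<integral>\<^sup>+\<phi>. ennreal (c x \<phi> * u x \<phi>) \<partial>mu) \<partial>L)"
    if u [measurable]: "case_prod u \<in> borel_measurable (borel \<Otimes>\<^sub>M config_space)"
      and "\<And>x \<phi>. \<phi> \<in> configurations \<Longrightarrow> 0 \<le> u x \<phi>" for u
  proof -
    have "(\<integral>\<^sup>+\<omega>. (\<integral>\<^sup>+x. ennreal (u x (remove_point (\<Phi> \<omega>) x)) \<partial>\<Phi> \<omega>) \<partial>P) =
        (\<integral>\<^sup>+x. (\<integral>\<^sup>+\<omega>. ennreal (c x (\<Phi> \<omega>) * u x (\<Phi> \<omega>)) \<partial>P) \<partial>L)"
      using assms(8) that unfolding papangelou_intensity_def by blast
    also have "\<dots> = (\<integral>\<^sup>+x. (\<integral>\<^sup>+\<phi>. ennreal (c x \<phi> * u x \<phi>) \<partial>mu) \<partial>L)"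
      by (intro nn_integral_cong to_mu) measurable
    finally show ?thesis .
  qed
  \<comment> \<open>The mean intensity of \<open>\<Phi>\<close> at \<open>x\<close>. The triangle
    inequality bounds it by \<open>m\<close> plus the integrand of the finite right-hand side, so it
    is integrable.\<close>
  define i where "i x = (\<integral>\<^sup>+\<phi>. ennreal (c x \<phi>) \<partial>mu)" for x
  have i [measurable]: "i \<in> borel_measurable borel"
    unfolding i_def by measurable
  let ?D = "\<lambda>x. \<integral>\<^sup>+\<phi>. ennreal \<bar>m x - c x \<phi>\<bar> \<partial>mu"
  have R: "?R = (\<integral>\<^sup>+x. ?D x \<partial>L)"
    by (intro nn_integral_cong to_mu) measurable
  have i_le: "i x \<le> ennreal (m x) + ?D x" for x
  proof -
    have "i x \<le> (\<integral>\<^sup>+\<phi>. ennreal (m x) + ennreal \<bar>m x - c x \<phi>\<bar> \<partial>mu)"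
      unfolding i_def
    proof (rule nn_integral_mono)
      fix \<phi>
      have "ennreal (c x \<phi>) \<le> ennreal (m x + \<bar>m x - c x \<phi>\<bar>)"
        by (intro ennreal_leI) linarith
      then show "ennreal (c x \<phi>) \<le> ennreal (m x) + ennreal \<bar>m x - c x \<phi>\<bar>"
        using m_nonneg by simp
    qed
    also have "\<dots> = ennreal (m x) + ?D x"
      using mu.emeasure_space_1 by (subst nn_integral_add) simp_all
    finally show ?thesis .
  qed
  have m_fin: "(\<integral>\<^sup>+x. ennreal (m x) \<partial>L) < \<infinity>"
    using emeasure_finite[of UNIV] by (simp add: emeasure_density less_top)
  have i_fin: "(\<integral>\<^sup>+x. i x \<partial>L) < \<infinity>"
  proof -
    have "(\<integral>\<^sup>+x. i x \<partial>L) \<le>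
        (\<integral>\<^sup>+x. ennreal (m x) + ?D x \<partial>L)"
      by (intro nn_integral_mono i_le)
    also have "\<dots> = (\<integral>\<^sup>+x. ennreal (m x) \<partial>L) + ?R"
      unfolding R by (intro nn_integral_add) measurable
    also have "\<dots> < \<infinity>"
      using m_fin False by (simp add: less_top)
    finally show ?thesis .
  qed
  have "(\<integral>\<^sup>+x. ennreal (m x) + i x \<partial>L) < \<infinity>"
    using m_fin i_fin by (subst nn_integral_add) simp_all
  \<comment> \<open>One carrier for \<open>m\<close> and \<open>i\<close> together, so that both
    laws live over the same \<open>S0\<close>.\<close>
  then have "\<exists>K :: nat \<Rightarrow> 'a set. (\<forall>j. compact (K j)) \<and> undefined \<in> K 0 \<and>
      (AE x in L. x \<notin> (\<Union>j. K j) \<longrightarrow> ennreal (m x) + i x = 0)"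
    by (intro exists_sigma_compact_carrier[OF assms(2)]) measurable
  then obtain K :: "nat \<Rightarrow> 'a set" where K_all: "\<forall>j. compact (K j)" and K: "undefined \<in> K 0"
    "AE x in L. x \<notin> (\<Union>j. K j) \<longrightarrow> ennreal (m x) + i x = 0"
    by (elim exE conjE)
  have K_compact: "compact (K j)" for j
    using K_all by simp
  define S0 where "S0 = (\<Union>j. K j)"
  obtain lam h where lam: "prob_space lam" "sets lam = sets borel" "AE x in lam. x \<in> S0"
    and h [measurable]: "h \<in> borel_measurable borel" and h_all: "\<forall>x. 0 \<le> h x"
    and dens: "density L (indicator S0) = density lam (\<lambda>x. ennreal (h x))"
    using exists_probability_reference[OF assms(2), of K, OF K_compact K(1)] unfolding S0_def by (elim exE conjE)
  have h_nonneg: "0 \<le> h x" for x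
    using h_all by simp
  have null: "AE x in L. x \<notin> S0 \<longrightarrow> m x = 0 \<and> i x = 0"
    using K(2) unfolding S0_def[symmetric]
    by eventually_elim (use m_nonneg in \<open>auto simp: antisym\<close>)
  interpret carrier lam K S0
    using lam K_compact
    by (intro carrier.intro carrier_axioms.intro reference.intro reference_axioms.intro
        compact_relcompact_borel S0_def)
  \<comment> \<open>On \<open>S0\<close> integration against \<open>L\<close> is integration against
    \<open>lam\<close> with the factor \<open>h\<close>, so both intensities pick up this factor
    when taken relative to \<open>lam\<close>.\<close>
  have transfer: "(\<integral>\<^sup>+x. ennreal (h x) * F x \<partial>lam) = (\<integral>\<^sup>+x. indicator S0 x * F x \<partial>L)"
    if [measurable]: "F \<in> borel_measurable borel" for F
  proof -
    have "(\<integral>\<^sup>+x. ennreal (h x) * F x \<partial>lam) = (\<integral>\<^sup>+x. F x \<partial>density lam (\<lambda>x. ennreal (h x)))"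
      by (intro nn_integral_density[symmetric]) measurable
    also have "\<dots> = (\<integral>\<^sup>+x. indicator S0 x * F x \<partial>L)"
      unfolding dens[symmetric] by (intro nn_integral_density) measurable
    finally show ?thesis .
  qed
  have transfer_le: "(\<integral>\<^sup>+x. ennreal (h x) * F x \<partial>lam) \<le> (\<integral>\<^sup>+x. F x \<partial>L)"
    if "F \<in> borel_measurable borel" for F
    unfolding transfer[OF that] by (intro nn_integral_mono) (simp add: indicator_def)
  have pmu: "papangelou_law lam K S0 mu (\<lambda>x \<phi>. h x * c x \<phi>)"
  proof unfold_locales
    show "(\<lambda>(x, \<phi>). h x * c x \<phi>) \<in> borel_measurable (borel \<Otimes>\<^sub>M config_space)"
      by measurable
    show "0 \<le> h x * c x \<phi>" if "\<phi> \<in> configurations" for x \<phi>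
      using h_nonneg c_nonneg[OF that] by simp
    show "(\<integral>\<^sup>+x. \<integral>\<^sup>+\<phi>. ennreal (h x * c x \<phi>) \<partial>mu \<partial>lam) < \<infinity>"
    proof -
      have "(\<integral>\<^sup>+\<phi>. ennreal (h x * c x \<phi>) \<partial>mu) = ennreal (h x) * i x" for x
        unfolding i_def by (subst nn_integral_cmult[symmetric])
          (auto simp: h_nonneg c_nonneg ennreal_mult intro!: nn_integral_cong)
      then show ?thesis
        using transfer_le[OF i] i_fin by simp
    qed
    \<comment> \<open>The Papangelou equation with the indicator of \<open>A\<close> as test
      function: the mean count on \<open>A\<close> is the integral of \<open>i\<close> over
      \<open>A\<close>, and \<open>i\<close> vanishes almost everywhere off
      \<open>S0\<close>.\<close>
    show "AE \<phi> in mu. emeasure \<phi> A = 0" if A: "A \<in> relcompact_borel" "A \<inter> S0 = {}" for A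
    proof -
      have [measurable]: "A \<in> sets borel" using A(1) by (rule relcompact_borel_sets)
      have cnt: "(\<lambda>\<phi>. emeasure \<phi> A) \<in> borel_measurable config_space"
        using A(1) by (intro measurable_count measurable_ident_sets) simp_all
      have "(\<integral>\<^sup>+\<phi>. emeasure \<phi> A \<partial>mu) = (\<integral>\<^sup>+\<omega>. emeasure (\<Phi> \<omega>) A \<partial>P)"
        by (rule to_mu[OF cnt, symmetric])
      also have "\<dots> = (\<integral>\<^sup>+\<omega>. (\<integral>\<^sup>+x. ennreal (indicator A x) \<partial>\<Phi> \<omega>) \<partial>P)"
        using measurable_space[OF \<Phi>]
        by (intro nn_integral_cong) (simp add: ennreal_indicator configurations_sets)
      also have "\<dots> = (\<integral>\<^sup>+x. (\<integral>\<^sup>+\<phi>. ennreal (c x \<phi> * indicator A x) \<partial>mu) \<partial>L)"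
        by (rule papangelou) simp_all
      also have "\<dots> = (\<integral>\<^sup>+x. 0 \<partial>L)"
      proof (rule nn_integral_cong_AE)
        show "AE x in L. (\<integral>\<^sup>+\<phi>. ennreal (c x \<phi> * indicator A x) \<partial>mu) = 0"
          using null
        proof eventually_elim
          case (elim x)
          show ?case
          proof (cases "x \<in> A")
            case True
            then have "x \<notin> S0" using A(2) by blast
            with elim True show ?thesis by (simp add: i_def)
          qed simp
        qed
      qed
      finally have "(\<integral>\<^sup>+\<phi>. emeasure \<phi> A \<partial>mu) = 0" by simp
      then show ?thesis
        by (rule nn_integral_0_iff_AE[THEN iffD1, rotated])
          (use cnt in \<open>simp cong: measurable_cong_sets\<close>)
    qed
    show "(\<integral>\<^sup>+\<phi>. emeasure \<phi> A * indicator B \<phi> \<partial>mu) = (\<integral>\<^sup>+x. indicator A x *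
        (\<integral>\<^sup>+\<phi>. ennreal (h x * c x \<phi>) * indicator B (add_point x \<phi>) \<partial>mu) \<partial>lam)"
      if A [measurable]: "A \<in> sets borel" and sub: "A \<subseteq> S0" and B [measurable]: "B \<in> sets config_space"
      for A B
    proof -
      define J where "J x = (\<integral>\<^sup>+\<phi>. ennreal (c x \<phi>) * indicator B (add_point x \<phi>) \<partial>mu)" for x
      have J [measurable]: "J \<in> borel_measurable borel"
        unfolding J_def by measurable
      define cnt where "cnt \<phi> = emeasure \<phi> A" for \<phi> :: "'a measure"
      let ?H = "\<lambda>x. \<integral>\<^sup>+\<phi>. ennreal (h x * c x \<phi>) * indicator B (add_point x \<phi>) \<partial>mu"
      have [measurable]: "cnt \<in> borel_measurable config_space"
        unfolding cnt_def using A sub by (intro measurable_count_subset measurable_ident_sets) simp_all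
      \<comment> \<open>Evaluated after removing \<open>x\<close>, this gives the indicators of
        \<open>A\<close> at \<open>x\<close> and of \<open>B\<close> at
        \<open>\<Phi> \<omega>\<close>, provided that adding \<open>x\<close> restores
        \<open>\<Phi> \<omega>\<close>.\<close>
      let ?u = "\<lambda>x \<phi>. indicator A x * indicator B (add_point x \<phi>) :: real"
      let ?U = "\<lambda>\<omega>. \<integral>\<^sup>+x. ennreal (?u x (remove_point (\<Phi> \<omega>) x)) \<partial>\<Phi> \<omega>"
      have "(\<integral>\<^sup>+\<phi>. emeasure \<phi> A * indicator B \<phi> \<partial>mu) = (\<integral>\<^sup>+\<omega>. cnt (\<Phi> \<omega>) * indicator B (\<Phi> \<omega>) \<partial>P)"
        unfolding cnt_def[symmetric] by (rule to_mu[symmetric]) measurable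
      also have "\<dots> = (\<integral>\<^sup>+\<omega>. ?U \<omega> \<partial>P)"
      proof (rule nn_integral_cong_AE)
        show "AE \<omega> in P. cnt (\<Phi> \<omega>) * indicator B (\<Phi> \<omega>) =
            ?U \<omega>"
          using \<Phi>_fin
        proof eventually_elim
          case (elim \<omega>)
          then have conf: "\<Phi> \<omega> \<in> configurations"
            by (simp add: finite_configurations_def)
          \<comment> \<open>\<open>A\<close> lies in a countable union of compact sets, so almost
            every point of \<open>\<Phi> \<omega>\<close> in \<open>A\<close> is an atom; as
            \<open>\<Phi> \<omega>\<close> is finite, removing such a point can be undone.\<close>
          have "AE x in \<Phi> \<omega>. \<forall>j. x \<in> K j \<longrightarrow> 1 \<le> emeasure (\<Phi> \<omega>) {x}"
            unfolding AE_all_countable using AE_atom_on_compact[OF conf K_compact] by blast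
          then have "AE x in \<Phi> \<omega>. ennreal (?u x (remove_point (\<Phi> \<omega>) x)) =
              indicator B (\<Phi> \<omega>) * indicator A x"
          proof eventually_elim
            case atoms: (elim x)
            have "add_point x (remove_point (\<Phi> \<omega>) x) = \<Phi> \<omega>" if "x \<in> A"
              using atoms that sub elim by (intro add_point_remove_point) (auto simp: S0_def)
            then show ?case
              by (auto simp: indicator_def)
          qed
          then have "?U \<omega> =
              (\<integral>\<^sup>+x. indicator B (\<Phi> \<omega>) * indicator A x \<partial>\<Phi> \<omega>)"
            by (rule nn_integral_cong_AE)
          also have "\<dots> = indicator B (\<Phi> \<omega>) * cnt (\<Phi> \<omega>)"
            unfolding cnt_def using conf by (intro nn_integral_cmult_indicator) (simp add: configurations_sets)
          finally show ?case
            by (simp add: mult.commute)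
        qed
      qed
      also have "\<dots> = (\<integral>\<^sup>+x. (\<integral>\<^sup>+\<phi>. ennreal (c x \<phi> * ?u x \<phi>) \<partial>mu) \<partial>L)"
        by (rule papangelou) simp_all
      also have "\<dots> = (\<integral>\<^sup>+x. indicator S0 x * (indicator A x * J x) \<partial>L)"
      proof (rule nn_integral_cong)
        fix x
        have "(\<integral>\<^sup>+\<phi>. ennreal (c x \<phi> * ?u x \<phi>) \<partial>mu) =
            (\<integral>\<^sup>+\<phi>. indicator A x * (ennreal (c x \<phi>) * indicator B (add_point x \<phi>)) \<partial>mu)"
          by (intro nn_integral_cong) (simp add: indicator_def)
        also have "\<dots> = indicator A x * J x"
          unfolding J_def by (rule nn_integral_cmult) measurable
        finally show "(\<integral>\<^sup>+\<phi>. ennreal (c x \<phi> * ?u x \<phi>) \<partial>mu) = indicator S0 x * (indicator A x * J x)"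
          using sub by (auto simp: indicator_def)
      qed
      also have "\<dots> = (\<integral>\<^sup>+x. ennreal (h x) * (indicator A x * J x) \<partial>lam)"
        by (rule transfer[symmetric]) measurable
      also have "\<dots> = (\<integral>\<^sup>+x. indicator A x *
          ?H x \<partial>lam)"
      proof (rule nn_integral_cong)
        fix x
        have "ennreal (h x) * J x =
            (\<integral>\<^sup>+\<phi>. ennreal (h x) * (ennreal (c x \<phi>) * indicator B (add_point x \<phi>)) \<partial>mu)"
          unfolding J_def by (rule nn_integral_cmult[symmetric]) measurable
        also have "\<dots> = ?H x"
          by (intro nn_integral_cong) (simp add: ennreal_mult h_nonneg c_nonneg mult.assoc)
        finally have "?H x =
            ennreal (h x) * J x" ..
        then show "ennreal (h x) * (indicator A x * J x) = indicator A x *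
            ?H x"
          by (simp only: mult.left_commute)
      qed
      finally show ?thesis .
    qed
  qed (use s_mu in simp_all)
  have plaw: "papangelou_law lam K S0 law (\<lambda>x \<phi>. h x * m x)"
  proof unfold_locales
    show "(\<lambda>(x, \<phi>). h x * m x) \<in> borel_measurable (borel \<Otimes>\<^sub>M config_space)"
      by measurable
    show "0 \<le> h x * m x" for x
      using h_nonneg m_nonneg by simp
    show "(\<integral>\<^sup>+x. \<integral>\<^sup>+\<phi>. ennreal (h x * m x) \<partial>law \<partial>lam) < \<infinity>"
    proof -
      have "(\<integral>\<^sup>+\<phi>. ennreal (h x * m x) \<partial>law) = ennreal (h x) * ennreal (m x)" for x
        using law.emeasure_space_1 by (simp add: ennreal_mult h_nonneg m_nonneg)
      then show ?thesis
        using transfer_le[of "\<lambda>x. ennreal (m x)"] m_fin by simp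
    qed
    show "AE \<phi> in law. emeasure \<phi> A = 0" if A: "A \<in> relcompact_borel" "A \<inter> S0 = {}" for A
    proof (rule void_probability[OF A(1)])
      have [measurable]: "A \<in> sets borel" using A(1) by (rule relcompact_borel_sets)
      have "emeasure ?M A = (\<integral>\<^sup>+x. ennreal (m x) * indicator A x \<partial>L)"
        by (intro emeasure_density) simp_all
      also have "\<dots> = (\<integral>\<^sup>+x. 0 \<partial>L)"
        using null A(2) by (intro nn_integral_cong_AE) (auto simp: indicator_def)
      finally show "emeasure ?M A = 0" by simp
    qed
    show "(\<integral>\<^sup>+\<phi>. emeasure \<phi> A * indicator B \<phi> \<partial>law) = (\<integral>\<^sup>+x. indicator A x *
        (\<integral>\<^sup>+\<phi>. ennreal (h x * m x) * indicator B (add_point x \<phi>) \<partial>law) \<partial>lam)"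
      if A [measurable]: "A \<in> sets borel" and sub: "A \<subseteq> S0" and B [measurable]: "B \<in> sets config_space"
      for A B
    proof -
      define J where "J x = (\<integral>\<^sup>+\<phi>. indicator B (add_point x \<phi>) \<partial>law)" for x
      have J [measurable]: "J \<in> borel_measurable borel"
        unfolding J_def by measurable
      \<comment> \<open>\<open>law_mecke\<close> covers relatively compact sets only; monotone
        convergence along this exhaustion extends it to \<open>A\<close>.\<close>
      let ?A = "\<lambda>j. A \<inter> (\<Union>i\<le>j. K i)"
      let ?H = "\<lambda>x. \<integral>\<^sup>+\<phi>. ennreal (h x * m x) * indicator B (add_point x \<phi>) \<partial>law"
      have rc: "?A j \<in> relcompact_borel" for j
        using A relcompact_borel_sets[OF relcompact_partial_union[of j]]
        by (intro relcompact_borel_subset[OF relcompact_partial_union[of j]]) auto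
      note rcb [measurable] = relcompact_borel_sets[OF rc]
      have UN: "(\<Union>j. ?A j) = A"
        using sub unfolding S0_def by auto
      have inc: "incseq ?A"
        by (rule incseq_SucI) (auto simp: atMost_Suc)
      have "(\<integral>\<^sup>+\<phi>. emeasure \<phi> A * indicator B \<phi> \<partial>law) =
          (\<integral>\<^sup>+\<phi>. (SUP j. emeasure \<phi> (?A j) * indicator B \<phi>) \<partial>law)"
      proof (rule nn_integral_cong)
        fix \<phi> assume "\<phi> \<in> space law"
        then have "(SUP j. emeasure \<phi> (?A j)) = emeasure \<phi> (\<Union>j. ?A j)"
          using rcb by (intro SUP_emeasure_incseq inc) (auto simp: configurations_sets)
        then show "emeasure \<phi> A * indicator B \<phi> = (SUP j. emeasure \<phi> (?A j) * indicator B \<phi>)"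
          unfolding UN by (simp only: SUP_mult_right_ennreal[symmetric])
      qed
      also have "\<dots> = (SUP j. \<integral>\<^sup>+\<phi>. emeasure \<phi> (?A j) * indicator B \<phi> \<partial>law)"
      proof (rule nn_integral_monotone_convergence_SUP_AE)
        fix j
        show "AE \<phi> in law. emeasure \<phi> (?A j) * indicator B \<phi> \<le> emeasure \<phi> (?A (Suc j)) * indicator B \<phi>"
        proof (rule AE_I2)
          fix \<phi> assume "\<phi> \<in> space law"
          then have "emeasure \<phi> (?A j) \<le> emeasure \<phi> (?A (Suc j))"
            using rcb incseq_SucD[OF inc] by (intro emeasure_mono) (auto simp: configurations_sets)
          then show "emeasure \<phi> (?A j) * indicator B \<phi> \<le> emeasure \<phi> (?A (Suc j)) * indicator B \<phi>"
            by (rule mult_right_mono) simp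
        qed
        have "(\<lambda>\<phi>. emeasure \<phi> (?A j)) \<in> borel_measurable law"
          using rc by (intro measurable_count measurable_ident_sets) simp_all
        then show "(\<lambda>\<phi>. emeasure \<phi> (?A j) * indicator B \<phi>) \<in> borel_measurable law"
          by (rule borel_measurable_times_ennreal) simp
      qed
      also have "\<dots> = (SUP j. \<integral>\<^sup>+x. indicator (?A j) x * J x \<partial>?M)"
        unfolding J_def by (intro SUP_cong refl law_mecke rc B)
      also have "\<dots> = (SUP j. emeasure (density ?M J) (?A j))"
        using rcb by (intro SUP_cong refl) (simp add: emeasure_density mult.commute)
      also have "\<dots> = emeasure (density ?M J) A"
      proof -
        have "range ?A \<subseteq> sets (density ?M J)"
          by (intro image_subsetI) (simp only: sets_density sL rcb)
        from SUP_emeasure_incseq[OF this inc] show ?thesis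
          unfolding UN .
      qed
      also have "\<dots> = (\<integral>\<^sup>+x. indicator A x * J x \<partial>?M)"
        by (simp add: emeasure_density mult.commute)
      also have "\<dots> = (\<integral>\<^sup>+x. ennreal (m x) * (indicator A x * J x) \<partial>L)"
        by (intro nn_integral_density) measurable
      also have "\<dots> = (\<integral>\<^sup>+x. indicator S0 x * (ennreal (m x) * (indicator A x * J x)) \<partial>L)"
        using sub by (intro nn_integral_cong) (auto simp: indicator_def)
      also have "\<dots> = (\<integral>\<^sup>+x. ennreal (h x) * (ennreal (m x) * (indicator A x * J x)) \<partial>lam)"
        by (rule transfer[symmetric]) measurable
      also have "\<dots> = (\<integral>\<^sup>+x. indicator A x *
          ?H x \<partial>lam)"
      proof (rule nn_integral_cong)
        fix x
        have "?H x =
            ennreal (h x * m x) * J x"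
          unfolding J_def by (rule nn_integral_cmult) measurable
        then show "ennreal (h x) * (ennreal (m x) * (indicator A x * J x)) = indicator A x *
            ?H x"
          by (simp add: ennreal_mult h_nonneg m_nonneg ac_simps)
      qed
      finally show ?thesis .
    qed
  qed simp_all
  obtain C where C: "C \<in> couplings mu law"
    and cost: "(\<integral>\<^sup>+(\<phi>, \<psi>). tv_dist \<phi> \<psi> \<partial>C) \<le>
      (\<integral>\<^sup>+x. \<integral>\<^sup>+\<phi>. \<integral>\<^sup>+\<psi>. ennreal \<bar>h x * c x \<phi> - h x * m x\<bar> \<partial>law \<partial>mu \<partial>lam)"
    using coupling_of_papangelou_laws[OF pmu plaw] by blast
  have "kr_tv_dist mu law \<le> (\<integral>\<^sup>+(\<phi>, \<psi>). tv_dist \<phi> \<psi> \<partial>C)"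
    unfolding kr_tv_dist_def using C by (rule INF_lower)
  also note cost
  \<comment> \<open>The second intensity does not depend on \<open>\<psi>\<close>, so the integral
    over \<open>law\<close> drops out and the common factor \<open>h x\<close> can be pulled
    out.\<close>
  also have "(\<integral>\<^sup>+x. \<integral>\<^sup>+\<phi>. \<integral>\<^sup>+\<psi>. ennreal \<bar>h x * c x \<phi> - h x * m x\<bar> \<partial>law \<partial>mu \<partial>lam) =
      (\<integral>\<^sup>+x. ennreal (h x) * ?D x \<partial>lam)"
  proof (rule nn_integral_cong)
    fix x
    have "\<bar>h x * c x \<phi> - h x * m x\<bar> = h x * \<bar>m x - c x \<phi>\<bar>" for \<phi>
      using h_nonneg[of x] by (simp add: right_diff_distrib[symmetric] abs_mult abs_minus_commute)
    then have "(\<integral>\<^sup>+\<phi>. \<integral>\<^sup>+\<psi>. ennreal \<bar>h x * c x \<phi> - h x * m x\<bar> \<partial>law \<partial>mu) =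
        (\<integral>\<^sup>+\<phi>. ennreal (h x) * ennreal \<bar>m x - c x \<phi>\<bar> \<partial>mu)"
      using law.emeasure_space_1 by (simp add: ennreal_mult h_nonneg)
    also have "\<dots> = ennreal (h x) * ?D x"
      by (rule nn_integral_cmult) measurable
    finally show "(\<integral>\<^sup>+\<phi>. \<integral>\<^sup>+\<psi>. ennreal \<bar>h x * c x \<phi> - h x * m x\<bar> \<partial>law \<partial>mu) =
        ennreal (h x) * ?D x" .
  qed
  also have "\<dots> \<le> ?R"
    unfolding R by (rule transfer_le) measurable
  finally show ?thesis
    unfolding mu_def law_def .
qed simp

end
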